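(* Let $A$ be a ring that is either a Noetherian local ring or a standard graded ring, let $I$ be an ideal of $A$, and let $f,g,h\in I$ (in the graded case, $I$ and $f,g,h$ are homogeneous). Assume that $(f,h)$ is a regular sequence in $A$. Assume also that $H^i_I(A)=0$ for $i>2$, and let $M=H^2_I(A)$. Then the following are equivalent: (1) $\sqrt{I}=\sqrt{(f,g,h)}$; (2) $H^i(f,g,h;M)=0$ for $i\ge 2$.
   Context: $H^i_I(-)$ denotes local cohomology with support in $I$. In the graded case all modules are graded and all ideals and elements are homogeneous. For elements $x_1,\ldots,x_r\in A$ and an $A$-module $M$, $H^i(x_1,\ldots,x_r;M)$ is the $i$-th Koszul cohomology group, i.e. the $i$-th cohomology of the Koszul cochain complex $K^\bullet(x_1,\ldots,x_r;M)=\operatorname{Hom}_A(K_\bullet(x_1,\ldots,x_r),M)$, so $H^0(x_1,\ldots,x_r;M)=0:_M(x_1,\ldots,x_r)$ and $H^r(x_1,\ldots,x_r;M)=M/(x_1,\ldots,x_r)M$.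
   Formalization: I is assumed proper (for I = A the claim fails: A = k[[x,y]], f = x, h = y, g = 0), and a standard graded ring is taken to be Noetherian with local degree-zero part, which includes the usual case of a field. *)

theory Defs
  imports "HOL-Algebra.Algebra"
begin

section \<open>Rings and ideals\<close>

definition noetherian_local_ring :: "('a, 'z) ring_scheme \<Rightarrow> bool" where
  "noetherian_local_ring R \<longleftrightarrow>
     cring R \<and> noetherian_ring R \<and> (\<exists>!m. maximalideal m R)"

definition graded_ring :: "('a, 'z) ring_scheme \<Rightarrow> (nat \<Rightarrow> 'a set) \<Rightarrow> bool" where
  "graded_ring R A \<longleftrightarrow>
     cring R \<and>
     (\<forall>i. additive_subgroup (A i) R) \<and>
     (\<forall>x\<in>carrier R. \<exists>!c. (\<forall>i. c i \<in> A i) \<and> finite {i. c i \<noteq> \<zero>\<^bsub>R\<^esub>} \<and>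
                          x = finsum R c {i. c i \<noteq> \<zero>\<^bsub>R\<^esub>}) \<and>
     \<one>\<^bsub>R\<^esub> \<in> A 0 \<and>
     (\<forall>i j. \<forall>a\<in>A i. \<forall>b\<in>A j. a \<otimes>\<^bsub>R\<^esub> b \<in> A (i + j))"

text \<open>A standard graded ring is Noetherian, nonnegatively graded and generated in degree one over
  its degree zero part, which is a local ring; the usual case of a field in degree zero is
  included. Some such condition on the degree zero part is indispensable, because homogeneous
  proper ideals have to lie in a common homogeneous maximal ideal.\<close>

definition standard_graded_ring :: "('a, 'z) ring_scheme \<Rightarrow> (nat \<Rightarrow> 'a set) \<Rightarrow> bool" where
  "standard_graded_ring R A \<longleftrightarrow>
     graded_ring R A \<and> noetherian_ring R \<and>
     noetherian_local_ring (R\<lparr>carrier := A 0\<rparr>) \<and>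
     generate_ring R (A 0 \<union> A 1) = carrier R"

definition homogeneous_elements :: "(nat \<Rightarrow> 'a set) \<Rightarrow> 'a set" where
  "homogeneous_elements A = (\<Union>i. A i)"

definition homogeneous_ideal :: "('a, 'z) ring_scheme \<Rightarrow> (nat \<Rightarrow> 'a set) \<Rightarrow> 'a set \<Rightarrow> bool" where
  "homogeneous_ideal R A I \<longleftrightarrow> ideal I R \<and> I = genideal R (I \<inter> homogeneous_elements A)"

definition radical :: "('a, 'z) ring_scheme \<Rightarrow> 'a set \<Rightarrow> 'a set" where
  "radical R I = {x \<in> carrier R. \<exists>n::nat. x [^]\<^bsub>R\<^esub> n \<in> I}"

text \<open>Each entry is a nonzerodivisor modulo the ideal of the preceding ones, and the ideal of all
  entries is proper.\<close>

definition regular_sequence :: "('a, 'z) ring_scheme \<Rightarrow> 'a list \<Rightarrow> bool" where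
  "regular_sequence R xs \<longleftrightarrow>
     set xs \<subseteq> carrier R \<and>
     (\<forall>k<length xs. \<forall>a\<in>carrier R.
        xs ! k \<otimes>\<^bsub>R\<^esub> a \<in> genideal R (set (take k xs)) \<longrightarrow> a \<in> genideal R (set (take k xs))) \<and>
     genideal R (set xs) \<noteq> carrier R"


section \<open>Modules and cohomology\<close>

text \<open>The record type of modules extends that of rings; the ring multiplication and unit of a
  module play no role and are left unspecified below.\<close>

definition mod_hom ::
  "('a, 'z) ring_scheme \<Rightarrow> ('a, 'b) module \<Rightarrow> ('a, 'c) module \<Rightarrow> ('b \<Rightarrow> 'c) set" where
  "mod_hom R M N =
     {\<phi> \<in> carrier M \<rightarrow> carrier N.
        (\<forall>x\<in>carrier M. \<forall>y\<in>carrier M. \<phi> (x \<oplus>\<^bsub>M\<^esub> y) = \<phi> x \<oplus>\<^bsub>N\<^esub> \<phi> y) \<and>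
        (\<forall>a\<in>carrier R. \<forall>x\<in>carrier M. \<phi> (a \<odot>\<^bsub>M\<^esub> x) = a \<odot>\<^bsub>N\<^esub> \<phi> x)}"

definition self_module :: "('a, 'z) ring_scheme \<Rightarrow> ('a, 'a) module" where
  "self_module R = \<lparr>carrier = carrier R, monoid.mult = monoid.mult R, monoid.one = \<one>\<^bsub>R\<^esub>,
                    ring.zero = \<zero>\<^bsub>R\<^esub>, ring.add = ring.add R, smult = monoid.mult R\<rparr>"

definition zero_module :: "('a, 'b) module \<Rightarrow> bool" where
  "zero_module M \<longleftrightarrow> carrier M = {\<zero>\<^bsub>M\<^esub>}"

definition quotient_module :: "('a, 'b) module \<Rightarrow> 'b set \<Rightarrow> ('a, 'b set) module" where
  "quotient_module M N =
     \<lparr>carrier = a_rcosets\<^bsub>M\<^esub> N, monoid.mult = undefined, monoid.one = undefined,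
      ring.zero = N, ring.add = set_add M,
      smult = (\<lambda>a U. \<Union>x\<in>U. N +>\<^bsub>M\<^esub> (a \<odot>\<^bsub>M\<^esub> x))\<rparr>"

definition cocycles :: "(nat \<Rightarrow> ('a, 'b) module) \<Rightarrow> (nat \<Rightarrow> 'b \<Rightarrow> 'b) \<Rightarrow> nat \<Rightarrow> 'b set" where
  "cocycles C d i = {x \<in> carrier (C i). d i x = \<zero>\<^bsub>C (Suc i)\<^esub>}"

definition coboundaries :: "(nat \<Rightarrow> ('a, 'b) module) \<Rightarrow> (nat \<Rightarrow> 'b \<Rightarrow> 'b) \<Rightarrow> nat \<Rightarrow> 'b set" where
  "coboundaries C d i = (case i of 0 \<Rightarrow> {\<zero>\<^bsub>C 0\<^esub>} | Suc j \<Rightarrow> d j ` carrier (C j))"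

definition cohomology ::
  "(nat \<Rightarrow> ('a, 'b) module) \<Rightarrow> (nat \<Rightarrow> 'b \<Rightarrow> 'b) \<Rightarrow> nat \<Rightarrow> ('a, 'b set) module" where
  "cohomology C d i = quotient_module ((C i)\<lparr>carrier := cocycles C d i\<rparr>) (coboundaries C d i)"


section \<open>Local cohomology\<close>

text \<open>A definition cannot quantify over types, so the test modules \<open>Y\<close> are those carried by
  (a subset of) the type of ring elements. This class contains the ring as a module over itself,
  hence by Baer's criterion the extension property then holds for modules on every type.\<close>

definition injective_module :: "('a, 'z) ring_scheme \<Rightarrow> ('a, 'b) module \<Rightarrow> bool" where
  "injective_module R E \<longleftrightarrow>
     module R E \<and>
     (\<forall>(Y :: ('a, 'a) module) U. module R Y \<longrightarrow> submodule U R Y \<longrightarrow>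
        (\<forall>\<phi> \<in> mod_hom R (Y\<lparr>carrier := U\<rparr>) E. \<exists>\<psi> \<in> mod_hom R Y E. \<forall>x\<in>U. \<psi> x = \<phi> x))"

text \<open>\<open>0 \<rightarrow> N \<rightarrow> E 0 \<rightarrow> E 1 \<rightarrow> \<dots>\<close> is exact, with first map \<open>e\<close> and the others given by \<open>d\<close>. That all
  \<open>E i\<close> live on one type \<open>'b\<close> is no restriction, as \<open>'b\<close> is arbitrary.\<close>

definition injective_resolution ::
  "('a, 'z) ring_scheme \<Rightarrow> ('a, 'c) module \<Rightarrow> (nat \<Rightarrow> ('a, 'b) module) \<Rightarrow>
   (nat \<Rightarrow> 'b \<Rightarrow> 'b) \<Rightarrow> ('c \<Rightarrow> 'b) \<Rightarrow> bool" where
  "injective_resolution R N E d e \<longleftrightarrow>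
     (\<forall>i. injective_module R (E i)) \<and>
     (\<forall>i. d i \<in> mod_hom R (E i) (E (Suc i))) \<and>
     e \<in> mod_hom R N (E 0) \<and> inj_on e (carrier N) \<and>
     e ` carrier N = cocycles E d 0 \<and>
     (\<forall>i. d i ` carrier (E i) = cocycles E d (Suc i))"

definition torsion :: "('a, 'z) ring_scheme \<Rightarrow> 'a set \<Rightarrow> ('a, 'b) module \<Rightarrow> ('a, 'b) module" where
  "torsion R I M = M\<lparr>carrier :=
     {x \<in> carrier M. \<exists>n::nat. \<forall>a \<in> I [^]\<^bsub>ideals_set R\<^esub> n. a \<odot>\<^bsub>M\<^esub> x = \<zero>\<^bsub>M\<^esub>}\<rparr>"

text \<open>The \<open>i\<close>-th right derived functor of \<^const>\<open>torsion\<close>, computed from an injective resolution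
  \<open>(E, d)\<close> of the module in question.\<close>

definition local_cohomology ::
  "('a, 'z) ring_scheme \<Rightarrow> 'a set \<Rightarrow> (nat \<Rightarrow> ('a, 'b) module) \<Rightarrow> (nat \<Rightarrow> 'b \<Rightarrow> 'b) \<Rightarrow>
   nat \<Rightarrow> ('a, 'b set) module" where
  "local_cohomology R I E d i = cohomology (\<lambda>j. torsion R I (E j)) d i"


section \<open>Koszul cohomology\<close>

text \<open>The Koszul complex \<open>K\<close> of \<open>xs\<close> has in degree \<open>i\<close> the free module on the basis elements
  \<open>e\<^sub>S\<close>, where \<open>S\<close> ranges over the \<open>i\<close>-element subsets of \<open>{..<r}\<close> and \<open>r = length xs\<close>; its differential
  sends \<open>e\<^sub>S\<close> to the sum of \<open>(-1)\<^sup>p x\<^sub>j e\<^sub>T\<close> over \<open>j \<in> S\<close>, where \<open>T = S - {j}\<close> and \<open>p\<close> is the number of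
  elements of \<open>S\<close> below \<open>j\<close>. A homomorphism from \<open>K\<close> to \<open>M\<close> is given by its values on the basis.\<close>

definition koszul_basis :: "nat \<Rightarrow> nat \<Rightarrow> nat set set" where
  "koszul_basis r i = {S. S \<subseteq> {..<r} \<and> card S = i}"

definition koszul_cochains :: "'a list \<Rightarrow> ('a, 'b) module \<Rightarrow> nat \<Rightarrow> ('a, nat set \<Rightarrow> 'b) module" where
  "koszul_cochains xs M i =
     (let B = koszul_basis (length xs) i in
      \<lparr>carrier = B \<rightarrow>\<^sub>E carrier M, monoid.mult = undefined, monoid.one = undefined,
       ring.zero = (\<lambda>S\<in>B. \<zero>\<^bsub>M\<^esub>),
       ring.add = (\<lambda>u v. \<lambda>S\<in>B. u S \<oplus>\<^bsub>M\<^esub> v S),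
       smult = (\<lambda>a u. \<lambda>S\<in>B. a \<odot>\<^bsub>M\<^esub> u S)\<rparr>)"

definition koszul_differential ::
  "('a, 'z) ring_scheme \<Rightarrow> 'a list \<Rightarrow> ('a, 'b) module \<Rightarrow> nat \<Rightarrow> (nat set \<Rightarrow> 'b) \<Rightarrow> (nat set \<Rightarrow> 'b)" where
  "koszul_differential R xs M i u =
     (\<lambda>S\<in>koszul_basis (length xs) (Suc i).
        finsum M (\<lambda>j. ((\<ominus>\<^bsub>R\<^esub> \<one>\<^bsub>R\<^esub>) [^]\<^bsub>R\<^esub> card {k\<in>S. k < j} \<otimes>\<^bsub>R\<^esub> xs ! j) \<odot>\<^bsub>M\<^esub> u (S - {j})) S)"

definition koszul_cohomology ::
  "('a, 'z) ring_scheme \<Rightarrow> 'a list \<Rightarrow> ('a, 'b) module \<Rightarrow> nat \<Rightarrow> ('a, (nat set \<Rightarrow> 'b) set) module" where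
  "koszul_cohomology R xs M i = cohomology (koszul_cochains xs M) (koszul_differential R xs M) i"

end

theory Submission
  imports Defs
begin

text \<open>
  Let \<open>E\<close> be the injective resolution of \<open>R\<close>, let \<open>C = \<Gamma>\<^sub>I(E)\<close>, and let \<open>J = (f, g, h)\<close>. Since \<open>f, h\<close> is a regular
  sequence, \<open>C\<close> has cohomology \<open>M\<close> in degree two only, so \<open>H\<^sup>i(J; M) = H\<^sup>i\<^sup>+\<^sup>2(J; C)\<close> for the Koszul complexes,
  realised as iterated mapping cones. For any generators \<open>a\<close> of \<open>I\<close> up to radical the inclusion of \<open>C\<close>
  into \<open>E\<close> induces an isomorphism \<open>H(a; C) = H(a; E) = H(a; R)\<close>, because \<open>C\<close> is reached from \<open>E\<close> by adding
  one torsion condition at a time, and on each quotient some member of \<open>a\<close> is bijective.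

  If \<open>J\<close> generates \<open>I\<close> up to radical, this gives \<open>H\<^sup>i(J; M) = H\<^sup>i\<^sup>+\<^sup>2(J; R) = 0\<close> for \<open>i \<ge> 2\<close>. Conversely, if
  \<open>H\<^sup>i(J; C) = 0\<close> for \<open>i > 3\<close>, then adjoining generators \<open>b\<^sub>1, \<dots>, b\<^sub>t\<close> of \<open>I\<close> one at a time yields a surjection from
  \<open>H\<^sup>3(J; C)\<close> onto \<open>H\<^sup>3\<^sup>+\<^sup>t(b, J; C) = R / I\<close> that factors through \<open>R / J\<close>. A preimage of \<open>1\<close> is an element \<open>r\<close> with
  \<open>1 - r \<in> I\<close> whose class in \<open>R / J\<close> is \<open>I\<close>-torsion. In the local case \<open>r\<close> is a unit, so a power of each
  element of \<open>I\<close> lies in \<open>J\<close>; in the graded case the same holds for the degree zero component of \<open>r\<close>.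
\<close>

section \<open>Cochain complexes of modules\<close>

text \<open>One predicate, \<open>exact_from_three\<close>, has to serve both implications. Each
  cone lowers the index by one and \<open>pad\<close> raises it by two. So the second cohomology
  \<open>M\<close> starts at index four, and after three cones \<open>H^i(J; M)\<close> sits at
  index \<open>i + 1\<close>. The ring starts at index two, and the top cohomology of its Koszul
  complex stays at index two for every list. Hence vanishing for \<open>i >= 2\<close> and vanishing
  above the top class of the ring are the same statement about indices from three on. Lowering the
  index chops off cochains below zero, so cohomology at index zero carries no meaning;
  quasi-isomorphisms are therefore only required to be onto from index one and one-to-one from index
  two. Injectivity of the resolution enters through a single division property: up to
  \<open>a\<close>-power torsion every \<open>x\<close> is \<open>a y\<close>, with \<open>y\<close>
  killed by everything that kills \<open>x\<close>. This makes \<open>a\<close> bijective on the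
  quotient by the additional torsion, without a structure theory of injective modules and without
  showing that torsion preserves injectivity.\<close>

lemma (in abelian_group) minus_eq_zero_iff:
  "\<lbrakk>x \<in> carrier G; y \<in> carrier G\<rbrakk> \<Longrightarrow> x \<ominus> y = \<zero> \<longleftrightarrow> x = y"
  by (metis a_minus_def a_inv_closed minus_equality minus_minus r_neg)

lemma (in abelian_group) add_minus_cancel:
  "\<lbrakk>x \<in> carrier G; y \<in> carrier G\<rbrakk> \<Longrightarrow> x \<oplus> (y \<ominus> x) = y"
  by (simp add: a_minus_def a_comm[of y] r_neg2)

lemma (in abelian_group) eq_add_iff_minus_eq:
  "\<lbrakk>x \<in> carrier G; y \<in> carrier G; z \<in> carrier G\<rbrakk> \<Longrightarrow> x = y \<oplus> z \<longleftrightarrow> x \<ominus> y = z"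
  by (metis add_minus_cancel a_minus_def a_closed a_inv_closed a_assoc a_comm r_neg r_zero)

lemma mod_homD:
  assumes "\<phi> \<in> mod_hom R M N"
  shows "x \<in> carrier M \<Longrightarrow> \<phi> x \<in> carrier N"
    and "\<lbrakk>x \<in> carrier M; y \<in> carrier M\<rbrakk> \<Longrightarrow> \<phi> (x \<oplus>\<^bsub>M\<^esub> y) = \<phi> x \<oplus>\<^bsub>N\<^esub> \<phi> y"
    and "\<lbrakk>a \<in> carrier R; x \<in> carrier M\<rbrakk> \<Longrightarrow> \<phi> (a \<odot>\<^bsub>M\<^esub> x) = a \<odot>\<^bsub>N\<^esub> \<phi> x"
  using assms by (auto simp: mod_hom_def)

lemma mod_hom_zero_minus:
  assumes "\<phi> \<in> mod_hom R M N" and M: "module R M" and N: "module R N"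
  shows "\<phi> \<zero>\<^bsub>M\<^esub> = \<zero>\<^bsub>N\<^esub>"
    and "x \<in> carrier M \<Longrightarrow> \<phi> (\<ominus>\<^bsub>M\<^esub> x) = \<ominus>\<^bsub>N\<^esub> \<phi> x"
    and "\<lbrakk>x \<in> carrier M; y \<in> carrier M\<rbrakk> \<Longrightarrow> \<phi> (x \<ominus>\<^bsub>M\<^esub> y) = \<phi> x \<ominus>\<^bsub>N\<^esub> \<phi> y"
proof -
  interpret M: module R M by fact
  interpret N: module R N by fact
  note h = mod_homD[OF assms(1)]
  interpret hom: abelian_group_hom M N \<phi>
    by (rule abelian_group_homI)
      (auto simp: abelian_group_hom_axioms_def group_hom_axioms_def group_hom_def hom_def h
        M.abelian_group_axioms N.abelian_group_axioms M.add.is_group N.add.is_group)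
  show "\<phi> \<zero>\<^bsub>M\<^esub> = \<zero>\<^bsub>N\<^esub>" by simp
  show neg: "\<phi> (\<ominus>\<^bsub>M\<^esub> x) = \<ominus>\<^bsub>N\<^esub> \<phi> x" if "x \<in> carrier M" for x using that by simp
  show "\<phi> (x \<ominus>\<^bsub>M\<^esub> y) = \<phi> x \<ominus>\<^bsub>N\<^esub> \<phi> y" if "x \<in> carrier M" "y \<in> carrier M"
    using that by (simp add: a_minus_def h neg)
qed

lemma (in module) smult_minus_distr:
  "\<lbrakk>a \<in> carrier R; x \<in> carrier M; y \<in> carrier M\<rbrakk> \<Longrightarrow> a \<odot>\<^bsub>M\<^esub> (x \<ominus>\<^bsub>M\<^esub> y) = a \<odot>\<^bsub>M\<^esub> x \<ominus>\<^bsub>M\<^esub> a \<odot>\<^bsub>M\<^esub> y"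
  by (simp add: a_minus_def smult_r_distr smult_r_minus)

lemma (in module) submodule_module: "submodule H R M \<Longrightarrow> module R (M\<lparr>carrier := H\<rparr>)"
  using submodule.submodule_is_module module_axioms by blast

text \<open>Inverses are selected from the carrier, so restricting the carrier could in principle
  change them; uniqueness of inverses in the submodule rules this out.\<close>

lemma restrict_a_inv:
  assumes M: "module R M" and H: "submodule H R M" and x: "x \<in> H"
  shows "\<ominus>\<^bsub>M\<lparr>carrier := H\<rparr>\<^esub> x = \<ominus>\<^bsub>M\<^esub> x"
proof -
  interpret M: module R M by fact
  interpret H: module R "M\<lparr>carrier := H\<rparr>" by (rule M.submodule_module[OF H])
  have "\<ominus>\<^bsub>M\<^esub> x \<in> H" and "x \<in> carrier M" using M.submoduleE[OF H] x by auto
  then show ?thesis using H.minus_equality[of "\<ominus>\<^bsub>M\<^esub> x" x] x M.l_neg[of x] by simp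
qed

locale cochain_complex =
  fixes R (structure) and C :: "nat \<Rightarrow> ('a, 'b) module" and d :: "nat \<Rightarrow> 'b \<Rightarrow> 'b"
  assumes module_C: "module R (C i)"
    and d_hom: "d i \<in> mod_hom R (C i) (C (Suc i))"
    and d_d: "x \<in> carrier (C i) \<Longrightarrow> d (Suc i) (d i x) = \<zero>\<^bsub>C (Suc (Suc i))\<^esub>"
begin

lemma abelian_group_C: "abelian_group (C i)"
  using module_C by (rule module.axioms)

lemma C_closed [simp, intro]:
  "\<zero>\<^bsub>C i\<^esub> \<in> carrier (C i)"
  "\<lbrakk>x \<in> carrier (C i); y \<in> carrier (C i)\<rbrakk> \<Longrightarrow> x \<oplus>\<^bsub>C i\<^esub> y \<in> carrier (C i)"
  "\<lbrakk>x \<in> carrier (C i); y \<in> carrier (C i)\<rbrakk> \<Longrightarrow> x \<ominus>\<^bsub>C i\<^esub> y \<in> carrier (C i)"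
  "x \<in> carrier (C i) \<Longrightarrow> \<ominus>\<^bsub>C i\<^esub> x \<in> carrier (C i)"
  "\<lbrakk>a \<in> carrier R; x \<in> carrier (C i)\<rbrakk> \<Longrightarrow> a \<odot>\<^bsub>C i\<^esub> x \<in> carrier (C i)"
proof -
  interpret M: module R "C i" by (rule module_C)
  show "\<zero>\<^bsub>C i\<^esub> \<in> carrier (C i)" by simp
  show "\<lbrakk>x \<in> carrier (C i); y \<in> carrier (C i)\<rbrakk> \<Longrightarrow> x \<oplus>\<^bsub>C i\<^esub> y \<in> carrier (C i)" by simp
  show "\<lbrakk>x \<in> carrier (C i); y \<in> carrier (C i)\<rbrakk> \<Longrightarrow> x \<ominus>\<^bsub>C i\<^esub> y \<in> carrier (C i)" by simp
  show "x \<in> carrier (C i) \<Longrightarrow> \<ominus>\<^bsub>C i\<^esub> x \<in> carrier (C i)" by simp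
  show "\<lbrakk>a \<in> carrier R; x \<in> carrier (C i)\<rbrakk> \<Longrightarrow> a \<odot>\<^bsub>C i\<^esub> x \<in> carrier (C i)" by simp
qed

lemma C_neutral [simp]:
  "x \<in> carrier (C i) \<Longrightarrow> x \<oplus>\<^bsub>C i\<^esub> \<zero>\<^bsub>C i\<^esub> = x"
  "x \<in> carrier (C i) \<Longrightarrow> \<zero>\<^bsub>C i\<^esub> \<oplus>\<^bsub>C i\<^esub> x = x"
  "x \<in> carrier (C i) \<Longrightarrow> x \<ominus>\<^bsub>C i\<^esub> \<zero>\<^bsub>C i\<^esub> = x"
  "a \<in> carrier R \<Longrightarrow> a \<odot>\<^bsub>C i\<^esub> \<zero>\<^bsub>C i\<^esub> = \<zero>\<^bsub>C i\<^esub>"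
  "x \<in> carrier (C i) \<Longrightarrow> x \<ominus>\<^bsub>C i\<^esub> x = \<zero>\<^bsub>C i\<^esub>"
  "x \<in> carrier (C i) \<Longrightarrow> \<ominus>\<^bsub>C i\<^esub> (\<ominus>\<^bsub>C i\<^esub> x) = x"
proof -
  interpret M: module R "C i" by (rule module_C)
  show "x \<in> carrier (C i) \<Longrightarrow> x \<oplus>\<^bsub>C i\<^esub> \<zero>\<^bsub>C i\<^esub> = x" by simp
  show "x \<in> carrier (C i) \<Longrightarrow> \<zero>\<^bsub>C i\<^esub> \<oplus>\<^bsub>C i\<^esub> x = x" by simp
  show "x \<in> carrier (C i) \<Longrightarrow> x \<ominus>\<^bsub>C i\<^esub> \<zero>\<^bsub>C i\<^esub> = x" by (simp add: a_minus_def)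
  show "a \<in> carrier R \<Longrightarrow> a \<odot>\<^bsub>C i\<^esub> \<zero>\<^bsub>C i\<^esub> = \<zero>\<^bsub>C i\<^esub>" by simp
  show "x \<in> carrier (C i) \<Longrightarrow> x \<ominus>\<^bsub>C i\<^esub> x = \<zero>\<^bsub>C i\<^esub>" by (simp add: M.minus_eq_zero_iff)
  show "x \<in> carrier (C i) \<Longrightarrow> \<ominus>\<^bsub>C i\<^esub> (\<ominus>\<^bsub>C i\<^esub> x) = x" by simp
qed

lemmas C_minus_eq_zero_iff = abelian_group.minus_eq_zero_iff[OF abelian_group_C]
lemmas C_add_minus_cancel = abelian_group.add_minus_cancel[OF abelian_group_C]
lemmas C_smult_add = module.smult_r_distr[OF module_C]
lemmas C_smult_minus = module.smult_minus_distr[OF module_C]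

lemmas d_closed [simp, intro] = mod_homD(1)[OF d_hom]
lemmas d_add = mod_homD(2)[OF d_hom]
lemmas d_smult = mod_homD(3)[OF d_hom]
lemmas d_zero [simp] = mod_hom_zero_minus(1)[OF d_hom module_C module_C]
lemmas d_uminus = mod_hom_zero_minus(2)[OF d_hom module_C module_C]
lemmas d_minus = mod_hom_zero_minus(3)[OF d_hom module_C module_C]

end

text \<open>Here \<open>i\<close> is the source of the incoming differential, so the vanishing is at
  index \<open>Suc i\<close>, from three on: just above index two, which is reserved for the top
  cohomology of the ring.\<close>

definition exact_from_three :: "(nat \<Rightarrow> ('a, 'b) module) \<Rightarrow> (nat \<Rightarrow> 'b \<Rightarrow> 'b) \<Rightarrow> bool" where
  "exact_from_three C d \<longleftrightarrow>
     (\<forall>i\<ge>2. \<forall>x\<in>carrier (C (Suc i)). d (Suc i) x = \<zero>\<^bsub>C (Suc (Suc i))\<^esub> \<longrightarrow> x \<in> d i ` carrier (C i))"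

locale chain_map = C: cochain_complex R C d + D: cochain_complex R D d'
  for R (structure) and C :: "nat \<Rightarrow> ('a, 'b) module" and d
    and D :: "nat \<Rightarrow> ('a, 'c) module" and d' +
  fixes \<phi> :: "nat \<Rightarrow> 'b \<Rightarrow> 'c"
  assumes map_hom: "\<phi> i \<in> mod_hom R (C i) (D i)"
    and map_d: "x \<in> carrier (C i) \<Longrightarrow> \<phi> (Suc i) (d i x) = d' i (\<phi> i x)"
begin

lemmas map_closed [simp, intro] = mod_homD(1)[OF map_hom]
lemmas map_add = mod_homD(2)[OF map_hom]
lemmas map_smult = mod_homD(3)[OF map_hom]
lemmas map_zero [simp] = mod_hom_zero_minus(1)[OF map_hom C.module_C D.module_C]
lemmas map_uminus = mod_hom_zero_minus(2)[OF map_hom C.module_C D.module_C]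
lemmas map_minus = mod_hom_zero_minus(3)[OF map_hom C.module_C D.module_C]

end

text \<open>The mapping cone is exact in positive degrees: the map is onto on cohomology from degree one on
  and one-to-one from degree two on.\<close>

locale quasi_iso = chain_map +
  assumes lift: "\<lbrakk>x \<in> carrier (C (Suc (Suc i))); y \<in> carrier (D (Suc i));
      d (Suc (Suc i)) x = \<zero>\<^bsub>C (Suc (Suc (Suc i)))\<^esub>; \<phi> (Suc (Suc i)) x = d' (Suc i) y\<rbrakk> \<Longrightarrow>
    \<exists>x'\<in>carrier (C (Suc i)). \<exists>y'\<in>carrier (D i).
      x = d (Suc i) x' \<and> y = \<phi> (Suc i) x' \<oplus>\<^bsub>D (Suc i)\<^esub> d' i y'"
begin

lemma exact_reflect:
  assumes "exact_from_three D d'"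
  shows "exact_from_three C d"
  unfolding exact_from_three_def
proof (intro allI ballI impI)
  fix i x
  assume i: "2 \<le> i" and x: "x \<in> carrier (C (Suc i))" "d (Suc i) x = \<zero>\<^bsub>C (Suc (Suc i))\<^esub>"
  have "d' (Suc i) (\<phi> (Suc i) x) = \<zero>\<^bsub>D (Suc (Suc i))\<^esub>"
    using map_d[OF x(1)] x(2) by simp
  then obtain y where y: "y \<in> carrier (D i)" "\<phi> (Suc i) x = d' i y"
    using assms i x(1) unfolding exact_from_three_def by (metis imageE map_closed)
  obtain j where "i = Suc j" using i by (cases i) auto
  then show "x \<in> d i ` carrier (C i)" using lift[of x j y] x y by blast
qed

text \<open>The cone cocycle \<open>(0, y)\<close> is a boundary by \<open>lift\<close>; its
  primitive \<open>(x', y')\<close> has \<open>d x' = 0\<close>, so the class of \<open>y\<close>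
  comes from \<open>x'\<close>.\<close>

lemma surj:
  assumes "y \<in> carrier (D (Suc i))" "d' (Suc i) y = \<zero>\<^bsub>D (Suc (Suc i))\<^esub>"
  shows "\<exists>x\<in>carrier (C (Suc i)). \<exists>y'\<in>carrier (D i).
    d (Suc i) x = \<zero>\<^bsub>C (Suc (Suc i))\<^esub> \<and> y = \<phi> (Suc i) x \<oplus>\<^bsub>D (Suc i)\<^esub> d' i y'"
  using lift[of "\<zero>\<^bsub>C (Suc (Suc i))\<^esub>" i y] assms by (metis C.C_closed(1) C.d_zero map_zero)

lemma exact_preserve:
  assumes "exact_from_three C d"
  shows "exact_from_three D d'"
  unfolding exact_from_three_def
proof (intro allI ballI impI)
  fix i y
  assume i: "2 \<le> i" and y: "y \<in> carrier (D (Suc i))" "d' (Suc i) y = \<zero>\<^bsub>D (Suc (Suc i))\<^esub>"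
  obtain x y' where x: "x \<in> carrier (C (Suc i))" "d (Suc i) x = \<zero>\<^bsub>C (Suc (Suc i))\<^esub>"
    and y': "y' \<in> carrier (D i)" "y = \<phi> (Suc i) x \<oplus>\<^bsub>D (Suc i)\<^esub> d' i y'"
    using surj[OF y] by blast
  obtain x' where "x' \<in> carrier (C i)" "x = d i x'"
    using assms i x unfolding exact_from_three_def by blast
  then have "y = d' i (\<phi> i x' \<oplus>\<^bsub>D i\<^esub> y')" using y' by (simp add: map_d D.d_add)
  then show "y \<in> d' i ` carrier (D i)" using \<open>x' \<in> carrier (C i)\<close> y'(1) by blast
qed

lemma inj:
  assumes "x \<in> carrier (C (Suc (Suc i)))" "d (Suc (Suc i)) x = \<zero>\<^bsub>C (Suc (Suc (Suc i)))\<^esub>"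
    and "\<phi> (Suc (Suc i)) x \<in> d' (Suc i) ` carrier (D (Suc i))"
  shows "x \<in> d (Suc i) ` carrier (C (Suc i))"
  using assms lift by blast

end

text \<open>A cone cocycle of the composite is bounded in two stages: lifting along the second map
  produces the middle element \<open>y\<close>, which completes \<open>x\<close> to a cone cocycle
  of the first map.\<close>

lemma quasi_iso_comp:
  assumes "quasi_iso R C d D d' \<phi>" and "quasi_iso R D d' F d'' \<psi>"
  shows "quasi_iso R C d F d'' (\<lambda>i x. \<psi> i (\<phi> i x))"
proof -
  interpret f: quasi_iso R C d D d' \<phi> by fact
  interpret g: quasi_iso R D d' F d'' \<psi> by fact
  show ?thesis
  proof unfold_locales
    fix i
    show "(\<lambda>x. \<psi> i (\<phi> i x)) \<in> mod_hom R (C i) (F i)"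
      by (auto simp: mod_hom_def f.map_add f.map_smult g.map_add g.map_smult)
  next
    fix x i assume "x \<in> carrier (C i)"
    then show "\<psi> (Suc i) (\<phi> (Suc i) (d i x)) = d'' i (\<psi> i (\<phi> i x))"
      by (simp add: f.map_d g.map_d)
  next
    fix x z i
    assume x: "x \<in> carrier (C (Suc (Suc i)))" and z: "z \<in> carrier (F (Suc i))"
      and dx: "d (Suc (Suc i)) x = \<zero>\<^bsub>C (Suc (Suc (Suc i)))\<^esub>"
      and eq: "\<psi> (Suc (Suc i)) (\<phi> (Suc (Suc i)) x) = d'' (Suc i) z"
    have "d' (Suc (Suc i)) (\<phi> (Suc (Suc i)) x) = \<zero>\<^bsub>D (Suc (Suc (Suc i)))\<^esub>"
      using f.map_d[OF x] dx by simp
    then obtain y z' where y: "y \<in> carrier (D (Suc i))" and z': "z' \<in> carrier (F i)"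
      and y_eq: "\<phi> (Suc (Suc i)) x = d' (Suc i) y"
      and z_eq: "z = \<psi> (Suc i) y \<oplus>\<^bsub>F (Suc i)\<^esub> d'' i z'"
      using g.lift[OF _ z _ eq] x by blast
    obtain x' y' where x': "x' \<in> carrier (C (Suc i))" and y': "y' \<in> carrier (D i)"
      and x_eq: "x = d (Suc i) x'" and y_eq': "y = \<phi> (Suc i) x' \<oplus>\<^bsub>D (Suc i)\<^esub> d' i y'"
      using f.lift[OF x y dx y_eq] by blast
    interpret Zi: module R "F (Suc i)" by (rule g.D.module_C)
    have "z = \<psi> (Suc i) (\<phi> (Suc i) x') \<oplus>\<^bsub>F (Suc i)\<^esub> d'' i (\<psi> i y' \<oplus>\<^bsub>F i\<^esub> z')"
      using x' y' z' z_eq y_eq' by (simp add: g.map_add g.map_d g.D.d_add Zi.a_assoc)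
    then show "\<exists>x'\<in>carrier (C (Suc i)). \<exists>z'\<in>carrier (F i).
        x = d (Suc i) x' \<and> z = \<psi> (Suc i) (\<phi> (Suc i) x') \<oplus>\<^bsub>F (Suc i)\<^esub> d'' i z'"
      using x' y' z' x_eq by blast
  qed
qed

section \<open>Iterated mapping cones\<close>

text \<open>Cones are formed on trees, so that the type stays the same when the construction is iterated.\<close>

datatype 'b tree = Leaf (label: 'b) | Node (lft: "'b tree") (rgt: "'b tree")

definition leaf_module :: "('a, 'b) module \<Rightarrow> ('a, 'b tree) module" where
  "leaf_module M = \<lparr>carrier = Leaf ` carrier M, monoid.mult = undefined, monoid.one = undefined,
     ring.zero = Leaf \<zero>\<^bsub>M\<^esub>, ring.add = (\<lambda>u v. Leaf (label u \<oplus>\<^bsub>M\<^esub> label v)),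
     smult = (\<lambda>a u. Leaf (a \<odot>\<^bsub>M\<^esub> label u))\<rparr>"

definition pair_module :: "('a, 'b tree) module \<Rightarrow> ('a, 'b tree) module \<Rightarrow> ('a, 'b tree) module" where
  "pair_module M N = \<lparr>carrier = {Node x y |x y. x \<in> carrier M \<and> y \<in> carrier N},
     monoid.mult = undefined, monoid.one = undefined, ring.zero = Node \<zero>\<^bsub>M\<^esub> \<zero>\<^bsub>N\<^esub>,
     ring.add = (\<lambda>u v. Node (lft u \<oplus>\<^bsub>M\<^esub> lft v) (rgt u \<oplus>\<^bsub>N\<^esub> rgt v)),
     smult = (\<lambda>a u. Node (a \<odot>\<^bsub>M\<^esub> lft u) (a \<odot>\<^bsub>N\<^esub> rgt u))\<rparr>"

lemma leaf_module_simps [simp]: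
  "carrier (leaf_module M) = Leaf ` carrier M"
  "\<zero>\<^bsub>leaf_module M\<^esub> = Leaf \<zero>\<^bsub>M\<^esub>"
  "Leaf x \<oplus>\<^bsub>leaf_module M\<^esub> Leaf y = Leaf (x \<oplus>\<^bsub>M\<^esub> y)"
  "a \<odot>\<^bsub>leaf_module M\<^esub> Leaf x = Leaf (a \<odot>\<^bsub>M\<^esub> x)"
  by (simp_all add: leaf_module_def)

lemma pair_module_simps [simp]:
  "Node x y \<in> carrier (pair_module M N) \<longleftrightarrow> x \<in> carrier M \<and> y \<in> carrier N"
  "\<zero>\<^bsub>pair_module M N\<^esub> = Node \<zero>\<^bsub>M\<^esub> \<zero>\<^bsub>N\<^esub>"
  "Node x y \<oplus>\<^bsub>pair_module M N\<^esub> Node x' y' = Node (x \<oplus>\<^bsub>M\<^esub> x') (y \<oplus>\<^bsub>N\<^esub> y')"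
  "a \<odot>\<^bsub>pair_module M N\<^esub> Node x y = Node (a \<odot>\<^bsub>M\<^esub> x) (a \<odot>\<^bsub>N\<^esub> y)"
  by (simp_all add: pair_module_def)

lemma pair_moduleE:
  assumes "u \<in> carrier (pair_module M N)"
  obtains x y where "u = Node x y" "x \<in> carrier M" "y \<in> carrier N"
  using assms by (auto simp: pair_module_def)

lemma leaf_module_module:
  assumes "module R M"
  shows "module R (leaf_module M)"
proof -
  interpret M: module R M by fact
  show ?thesis
  proof (rule moduleI)
    show "abelian_group (leaf_module M)"
    proof (rule abelian_groupI)
      fix x assume "x \<in> carrier (leaf_module M)"
      then obtain x' where "x = Leaf x'" "x' \<in> carrier M" by auto
      then show "\<exists>y\<in>carrier (leaf_module M). y \<oplus>\<^bsub>leaf_module M\<^esub> x = \<zero>\<^bsub>leaf_module M\<^esub>"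
        by (auto intro!: bexI[of _ "\<ominus>\<^bsub>M\<^esub> x'"] simp: M.l_neg)
    qed (auto simp: M.a_ac)
  qed (auto simp: M.smult_l_distr M.smult_r_distr M.smult_assoc1 M.R.is_cring)
qed

lemma pair_module_module:
  assumes "module R M" "module R N"
  shows "module R (pair_module M N)"
proof -
  interpret M: module R M by fact
  interpret N: module R N by fact
  show ?thesis
  proof (rule moduleI)
    show "abelian_group (pair_module M N)"
    proof (rule abelian_groupI)
      fix u assume "u \<in> carrier (pair_module M N)"
      then obtain x y where "u = Node x y" "x \<in> carrier M" "y \<in> carrier N" by (rule pair_moduleE)
      then show "\<exists>v\<in>carrier (pair_module M N). v \<oplus>\<^bsub>pair_module M N\<^esub> u = \<zero>\<^bsub>pair_module M N\<^esub>"
        by (intro bexI[of _ "Node (\<ominus>\<^bsub>M\<^esub> x) (\<ominus>\<^bsub>N\<^esub> y)"]) (simp_all add: M.l_neg N.l_neg)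
    qed (auto elim!: pair_moduleE simp: M.a_ac N.a_ac)
  qed (auto elim!: pair_moduleE simp: M.smult_l_distr M.smult_r_distr M.smult_assoc1
      N.smult_l_distr N.smult_r_distr N.smult_assoc1 M.R.is_cring)
qed

lemma pair_module_minus:
  assumes "module R M" "module R N"
    and "x \<in> carrier M" "x' \<in> carrier M" "y \<in> carrier N" "y' \<in> carrier N"
  shows "Node x y \<ominus>\<^bsub>pair_module M N\<^esub> Node x' y' = Node (x \<ominus>\<^bsub>M\<^esub> x') (y \<ominus>\<^bsub>N\<^esub> y')"
proof -
  interpret M: module R M by fact
  interpret N: module R N by fact
  interpret P: module R "pair_module M N" by (rule pair_module_module) fact+
  have "\<ominus>\<^bsub>pair_module M N\<^esub> Node x' y' = Node (\<ominus>\<^bsub>M\<^esub> x') (\<ominus>\<^bsub>N\<^esub> y')"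
    by (rule P.minus_equality) (simp_all add: assms M.l_neg N.l_neg)
  then show ?thesis by (simp add: a_minus_def)
qed

text \<open>The index is one less than usual, so that the top cohomology of the Koszul complexes of a ring
  stays at the same index however many elements are adjoined.\<close>

definition cone :: "(nat \<Rightarrow> ('a, 'b tree) module) \<Rightarrow> nat \<Rightarrow> ('a, 'b tree) module" where
  "cone C i = pair_module (C (Suc i)) (C i)"

text \<open>The cone of multiplication by \<open>b\<close>. The minus sign makes consecutive
  differentials cancel, the mixed terms being \<open>b d x - d (b x)\<close>; it also accounts for
  the negated primitives and the nested differences further on.\<close>

definition cone_diff ::
  "'a \<Rightarrow> (nat \<Rightarrow> ('a, 'b tree) module) \<Rightarrow> (nat \<Rightarrow> 'b tree \<Rightarrow> 'b tree) \<Rightarrow> nat \<Rightarrow> 'b tree \<Rightarrow> 'b tree" where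
  "cone_diff b C d i u =
     Node (d (Suc i) (lft u)) (b \<odot>\<^bsub>C (Suc i)\<^esub> lft u \<ominus>\<^bsub>C (Suc i)\<^esub> d i (rgt u))"

definition cone_map :: "(nat \<Rightarrow> 'b tree \<Rightarrow> 'c tree) \<Rightarrow> nat \<Rightarrow> 'b tree \<Rightarrow> 'c tree" where
  "cone_map \<phi> i u = Node (\<phi> (Suc i) (lft u)) (\<phi> i (rgt u))"

lemma cone_simps [simp]:
  "Node x y \<in> carrier (cone C i) \<longleftrightarrow> x \<in> carrier (C (Suc i)) \<and> y \<in> carrier (C i)"
  "\<zero>\<^bsub>cone C i\<^esub> = Node \<zero>\<^bsub>C (Suc i)\<^esub> \<zero>\<^bsub>C i\<^esub>"
  "Node x y \<oplus>\<^bsub>cone C i\<^esub> Node x' y' = Node (x \<oplus>\<^bsub>C (Suc i)\<^esub> x') (y \<oplus>\<^bsub>C i\<^esub> y')"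
  "a \<odot>\<^bsub>cone C i\<^esub> Node x y = Node (a \<odot>\<^bsub>C (Suc i)\<^esub> x) (a \<odot>\<^bsub>C i\<^esub> y)"
  "cone_diff b C d i (Node x y) = Node (d (Suc i) x) (b \<odot>\<^bsub>C (Suc i)\<^esub> x \<ominus>\<^bsub>C (Suc i)\<^esub> d i y)"
  "cone_map \<phi> i (Node x y) = Node (\<phi> (Suc i) x) (\<phi> i y)"
  by (simp_all add: cone_def cone_diff_def cone_map_def)

lemma coneE:
  assumes "u \<in> carrier (cone C i)"
  obtains x y where "u = Node x y" "x \<in> carrier (C (Suc i))" "y \<in> carrier (C i)"
  using assms unfolding cone_def by (rule pair_moduleE)

lemma cone_complex:
  assumes "cochain_complex R C d" and b: "b \<in> carrier R"
  shows "cochain_complex R (cone C) (cone_diff b C d)"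
proof -
  interpret C: cochain_complex R C d by fact
  show ?thesis
  proof (rule cochain_complex.intro)
    show "module R (cone C i)" for i
      unfolding cone_def by (intro pair_module_module C.module_C)
  next
    fix i
    interpret M: module R "C (Suc i)" by (rule C.module_C)
    have "(a1 \<oplus>\<^bsub>C (Suc i)\<^esub> a2) \<ominus>\<^bsub>C (Suc i)\<^esub> (b1 \<oplus>\<^bsub>C (Suc i)\<^esub> b2) =
        (a1 \<ominus>\<^bsub>C (Suc i)\<^esub> b1) \<oplus>\<^bsub>C (Suc i)\<^esub> (a2 \<ominus>\<^bsub>C (Suc i)\<^esub> b2)"
      if "a1 \<in> carrier (C (Suc i))" "a2 \<in> carrier (C (Suc i))"
        "b1 \<in> carrier (C (Suc i))" "b2 \<in> carrier (C (Suc i))" for a1 a2 b1 b2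
      using that by (simp add: a_minus_def M.minus_add M.a_ac)
    then show "cone_diff b C d i \<in> mod_hom R (cone C i) (cone C (Suc i))"
      unfolding mod_hom_def using b
      by (auto elim!: coneE simp: C.d_add C.d_smult C.C_smult_add C.C_smult_minus
          M.smult_assoc1[symmetric] M.R.m_comm)
  next
    fix u i assume "u \<in> carrier (cone C i)"
    then show "cone_diff b C d (Suc i) (cone_diff b C d i u) = \<zero>\<^bsub>cone C (Suc (Suc i))\<^esub>"
      using b by (auto elim!: coneE simp: C.d_d C.d_minus C.d_smult)
  qed
qed

lemma cone_chain_map:
  assumes "chain_map R C d D d' \<phi>" and b: "b \<in> carrier R"
  shows "chain_map R (cone C) (cone_diff b C d) (cone D) (cone_diff b D d') (cone_map \<phi>)"
proof -
  interpret f: chain_map R C d D d' \<phi> by fact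
  interpret C: cochain_complex R "cone C" "cone_diff b C d"
    by (rule cone_complex[OF f.C.cochain_complex_axioms b])
  interpret D: cochain_complex R "cone D" "cone_diff b D d'"
    by (rule cone_complex[OF f.D.cochain_complex_axioms b])
  show ?thesis
  proof
    fix i show "cone_map \<phi> i \<in> mod_hom R (cone C i) (cone D i)"
      by (auto simp: mod_hom_def f.map_add f.map_smult elim!: coneE)
  next
    fix u i assume "u \<in> carrier (cone C i)"
    then show "cone_map \<phi> (Suc i) (cone_diff b C d i u) = cone_diff b D d' i (cone_map \<phi> i u)"
      using b by (auto elim!: coneE simp: f.map_d f.map_minus f.map_smult)
  qed
qed

text \<open>A five lemma by elements. Lifting the first components \<open>(x1, y1)\<close> leaves
  second components that, corrected by multiples of \<open>b\<close>, form another cone cocycle of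
  \<open>\<phi>\<close>; a second lift disposes of these.\<close>

lemma cone_quasi_iso:
  assumes "quasi_iso R C d D d' \<phi>" and b: "b \<in> carrier R"
  shows "quasi_iso R (cone C) (cone_diff b C d) (cone D) (cone_diff b D d') (cone_map \<phi>)"
proof -
  interpret f: quasi_iso R C d D d' \<phi> by fact
  interpret c: chain_map R "cone C" "cone_diff b C d" "cone D" "cone_diff b D d'" "cone_map \<phi>"
    by (rule cone_chain_map[OF f.chain_map_axioms b])
  show ?thesis
  proof
    fix u v i
    assume u: "u \<in> carrier (cone C (Suc (Suc i)))" and v: "v \<in> carrier (cone D (Suc i))"
      and du: "cone_diff b C d (Suc (Suc i)) u = \<zero>\<^bsub>cone C (Suc (Suc (Suc i)))\<^esub>"
      and eq: "cone_map \<phi> (Suc (Suc i)) u = cone_diff b D d' (Suc i) v"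
    let ?i = "Suc i" let ?j = "Suc (Suc i)" let ?k = "Suc (Suc (Suc i))"
    obtain x1 x0 where u_eq: "u = Node x1 x0" and x1: "x1 \<in> carrier (C ?k)"
      and x0: "x0 \<in> carrier (C ?j)" using u by (rule coneE)
    obtain y1 y0 where v_eq: "v = Node y1 y0" and y1: "y1 \<in> carrier (D ?j)"
      and y0: "y0 \<in> carrier (D ?i)" using v by (rule coneE)
    have dx1: "d ?k x1 = \<zero>\<^bsub>C (Suc ?k)\<^esub>" and dx0: "d ?j x0 = b \<odot>\<^bsub>C ?k\<^esub> x1"
      using du x1 x0 b by (auto simp: u_eq f.C.C_minus_eq_zero_iff)
    have p1: "\<phi> ?k x1 = d' ?j y1" and p0: "\<phi> ?j x0 = b \<odot>\<^bsub>D ?j\<^esub> y1 \<ominus>\<^bsub>D ?j\<^esub> d' ?i y0"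
      using eq by (auto simp: u_eq v_eq)
    obtain x1' y1' where x1': "x1' \<in> carrier (C ?j)" and y1': "y1' \<in> carrier (D ?i)"
      and x1_eq: "x1 = d ?j x1'" and y1_eq: "y1 = \<phi> ?j x1' \<oplus>\<^bsub>D ?j\<^esub> d' ?i y1'"
      using f.lift[OF x1 y1 dx1 p1] by blast
    interpret Cj: module R "C ?j" by (rule f.C.module_C)
    interpret Dj: module R "D ?j" by (rule f.D.module_C)
    interpret Di: module R "D ?i" by (rule f.D.module_C)
    \<comment> \<open>The term \<open>b x1'\<close> accounts for the part of \<open>x0\<close> that
      is not a cocycle; the rest is a cocycle whose image is a boundary, so \<open>lift\<close>
      applies one index lower.\<close>
    have "\<phi> ?j (x0 \<ominus>\<^bsub>C ?j\<^esub> b \<odot>\<^bsub>C ?j\<^esub> x1') = d' ?i (b \<odot>\<^bsub>D ?i\<^esub> y1' \<ominus>\<^bsub>D ?i\<^esub> y0)"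
      using x0 x1' y1' y0 b
      by (simp add: f.map_minus f.map_smult p0 y1_eq f.D.d_minus f.D.d_smult Dj.smult_r_distr)
        (simp add: a_minus_def Dj.a_ac Dj.r_neg Dj.r_neg1 Dj.r_neg2)
    moreover have "d ?j (x0 \<ominus>\<^bsub>C ?j\<^esub> b \<odot>\<^bsub>C ?j\<^esub> x1') = \<zero>\<^bsub>C ?k\<^esub>"
      using x0 x1' b x1 by (simp add: f.C.d_minus f.C.d_smult dx0 x1_eq[symmetric])
    ultimately obtain w v' where w: "w \<in> carrier (C ?i)" and v': "v' \<in> carrier (D i)"
      and w_eq: "x0 \<ominus>\<^bsub>C ?j\<^esub> b \<odot>\<^bsub>C ?j\<^esub> x1' = d ?i w"
      and v'_eq: "b \<odot>\<^bsub>D ?i\<^esub> y1' \<ominus>\<^bsub>D ?i\<^esub> y0 = \<phi> ?i w \<oplus>\<^bsub>D ?i\<^esub> d' i v'"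
      using f.lift[of "x0 \<ominus>\<^bsub>C ?j\<^esub> b \<odot>\<^bsub>C ?j\<^esub> x1'" i "b \<odot>\<^bsub>D ?i\<^esub> y1' \<ominus>\<^bsub>D ?i\<^esub> y0"] x0 x1' y1' y0 b
      by auto
    \<comment> \<open>The primitive has to be \<open>- w\<close>, because second components enter
      \<open>cone_diff\<close> with a minus sign.\<close>
    have "b \<odot>\<^bsub>C ?j\<^esub> x1' \<ominus>\<^bsub>C ?j\<^esub> d ?i (\<ominus>\<^bsub>C ?i\<^esub> w) = b \<odot>\<^bsub>C ?j\<^esub> x1' \<oplus>\<^bsub>C ?j\<^esub> d ?i w"
      using w x1' b by (simp add: f.C.d_uminus a_minus_def)
    also have "\<dots> = x0"
      unfolding w_eq[symmetric] using x0 x1' b by (simp add: f.C.C_add_minus_cancel)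
    finally have 1: "u = cone_diff b C d ?i (Node x1' (\<ominus>\<^bsub>C ?i\<^esub> w))"
      by (simp add: u_eq x1_eq)
    have "y0 = b \<odot>\<^bsub>D ?i\<^esub> y1' \<ominus>\<^bsub>D ?i\<^esub> (b \<odot>\<^bsub>D ?i\<^esub> y1' \<ominus>\<^bsub>D ?i\<^esub> y0)"
      using y0 y1' b by (simp add: a_minus_def Di.minus_add Di.a_ac Di.r_neg Di.r_neg1 Di.r_neg2)
    also have "\<dots> = \<phi> ?i (\<ominus>\<^bsub>C ?i\<^esub> w) \<oplus>\<^bsub>D ?i\<^esub> (b \<odot>\<^bsub>D ?i\<^esub> y1' \<ominus>\<^bsub>D ?i\<^esub> d' i v')"
      unfolding v'_eq using w v' y1' b
      by (simp add: f.map_uminus a_minus_def Di.minus_add Di.a_ac)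
    finally have 2: "v = cone_map \<phi> ?i (Node x1' (\<ominus>\<^bsub>C ?i\<^esub> w)) \<oplus>\<^bsub>cone D ?i\<^esub> cone_diff b D d' i (Node y1' v')"
      by (simp add: v_eq y1_eq)
    show "\<exists>u'\<in>carrier (cone C ?i). \<exists>v'\<in>carrier (cone D i).
        u = cone_diff b C d ?i u' \<and> v = cone_map \<phi> ?i u' \<oplus>\<^bsub>cone D ?i\<^esub> cone_diff b D d' i v'"
      using 1 2 x1' w y1' v'
      by (intro bexI[of _ "Node x1' (\<ominus>\<^bsub>C ?i\<^esub> w)"] bexI[of _ "Node y1' v'"]) auto
  qed
qed

text \<open>\<open>b\<close> acts bijectively on the cokernel of \<open>\<phi>\<close> in each degree.\<close>

locale chain_map_inverting = chain_map +
  fixes b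
  assumes b: "b \<in> carrier R"
    and inj_map: "inj_on (\<phi> i) (carrier (C i))"
    and saturated: "\<lbrakk>y \<in> carrier (D i); b \<odot>\<^bsub>D i\<^esub> y \<in> \<phi> i ` carrier (C i)\<rbrakk> \<Longrightarrow> y \<in> \<phi> i ` carrier (C i)"
    and divisible: "y \<in> carrier (D i) \<Longrightarrow>
      \<exists>x\<in>carrier (C i). \<exists>y'\<in>carrier (D i). y = \<phi> i x \<oplus>\<^bsub>D i\<^esub> b \<odot>\<^bsub>D i\<^esub> y'"

text \<open>The cone is a direct sum in each degree, so the conditions on \<open>b\<close> hold
  componentwise; the element \<open>c\<close> enters only the differential.\<close>

lemma cone_inverting:
  assumes "chain_map_inverting R C d D d' \<phi> b" and c: "c \<in> carrier R"
  shows "chain_map_inverting R (cone C) (cone_diff c C d) (cone D) (cone_diff c D d') (cone_map \<phi>) b"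
proof -
  interpret f: chain_map_inverting R C d D d' \<phi> b by fact
  interpret c: chain_map R "cone C" "cone_diff c C d" "cone D" "cone_diff c D d'" "cone_map \<phi>"
    by (rule cone_chain_map[OF f.chain_map_axioms c])
  have im: "Node x y \<in> cone_map \<phi> i ` carrier (cone C i) \<longleftrightarrow>
      x \<in> \<phi> (Suc i) ` carrier (C (Suc i)) \<and> y \<in> \<phi> i ` carrier (C i)" for x y i
  proof
    assume "x \<in> \<phi> (Suc i) ` carrier (C (Suc i)) \<and> y \<in> \<phi> i ` carrier (C i)"
    then obtain x' y' where "x' \<in> carrier (C (Suc i))" "y' \<in> carrier (C i)"
      "x = \<phi> (Suc i) x'" "y = \<phi> i y'" by blast
    then show "Node x y \<in> cone_map \<phi> i ` carrier (cone C i)"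
      by (intro image_eqI[of _ _ "Node x' y'"]) simp_all
  qed (auto elim!: coneE)
  show ?thesis
  proof
    show "b \<in> carrier R" by (rule f.b)
    show "inj_on (cone_map \<phi> i) (carrier (cone C i))" for i
      by (auto elim!: coneE intro!: inj_onI dest: inj_onD[OF f.inj_map])
  next
    fix v i
    assume "v \<in> carrier (cone D i)" "b \<odot>\<^bsub>cone D i\<^esub> v \<in> cone_map \<phi> i ` carrier (cone C i)"
    then show "v \<in> cone_map \<phi> i ` carrier (cone C i)"
      by (auto elim!: coneE simp: im f.saturated simp del: image_iff)
  next
    fix v i
    assume "v \<in> carrier (cone D i)"
    then obtain y1 y0 where v: "v = Node y1 y0" "y1 \<in> carrier (D (Suc i))" "y0 \<in> carrier (D i)"
      by (rule coneE)
    obtain x1 y1' where 1: "x1 \<in> carrier (C (Suc i))" "y1' \<in> carrier (D (Suc i))"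
      "y1 = \<phi> (Suc i) x1 \<oplus>\<^bsub>D (Suc i)\<^esub> b \<odot>\<^bsub>D (Suc i)\<^esub> y1'" using f.divisible[OF v(2)] by blast
    obtain x0 y0' where 0: "x0 \<in> carrier (C i)" "y0' \<in> carrier (D i)"
      "y0 = \<phi> i x0 \<oplus>\<^bsub>D i\<^esub> b \<odot>\<^bsub>D i\<^esub> y0'" using f.divisible[OF v(3)] by blast
    show "\<exists>u\<in>carrier (cone C i). \<exists>v'\<in>carrier (cone D i).
        v = cone_map \<phi> i u \<oplus>\<^bsub>cone D i\<^esub> b \<odot>\<^bsub>cone D i\<^esub> v'"
      using 0 1 by (intro bexI[of _ "Node x1 x0"] bexI[of _ "Node y1' y0'"]) (auto simp: v)
  qed
qed

text \<open>On the cokernel of \<open>\<phi>\<close> multiplication by \<open>b\<close> is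
  bijective, so its cone has no cohomology and \<open>cone_map\<close> is a quasi-isomorphism
  whatever \<open>\<phi>\<close> itself does to cohomology. The cokernel is never formed:
  \<open>divisible\<close> stands for surjectivity on it and \<open>saturated\<close> for
  injectivity.\<close>

lemma cone_inverting_quasi_iso:
  assumes "chain_map_inverting R C d D d' \<phi> b"
  shows "quasi_iso R (cone C) (cone_diff b C d) (cone D) (cone_diff b D d') (cone_map \<phi>)"
proof -
  interpret f: chain_map_inverting R C d D d' \<phi> b by fact
  interpret c: chain_map R "cone C" "cone_diff b C d" "cone D" "cone_diff b D d'" "cone_map \<phi>"
    by (rule cone_chain_map[OF f.chain_map_axioms f.b])
  note b = f.b
  show ?thesis
  proof
    fix u v i
    assume u: "u \<in> carrier (cone C (Suc (Suc i)))" and v: "v \<in> carrier (cone D (Suc i))"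
      and du: "cone_diff b C d (Suc (Suc i)) u = \<zero>\<^bsub>cone C (Suc (Suc (Suc i)))\<^esub>"
      and eq: "cone_map \<phi> (Suc (Suc i)) u = cone_diff b D d' (Suc i) v"
    let ?i = "Suc i" let ?j = "Suc (Suc i)" let ?k = "Suc (Suc (Suc i))"
    obtain x1 x0 where u_eq: "u = Node x1 x0" and x1: "x1 \<in> carrier (C ?k)"
      and x0: "x0 \<in> carrier (C ?j)" using u by (rule coneE)
    obtain y1 y0 where v_eq: "v = Node y1 y0" and y1: "y1 \<in> carrier (D ?j)"
      and y0: "y0 \<in> carrier (D ?i)" using v by (rule coneE)
    have p1: "\<phi> ?k x1 = d' ?j y1" and p0: "\<phi> ?j x0 = b \<odot>\<^bsub>D ?j\<^esub> y1 \<ominus>\<^bsub>D ?j\<^esub> d' ?i y0"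
      using eq by (auto simp: u_eq v_eq)
    interpret Cj: module R "C ?j" by (rule f.C.module_C)
    interpret Dj: module R "D ?j" by (rule f.D.module_C)
    interpret Di: module R "D ?i" by (rule f.D.module_C)
    \<comment> \<open>Dividing \<open>y0\<close> by \<open>b\<close> supplies both halves of the
      primitive: \<open>y1'\<close> is its first component on the \<open>D\<close> side, where the
      second may be zero, and \<open>x0'\<close> is its second component on the \<open>C\<close>
      side.\<close>
    obtain x0' y1' where x0': "x0' \<in> carrier (C ?i)" and y1': "y1' \<in> carrier (D ?i)"
      and y0_eq: "y0 = \<phi> ?i x0' \<oplus>\<^bsub>D ?i\<^esub> b \<odot>\<^bsub>D ?i\<^esub> y1'"
      using f.divisible[OF y0] by blast
    have "b \<odot>\<^bsub>D ?j\<^esub> (y1 \<ominus>\<^bsub>D ?j\<^esub> d' ?i y1') = \<phi> ?j (x0 \<oplus>\<^bsub>C ?j\<^esub> d ?i x0')"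
      using x0 x0' y1 y1' b
      by (simp add: f.map_add f.map_d p0 y0_eq f.D.d_add f.D.d_smult Dj.smult_minus_distr)
        (simp add: a_minus_def Dj.minus_add Dj.a_ac Dj.r_neg1 Dj.r_neg2 Dj.r_neg Dj.l_neg)
    note key = this
    \<comment> \<open>Modulo the image of \<open>\<phi>\<close> this difference is killed by
      \<open>b\<close>, hence it vanishes there.\<close>
    have "y1 \<ominus>\<^bsub>D ?j\<^esub> d' ?i y1' \<in> \<phi> ?j ` carrier (C ?j)"
      by (rule f.saturated) (use x0 x0' y1 y1' key in auto)
    then obtain x1' where x1': "x1' \<in> carrier (C ?j)" and x1'_eq: "y1 \<ominus>\<^bsub>D ?j\<^esub> d' ?i y1' = \<phi> ?j x1'"
      by blast
    have y1_eq: "y1 = \<phi> ?j x1' \<oplus>\<^bsub>D ?j\<^esub> d' ?i y1'"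
      using y1 y1' by (simp add: x1'_eq[symmetric] Dj.a_comm f.D.C_add_minus_cancel)
    have "\<phi> ?j (b \<odot>\<^bsub>C ?j\<^esub> x1') = \<phi> ?j (x0 \<oplus>\<^bsub>C ?j\<^esub> d ?i x0')"
      using key x1' b by (simp add: x1'_eq f.map_smult)
    then have bx: "b \<odot>\<^bsub>C ?j\<^esub> x1' = x0 \<oplus>\<^bsub>C ?j\<^esub> d ?i x0'"
      by (rule inj_onD[OF f.inj_map]) (use x1' x0 x0' b in auto)
    have "\<phi> ?k x1 = \<phi> ?k (d ?j x1')"
      using x1' y1' by (simp add: p1 y1_eq f.map_d f.D.d_add f.D.d_d)
    then have x1_eq: "x1 = d ?j x1'"
      by (rule inj_onD[OF f.inj_map]) (use x1' x1 in auto)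
    have "x0 = b \<odot>\<^bsub>C ?j\<^esub> x1' \<ominus>\<^bsub>C ?j\<^esub> d ?i x0'"
      using x0 x0' by (simp add: bx a_minus_def Cj.a_assoc Cj.r_neg)
    then have 1: "u = cone_diff b C d ?i (Node x1' x0')"
      by (simp add: u_eq x1_eq)
    have 2: "v = cone_map \<phi> ?i (Node x1' x0') \<oplus>\<^bsub>cone D ?i\<^esub> cone_diff b D d' i (Node y1' \<zero>\<^bsub>D i\<^esub>)"
      using y1' b x0' by (simp add: v_eq y1_eq y0_eq)
    show "\<exists>u'\<in>carrier (cone C ?i). \<exists>v'\<in>carrier (cone D i).
        u = cone_diff b C d ?i u' \<and> v = cone_map \<phi> ?i u' \<oplus>\<^bsub>cone D ?i\<^esub> cone_diff b D d' i v'"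
      using 1 2 x1' x0' y1'
      by (intro bexI[of _ "Node x1' x0'"] bexI[of _ "Node y1' \<zero>\<^bsub>D i\<^esub>"]) auto
  qed
qed

text \<open>In the long exact sequence of the cone, its cohomology at index \<open>i\<close> sits
  between that of \<open>C\<close> at \<open>i\<close> and at \<open>i + 1\<close>, so the range
  from three on is not diminished.\<close>

lemma cone_exact:
  assumes "cochain_complex R C d" and b: "b \<in> carrier R" and ex: "exact_from_three C d"
  shows "exact_from_three (cone C) (cone_diff b C d)"
  unfolding exact_from_three_def
proof (intro allI ballI impI)
  interpret C: cochain_complex R C d by fact
  fix i u
  assume i: "2 \<le> i" and u: "u \<in> carrier (cone C (Suc i))"
    and du: "cone_diff b C d (Suc i) u = \<zero>\<^bsub>cone C (Suc (Suc i))\<^esub>"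
  obtain x1 x0 where u_eq: "u = Node x1 x0" and x1: "x1 \<in> carrier (C (Suc (Suc i)))"
    and x0: "x0 \<in> carrier (C (Suc i))" using u by (rule coneE)
  have dx1: "d (Suc (Suc i)) x1 = \<zero>\<^bsub>C (Suc (Suc (Suc i)))\<^esub>"
    and dx0: "d (Suc i) x0 = b \<odot>\<^bsub>C (Suc (Suc i))\<^esub> x1"
    using du x1 x0 b by (auto simp: u_eq C.C_minus_eq_zero_iff)
  obtain x1' where x1': "x1' \<in> carrier (C (Suc i))" and x1_eq: "x1 = d (Suc i) x1'"
    using ex x1 dx1 i unfolding exact_from_three_def by (metis imageE le_SucI)
  have "d (Suc i) (x0 \<ominus>\<^bsub>C (Suc i)\<^esub> b \<odot>\<^bsub>C (Suc i)\<^esub> x1') = \<zero>\<^bsub>C (Suc (Suc i))\<^esub>"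
    using x0 x1' b x1 by (simp add: C.d_minus C.d_smult dx0 x1_eq[symmetric])
  moreover have "x0 \<ominus>\<^bsub>C (Suc i)\<^esub> b \<odot>\<^bsub>C (Suc i)\<^esub> x1' \<in> carrier (C (Suc i))"
    using x0 x1' b by simp
  ultimately obtain w where w: "w \<in> carrier (C i)"
    and w_eq: "x0 \<ominus>\<^bsub>C (Suc i)\<^esub> b \<odot>\<^bsub>C (Suc i)\<^esub> x1' = d i w"
    using ex i unfolding exact_from_three_def by blast
  interpret Ci: module R "C (Suc i)" by (rule C.module_C)
  have "b \<odot>\<^bsub>C (Suc i)\<^esub> x1' \<ominus>\<^bsub>C (Suc i)\<^esub> d i (\<ominus>\<^bsub>C i\<^esub> w) = b \<odot>\<^bsub>C (Suc i)\<^esub> x1' \<oplus>\<^bsub>C (Suc i)\<^esub> d i w"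
    using w x1' b by (simp add: C.d_uminus a_minus_def)
  also have "\<dots> = x0"
    unfolding w_eq[symmetric] using x0 x1' b by (simp add: C.C_add_minus_cancel)
  finally show "u \<in> cone_diff b C d i ` carrier (cone C i)"
    using w x1' by (intro image_eqI[of _ _ "Node x1' (\<ominus>\<^bsub>C i\<^esub> w)"]) (auto simp: u_eq x1_eq)
qed

text \<open>At index two the same sequence has one vanishing neighbour, \<open>H^3\<close> of
  \<open>C\<close>; this still makes \<open>H^2\<close> of \<open>C\<close> map onto
  \<open>H^2\<close> of the cone.\<close>

lemma cone_cocycle:
  assumes "cochain_complex R C d" and b: "b \<in> carrier R" and ex: "exact_from_three C d"
    and u: "u \<in> carrier (cone C 2)" and du: "cone_diff b C d 2 u = \<zero>\<^bsub>cone C 3\<^esub>"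
  shows "\<exists>y\<in>carrier (C 2). \<exists>v\<in>carrier (cone C 1). d 2 y = \<zero>\<^bsub>C 3\<^esub> \<and>
    u = Node \<zero>\<^bsub>C 3\<^esub> y \<oplus>\<^bsub>cone C 2\<^esub> cone_diff b C d 1 v"
proof -
  interpret C: cochain_complex R C d by fact
  obtain x1 x0 where u_eq: "u = Node x1 x0" and x1: "x1 \<in> carrier (C (Suc 2))"
    and x0: "x0 \<in> carrier (C 2)" using u by (rule coneE)
  have dx1: "d (Suc 2) x1 = \<zero>\<^bsub>C (Suc (Suc 2))\<^esub>" and dx0: "d 2 x0 = b \<odot>\<^bsub>C (Suc 2)\<^esub> x1"
    using du x1 x0 b C.d_closed[of x0 2]
    by (auto simp: u_eq C.C_minus_eq_zero_iff eval_nat_numeral)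
  obtain x1' where x1': "x1' \<in> carrier (C 2)" and x1_eq: "x1 = d 2 x1'"
    using ex x1 dx1 unfolding exact_from_three_def by blast
  have "d 2 (x0 \<ominus>\<^bsub>C 2\<^esub> b \<odot>\<^bsub>C 2\<^esub> x1') = \<zero>\<^bsub>C (Suc 2)\<^esub>"
    using x0 x1' b x1 by (simp add: C.d_minus C.d_smult dx0 x1_eq[symmetric])
  moreover have "x0 = (x0 \<ominus>\<^bsub>C 2\<^esub> b \<odot>\<^bsub>C 2\<^esub> x1') \<oplus>\<^bsub>C 2\<^esub> b \<odot>\<^bsub>C 2\<^esub> x1'"
    using x0 x1' b C.C_add_minus_cancel
    by (metis C.C_closed(3) C.C_closed(5) abelian_monoid.a_comm abelian_group.axioms(1) C.abelian_group_C)
  ultimately show ?thesis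
    using x0 x1' b x1
    by (intro bexI[of _ "x0 \<ominus>\<^bsub>C 2\<^esub> b \<odot>\<^bsub>C 2\<^esub> x1'"] bexI[of _ "Node x1' \<zero>\<^bsub>C 1\<^esub>"])
      (auto simp: u_eq x1_eq eval_nat_numeral)
qed

section \<open>Koszul complexes as cones iterated over a list of ring elements\<close>

primrec koszul :: "'a list \<Rightarrow> (nat \<Rightarrow> ('a, 'b tree) module) \<Rightarrow> nat \<Rightarrow> ('a, 'b tree) module" where
  "koszul [] C = C"
| "koszul (b # bs) C = cone (koszul bs C)"

primrec koszul_diff ::
  "'a list \<Rightarrow> (nat \<Rightarrow> ('a, 'b tree) module) \<Rightarrow> (nat \<Rightarrow> 'b tree \<Rightarrow> 'b tree) \<Rightarrow> nat \<Rightarrow> 'b tree \<Rightarrow> 'b tree" where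
  "koszul_diff [] C d = d"
| "koszul_diff (b # bs) C d = cone_diff b (koszul bs C) (koszul_diff bs C d)"

primrec koszul_map :: "'a list \<Rightarrow> (nat \<Rightarrow> 'b tree \<Rightarrow> 'c tree) \<Rightarrow> nat \<Rightarrow> 'b tree \<Rightarrow> 'c tree" where
  "koszul_map [] \<phi> = \<phi>"
| "koszul_map (b # bs) \<phi> = cone_map (koszul_map bs \<phi>)"

text \<open>The summand of the Koszul complex on the product of all basis elements, in the degree where
  it carries the top cohomology.\<close>

primrec koszul_top :: "'a list \<Rightarrow> (nat \<Rightarrow> ('a, 'b tree) module) \<Rightarrow> 'b tree \<Rightarrow> 'b tree" where
  "koszul_top [] C y = y"
| "koszul_top (b # bs) C y = Node \<zero>\<^bsub>koszul bs C 3\<^esub> (koszul_top bs C y)"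

lemma koszul_append [simp]: "koszul (bs @ cs) C = koszul bs (koszul cs C)"
  by (induction bs) auto

lemma koszul_diff_append [simp]:
  "koszul_diff (bs @ cs) C d = koszul_diff bs (koszul cs C) (koszul_diff cs C d)"
  by (induction bs) auto

lemma koszul_top_append [simp]: "koszul_top (bs @ cs) C y = koszul_top bs (koszul cs C) (koszul_top cs C y)"
  by (induction bs) auto

lemma koszul_complex:
  assumes "cochain_complex R C d" and "set bs \<subseteq> carrier R"
  shows "cochain_complex R (koszul bs C) (koszul_diff bs C d)"
  using assms(2) by (induction bs) (auto intro: assms(1) cone_complex)

lemma koszul_chain_map:
  assumes "chain_map R C d D d' \<phi>" and "set bs \<subseteq> carrier R"
  shows "chain_map R (koszul bs C) (koszul_diff bs C d) (koszul bs D) (koszul_diff bs D d')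
    (koszul_map bs \<phi>)"
  using assms(2) by (induction bs) (auto intro: assms(1) cone_chain_map)

lemma koszul_quasi_iso:
  assumes "quasi_iso R C d D d' \<phi>" and "set bs \<subseteq> carrier R"
  shows "quasi_iso R (koszul bs C) (koszul_diff bs C d) (koszul bs D) (koszul_diff bs D d')
    (koszul_map bs \<phi>)"
  using assms(2) by (induction bs) (auto intro: assms(1) cone_quasi_iso)

lemma koszul_inverting:
  assumes "chain_map_inverting R C d D d' \<phi> b" and "set bs \<subseteq> carrier R"
  shows "chain_map_inverting R (koszul bs C) (koszul_diff bs C d) (koszul bs D) (koszul_diff bs D d')
    (koszul_map bs \<phi>) b"
  using assms(2) by (induction bs) (auto intro: assms(1) cone_inverting)

text \<open>The innermost cone on \<open>b\<close> kills the cokernel of \<open>\<phi>\<close>. The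
  cones inside it only have to keep \<open>b\<close> bijective on the cokernel, and those outside it
  preserve quasi-isomorphisms.\<close>

lemma koszul_inverting_quasi_iso:
  assumes "chain_map_inverting R C d D d' \<phi> b" and "b \<in> set bs" and "set bs \<subseteq> carrier R"
  shows "quasi_iso R (koszul bs C) (koszul_diff bs C d) (koszul bs D) (koszul_diff bs D d')
    (koszul_map bs \<phi>)"
  using assms(2,3)
proof (induction bs)
  case (Cons c bs)
  show ?case
  proof (cases "b \<in> set bs")
    case True
    with Cons show ?thesis by (simp add: cone_quasi_iso)
  next
    case False
    with Cons.prems have "c = b" by simp
    then show ?thesis
      using cone_inverting_quasi_iso[OF koszul_inverting[OF assms(1), of bs]] Cons.prems by simp
  qed
qed simp

lemma koszul_exact:
  assumes "cochain_complex R C d" and "set bs \<subseteq> carrier R" and "exact_from_three C d"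
  shows "exact_from_three (koszul bs C) (koszul_diff bs C d)"
  using assms(2) by (induction bs) (auto intro!: assms(3) cone_exact[OF koszul_complex[OF assms(1)]])

lemma koszul_map_comp:
  "koszul_map bs \<psi> i (koszul_map bs \<phi> i u) = koszul_map bs (\<lambda>i x. \<psi> i (\<phi> i x)) i u"
  by (induction bs arbitrary: i u) (auto simp: cone_map_def)

lemma koszul_trivial:
  assumes "\<And>i. n \<le> i \<Longrightarrow> carrier (C i) = {\<zero>\<^bsub>C i\<^esub>}" and "n \<le> i"
  shows "carrier (koszul bs C i) = {\<zero>\<^bsub>koszul bs C i\<^esub>}"
  using assms(2) by (induction bs arbitrary: i) (auto simp: assms(1) elim!: coneE)

text \<open>A cochain has finitely many components, so one exponent of \<open>a\<close> serves all
  of them.\<close>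

lemma koszul_torsion:
  assumes "cochain_complex R C d" and a: "a \<in> carrier R" and bs: "set bs \<subseteq> carrier R"
    and tor: "\<And>i x. x \<in> carrier (C i) \<Longrightarrow> \<exists>n. a [^]\<^bsub>R\<^esub> (n::nat) \<odot>\<^bsub>C i\<^esub> x = \<zero>\<^bsub>C i\<^esub>"
    and "u \<in> carrier (koszul bs C i)"
  shows "\<exists>n. a [^]\<^bsub>R\<^esub> (n::nat) \<odot>\<^bsub>koszul bs C i\<^esub> u = \<zero>\<^bsub>koszul bs C i\<^esub>"
  using assms(5) bs
proof (induction bs arbitrary: u i)
  case Nil
  then show ?case using tor by simp
next
  case (Cons b bs)
  interpret K: cochain_complex R "koszul bs C" "koszul_diff bs C d"
    by (rule koszul_complex[OF assms(1)]) (use Cons.prems in simp)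
  interpret M: module R "koszul bs C i" by (rule K.module_C)
  interpret N: module R "koszul bs C (Suc i)" by (rule K.module_C)
  obtain x y where u: "u = Node x y" and x: "x \<in> carrier (koszul bs C (Suc i))"
    and y: "y \<in> carrier (koszul bs C i)" using Cons.prems(1) by (auto elim: coneE)
  obtain m n where m: "a [^]\<^bsub>R\<^esub> (m::nat) \<odot>\<^bsub>koszul bs C (Suc i)\<^esub> x = \<zero>\<^bsub>koszul bs C (Suc i)\<^esub>"
    and n: "a [^]\<^bsub>R\<^esub> (n::nat) \<odot>\<^bsub>koszul bs C i\<^esub> y = \<zero>\<^bsub>koszul bs C i\<^esub>"
    using Cons.IH[OF x] Cons.IH[OF y] Cons.prems(2) by auto
  have "a [^]\<^bsub>R\<^esub> (n + m) \<odot>\<^bsub>koszul bs C (Suc i)\<^esub> x = \<zero>\<^bsub>koszul bs C (Suc i)\<^esub>"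
    using a x m by (simp add: M.R.nat_pow_mult[symmetric] N.smult_assoc1)
  moreover have "a [^]\<^bsub>R\<^esub> (n + m) \<odot>\<^bsub>koszul bs C i\<^esub> y = \<zero>\<^bsub>koszul bs C i\<^esub>"
    using a y n by (subst add.commute) (simp add: M.R.nat_pow_mult[symmetric] M.smult_assoc1)
  ultimately show ?case by (auto simp: u)
qed

lemma koszul_top_hom:
  assumes "cochain_complex R C d" and "set bs \<subseteq> carrier R"
  shows "koszul_top bs C \<in> mod_hom R (C 2) (koszul bs C 2)"
  using assms(2)
proof (induction bs)
  case Nil
  then show ?case by (simp add: mod_hom_def)
next
  case (Cons b bs)
  interpret K: cochain_complex R "koszul bs C" "koszul_diff bs C d"
    by (rule koszul_complex[OF assms(1)]) (use Cons.prems in simp)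
  show ?case using Cons by (auto simp: mod_hom_def eval_nat_numeral)
qed

lemma koszul_top_map:
  assumes "chain_map R C d D d' \<phi>" and "set bs \<subseteq> carrier R"
  shows "koszul_map bs \<phi> 2 (koszul_top bs C y) = koszul_top bs D (\<phi> 2 y)"
  using assms(2)
proof (induction bs)
  case (Cons b bs)
  interpret chain_map R "koszul bs C" "koszul_diff bs C d" "koszul bs D" "koszul_diff bs D d'"
    "koszul_map bs \<phi>" by (rule koszul_chain_map[OF assms(1)]) (use Cons.prems in simp)
  show ?case using Cons map_zero[of 3] by (simp add: eval_nat_numeral)
qed simp

lemma koszul_top_boundary:
  assumes "cochain_complex R C d" and "set bs \<subseteq> carrier R" and "y \<in> carrier (C 1)"
  shows "\<exists>v\<in>carrier (koszul bs C 1). koszul_top bs C (d 1 y) = koszul_diff bs C d 1 v"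
  using assms(2)
proof (induction bs)
  case Nil
  then show ?case using assms(3) by auto
next
  case (Cons b bs)
  interpret K: cochain_complex R "koszul bs C" "koszul_diff bs C d"
    by (rule koszul_complex[OF assms(1)]) (use Cons.prems in simp)
  obtain v where v: "v \<in> carrier (koszul bs C 1)" "koszul_top bs C (d 1 y) = koszul_diff bs C d 1 v"
    using Cons by auto
  interpret M: module R "koszul bs C 2" by (rule K.module_C)
  have "koszul_diff bs C d 1 v \<in> carrier (koszul bs C 2)"
    using K.d_closed[OF v(1)] by (simp add: eval_nat_numeral)
  \<comment> \<open>The primitive changes its sign with every cone, because of the minus in
    \<open>cone_diff\<close>.\<close>
  then have "koszul_top (b # bs) C (d 1 y) =
      koszul_diff (b # bs) C d 1 (Node \<zero>\<^bsub>koszul bs C 2\<^esub> (\<ominus>\<^bsub>koszul bs C 1\<^esub> v))"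
    using v Cons.prems K.d_zero[of 2] K.d_uminus[OF v(1)] K.C_neutral(6)[of _ 2] by (simp add: eval_nat_numeral a_minus_def)
  then show ?case
    using v by (intro bexI[of _ "Node \<zero>\<^bsub>koszul bs C 2\<^esub> (\<ominus>\<^bsub>koszul bs C 1\<^esub> v)"]) (auto simp: eval_nat_numeral)
qed

text \<open>This is where vanishing above index two is spent: \<open>cone_cocycle\<close> strips off
  one adjoined element after another, so \<open>H^2\<close> of \<open>C\<close> maps onto
  \<open>H^2\<close> of the Koszul complex. Exactness survives each cone by
  \<open>koszul_exact\<close>, which keeps the induction going.\<close>

lemma koszul_cocycle:
  assumes "cochain_complex R C d" and "set bs \<subseteq> carrier R" and ex: "exact_from_three C d"
    and "u \<in> carrier (koszul bs C 2)" and "koszul_diff bs C d 2 u = \<zero>\<^bsub>koszul bs C 3\<^esub>"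
  shows "\<exists>y\<in>carrier (C 2). \<exists>v\<in>carrier (koszul bs C 1). d 2 y = \<zero>\<^bsub>C 3\<^esub> \<and>
    u = koszul_top bs C y \<oplus>\<^bsub>koszul bs C 2\<^esub> koszul_diff bs C d 1 v"
  using assms(2,4,5)
proof (induction bs arbitrary: u)
  case Nil
  interpret C: cochain_complex R C d by fact
  show ?case using Nil by (intro bexI[of _ u] bexI[of _ "\<zero>\<^bsub>C 1\<^esub>"])
      (use C.d_zero[of 1] in \<open>auto simp: eval_nat_numeral\<close>)
next
  case (Cons b bs)
  interpret K: cochain_complex R "koszul bs C" "koszul_diff bs C d"
    by (rule koszul_complex[OF assms(1)]) (use Cons.prems in simp)
  interpret KK: cochain_complex R "cone (koszul bs C)" "cone_diff b (koszul bs C) (koszul_diff bs C d)"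
    by (rule cone_complex[OF K.cochain_complex_axioms]) (use Cons.prems in simp)
  interpret M: module R "cone (koszul bs C) 2" by (rule KK.module_C)
  interpret N: module R "koszul bs C 2" by (rule K.module_C)
  have bs: "set bs \<subseteq> carrier R" and b: "b \<in> carrier R" using Cons.prems by auto
  let ?D = "cone_diff b (koszul bs C) (koszul_diff bs C d)"
  let ?z = "\<zero>\<^bsub>koszul bs C 3\<^esub>"
  obtain x v where x: "x \<in> carrier (koszul bs C 2)" and v: "v \<in> carrier (cone (koszul bs C) 1)"
    and dx: "koszul_diff bs C d 2 x = \<zero>\<^bsub>koszul bs C 3\<^esub>"
    and u: "u = Node ?z x \<oplus>\<^bsub>cone (koszul bs C) 2\<^esub> ?D 1 v"
    using cone_cocycle[OF K.cochain_complex_axioms b koszul_exact[OF assms(1) bs ex], of u] Cons.prems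
    by auto
  obtain y w where y: "y \<in> carrier (C 2)" "d 2 y = \<zero>\<^bsub>C 3\<^esub>" and w: "w \<in> carrier (koszul bs C 1)"
    and x_eq: "x = koszul_top bs C y \<oplus>\<^bsub>koszul bs C 2\<^esub> koszul_diff bs C d 1 w"
    using Cons.IH[OF bs x dx] by blast
  have top: "koszul_top bs C y \<in> carrier (koszul bs C 2)"
    by (rule mod_homD(1)[OF koszul_top_hom[OF assms(1) bs] y(1)])
  have dw: "koszul_diff bs C d 1 w \<in> carrier (koszul bs C 2)"
    using K.d_closed[OF w] by (simp add: eval_nat_numeral)
  \<comment> \<open>Moves the inner boundary of \<open>w\<close> into the outer cone, where the
    primitive needs the opposite sign.\<close>
  let ?w = "Node \<zero>\<^bsub>koszul bs C 2\<^esub> (\<ominus>\<^bsub>koszul bs C 1\<^esub> w)"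
  have w': "?w \<in> carrier (cone (koszul bs C) 1)" using w by (auto simp: eval_nat_numeral)
  have Dw: "?D 1 ?w = Node ?z (koszul_diff bs C d 1 w)"
    using K.d_zero[of 2] K.d_uminus[OF w] b dw K.C_neutral(6)[OF dw] by (simp add: eval_nat_numeral a_minus_def)
  have cl: "?D 1 v \<in> carrier (cone (koszul bs C) 2)" "?D 1 ?w \<in> carrier (cone (koszul bs C) 2)"
    using KK.d_closed[OF v] KK.d_closed[OF w'] by (simp_all add: eval_nat_numeral)
  have z: "?z \<in> carrier (koszul bs C (Suc 2))" using K.C_closed(1)[of 3] by (simp add: eval_nat_numeral)
  have "Node ?z x = koszul_top (b # bs) C y \<oplus>\<^bsub>cone (koszul bs C) 2\<^esub> ?D 1 ?w"
    unfolding Dw x_eq using z K.C_neutral(1)[of _ 3] K.C_closed(1)[of 3] by (simp add: eval_nat_numeral)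
  then have "u = koszul_top (b # bs) C y \<oplus>\<^bsub>cone (koszul bs C) 2\<^esub> (?D 1 ?w \<oplus>\<^bsub>cone (koszul bs C) 2\<^esub> ?D 1 v)"
    unfolding u using cl top z by (simp add: M.a_assoc del: cone_simps(3,5))
  also have "?D 1 ?w \<oplus>\<^bsub>cone (koszul bs C) 2\<^esub> ?D 1 v = ?D 1 (?w \<oplus>\<^bsub>cone (koszul bs C) 1\<^esub> v)"
    using KK.d_add[OF w' v] by (simp add: eval_nat_numeral del: cone_simps(3,5))
  finally show ?case using y w' v KK.C_closed(2)[OF w' v] by (simp only: koszul.simps koszul_diff.simps) blast
qed

text \<open>The first summand of a cone has the index raised by one, so at index two every summand
  but the top one comes from some \<open>C i\<close> with \<open>i >= 3\<close>.\<close>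

lemma koszul_top_is_all:
  assumes "cochain_complex R C d" and "set bs \<subseteq> carrier R"
    and "\<And>i. 3 \<le> i \<Longrightarrow> carrier (C i) = {\<zero>\<^bsub>C i\<^esub>}"
  shows "carrier (koszul bs C 2) = koszul_top bs C ` carrier (C 2)"
proof
  show "koszul_top bs C ` carrier (C 2) \<subseteq> carrier (koszul bs C 2)"
    using mod_homD(1)[OF koszul_top_hom[OF assms(1,2)]] by blast
  show "carrier (koszul bs C 2) \<subseteq> koszul_top bs C ` carrier (C 2)"
    using assms(2)
  proof (induction bs)
    case (Cons b bs)
    show ?case
    proof
      fix u assume "u \<in> carrier (koszul (b # bs) C 2)"
      then obtain x y where u: "u = Node x y" "x \<in> carrier (koszul bs C 3)" "y \<in> carrier (koszul bs C 2)"
        by (auto elim!: coneE simp: eval_nat_numeral)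
      have "x = \<zero>\<^bsub>koszul bs C 3\<^esub>" using koszul_trivial[of 3 C 3 bs] assms(3) u(2) by auto
      then show "u \<in> koszul_top (b # bs) C ` carrier (C 2)" using u Cons by auto
    qed
  qed simp
qed

text \<open>One half of the description of the top Koszul cohomology as \<open>C 2\<close> modulo
  the multiples of \<open>bs\<close>, for \<open>C\<close> trivial around index two: a boundary with
  top component \<open>y\<close> writes \<open>y\<close> as a combination of multiples
  \<open>b z\<close>. It is applied with \<open>H\<close> the ideal generated by the list.\<close>

lemma koszul_top_boundaryD:
  assumes "cochain_complex R C d" and "set bs \<subseteq> carrier R"
    and triv: "\<And>i. 3 \<le> i \<Longrightarrow> carrier (C i) = {\<zero>\<^bsub>C i\<^esub>}" and one: "carrier (C 1) = {\<zero>\<^bsub>C 1\<^esub>}"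
    and H: "submodule H R (C 2)" and bH: "\<And>b y. b \<in> set bs \<Longrightarrow> y \<in> carrier (C 2) \<Longrightarrow> b \<odot>\<^bsub>C 2\<^esub> y \<in> H"
    and "y \<in> carrier (C 2)" and "koszul_top bs C y \<in> koszul_diff bs C d 1 ` carrier (koszul bs C 1)"
  shows "y \<in> H"
  using assms(2,7,8) bH
proof (induction bs arbitrary: y)
  case Nil
  interpret C: cochain_complex R C d by fact
  interpret M: module R "C 2" by (rule C.module_C)
  show ?case using Nil one C.d_zero[of 1] subgroup.one_closed[OF submodule.axioms(1)[OF H]]
    by (auto simp: eval_nat_numeral)
next
  case (Cons b bs)
  interpret C: cochain_complex R C d by fact
  interpret K: cochain_complex R "koszul bs C" "koszul_diff bs C d"
    by (rule koszul_complex[OF assms(1)]) (use Cons.prems in simp)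
  interpret M: module R "C 2" by (rule C.module_C)
  interpret N: module R "koszul bs C 2" by (rule K.module_C)
  have bs: "set bs \<subseteq> carrier R" and b: "b \<in> carrier R" using Cons.prems by auto
  note top = koszul_top_hom[OF assms(1) bs]
  note H' = M.submoduleE[OF H]
  obtain v1 v0 where v1: "v1 \<in> carrier (koszul bs C 2)" and v0: "v0 \<in> carrier (koszul bs C 1)"
    and eq: "koszul_top bs C y = b \<odot>\<^bsub>koszul bs C 2\<^esub> v1 \<ominus>\<^bsub>koszul bs C 2\<^esub> koszul_diff bs C d 1 v0"
    using Cons.prems(3) by (auto elim!: coneE simp: eval_nat_numeral)
  obtain z where z: "z \<in> carrier (C 2)" and v1_eq: "v1 = koszul_top bs C z"
    using v1 koszul_top_is_all[OF assms(1) bs triv] by auto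
  have dv0: "koszul_diff bs C d 1 v0 \<in> carrier (koszul bs C 2)"
    using K.d_closed[OF v0] by (simp add: eval_nat_numeral)
  \<comment> \<open>Solving the boundary equation for the inner boundary shows that
    \<open>b z - y\<close>, rather than \<open>y\<close>, is the top component of a boundary on the
    shorter list.\<close>
  have "koszul_top bs C (b \<odot>\<^bsub>C 2\<^esub> z \<ominus>\<^bsub>C 2\<^esub> y) = b \<odot>\<^bsub>koszul bs C 2\<^esub> v1 \<ominus>\<^bsub>koszul bs C 2\<^esub> koszul_top bs C y"
    using z b Cons.prems(2)
    by (simp add: v1_eq mod_hom_zero_minus(3)[OF top C.module_C K.module_C] mod_homD(3)[OF top])
  also have "\<dots> = koszul_diff bs C d 1 v0"
    unfolding eq using dv0 v1 b
    by (simp add: a_minus_def N.minus_add N.a_ac N.r_neg N.r_neg1 N.r_neg2)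
  finally have "b \<odot>\<^bsub>C 2\<^esub> z \<ominus>\<^bsub>C 2\<^esub> y \<in> H"
    using Cons.IH[OF bs, of "b \<odot>\<^bsub>C 2\<^esub> z \<ominus>\<^bsub>C 2\<^esub> y"] Cons.prems(2,4) z b v0 by simp
  moreover have "b \<odot>\<^bsub>C 2\<^esub> z \<in> H" using Cons.prems(4) z by simp
  moreover have "y = b \<odot>\<^bsub>C 2\<^esub> z \<ominus>\<^bsub>C 2\<^esub> (b \<odot>\<^bsub>C 2\<^esub> z \<ominus>\<^bsub>C 2\<^esub> y)"
    using z b Cons.prems(2) by (simp add: a_minus_def M.minus_add M.a_ac M.r_neg M.r_neg1 M.r_neg2)
  ultimately show "y \<in> H" using H'(3,5) by (metis a_minus_def)
qed

section \<open>Turning a complex into one whose elements are single leaves\<close>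

definition leaf_diff :: "(nat \<Rightarrow> 'b \<Rightarrow> 'c) \<Rightarrow> nat \<Rightarrow> 'b tree \<Rightarrow> 'c tree" where
  "leaf_diff d i u = Leaf (d i (label u))"

abbreviation leaves :: "(nat \<Rightarrow> ('a, 'b) module) \<Rightarrow> nat \<Rightarrow> ('a, 'b tree) module" where
  "leaves C \<equiv> \<lambda>i. leaf_module (C i)"

lemma leaf_diff_simp [simp]: "leaf_diff d i (Leaf x) = Leaf (d i x)"
  by (simp add: leaf_diff_def)

lemma leaves_complex:
  assumes "cochain_complex R C d"
  shows "cochain_complex R (leaves C) (leaf_diff d)"
proof -
  interpret C: cochain_complex R C d by fact
  show ?thesis
    by (rule cochain_complex.intro)
      (auto simp: leaf_module_module C.module_C mod_hom_def C.d_add C.d_smult C.d_d)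
qed

lemma leaves_chain_map:
  assumes "chain_map R C d D d' \<phi>"
  shows "chain_map R (leaves C) (leaf_diff d) (leaves D) (leaf_diff d') (leaf_diff \<phi>)"
proof -
  interpret f: chain_map R C d D d' \<phi> by fact
  show ?thesis
    by (intro chain_map.intro leaves_complex f.C.cochain_complex_axioms f.D.cochain_complex_axioms
        chain_map_axioms.intro) (auto simp: mod_hom_def f.map_add f.map_smult f.map_d)
qed

lemma leaves_quasi_iso:
  assumes "quasi_iso R C d D d' \<phi>"
  shows "quasi_iso R (leaves C) (leaf_diff d) (leaves D) (leaf_diff d') (leaf_diff \<phi>)"
proof -
  interpret f: quasi_iso R C d D d' \<phi> by fact
  show ?thesis
  proof (intro quasi_iso.intro leaves_chain_map f.chain_map_axioms quasi_iso_axioms.intro)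
    fix u v i
    assume "u \<in> carrier (leaf_module (C (Suc (Suc i))))" and "v \<in> carrier (leaf_module (D (Suc i)))"
      and "leaf_diff d (Suc (Suc i)) u = \<zero>\<^bsub>leaf_module (C (Suc (Suc (Suc i))))\<^esub>"
      and "leaf_diff \<phi> (Suc (Suc i)) u = leaf_diff d' (Suc i) v"
    then show "\<exists>x'\<in>carrier (leaf_module (C (Suc i))). \<exists>y'\<in>carrier (leaf_module (D i)).
        u = leaf_diff d (Suc i) x' \<and> v = leaf_diff \<phi> (Suc i) x' \<oplus>\<^bsub>leaf_module (D (Suc i))\<^esub> leaf_diff d' i y'"
      using f.lift by (auto simp: bex_simps)
  qed
qed

lemma leaves_inverting:
  assumes "chain_map_inverting R C d D d' \<phi> b"
  shows "chain_map_inverting R (leaves C) (leaf_diff d) (leaves D) (leaf_diff d') (leaf_diff \<phi>) b"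
proof -
  interpret f: chain_map_inverting R C d D d' \<phi> b by fact
  show ?thesis
  proof (intro chain_map_inverting.intro leaves_chain_map f.chain_map_axioms
      chain_map_inverting_axioms.intro f.b)
    show "inj_on (leaf_diff \<phi> i) (carrier (leaf_module (C i)))" for i
      by (auto intro!: inj_onI dest: inj_onD[OF f.inj_map])
  next
    fix v i
    assume "v \<in> carrier (leaf_module (D i))"
      "b \<odot>\<^bsub>leaf_module (D i)\<^esub> v \<in> leaf_diff \<phi> i ` carrier (leaf_module (C i))"
    then obtain y where "v = Leaf y" "y \<in> carrier (D i)" "b \<odot>\<^bsub>D i\<^esub> y \<in> \<phi> i ` carrier (C i)" by auto
    then show "v \<in> leaf_diff \<phi> i ` carrier (leaf_module (C i))"
      using f.saturated[of y i] by (auto simp: image_image)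
  next
    fix v i assume "v \<in> carrier (leaf_module (D i))"
    then show "\<exists>x\<in>carrier (leaf_module (C i)). \<exists>y'\<in>carrier (leaf_module (D i)).
        v = leaf_diff \<phi> i x \<oplus>\<^bsub>leaf_module (D i)\<^esub> b \<odot>\<^bsub>leaf_module (D i)\<^esub> y'"
      using f.divisible by (auto simp: bex_simps)
  qed
qed

section \<open>Koszul cohomology of three elements\<close>

lemma zero_quotient_module_iff:
  assumes "abelian_group M" and N: "subgroup N (add_monoid M)" and "S \<subseteq> carrier M" "S \<noteq> {}"
  shows "zero_module (quotient_module (M\<lparr>carrier := S\<rparr>) N) \<longleftrightarrow> S \<subseteq> N"
proof -
  interpret M: abelian_group M by fact
  have carr: "carrier (quotient_module (M\<lparr>carrier := S\<rparr>) N) = (\<lambda>x. N +>\<^bsub>M\<^esub> x) ` S"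
    by (auto simp: quotient_module_def A_RCOSETS_def' a_r_coset_def')
  have coset: "N +>\<^bsub>M\<^esub> x = N \<longleftrightarrow> x \<in> N" if "x \<in> S" for x
    using M.a_coset_join1[OF _ _ N] M.a_coset_join2[OF _ N] that assms(3) by blast
  show ?thesis
    unfolding zero_module_def carr using coset assms(4)
    by (auto simp: quotient_module_def)
qed

lemma zero_cohomology_iff:
  assumes "abelian_group (C i)" and "subgroup (coboundaries C d i) (add_monoid (C i))"
    and "cocycles C d i \<noteq> {}"
  shows "zero_module (cohomology C d i) \<longleftrightarrow> cocycles C d i \<subseteq> coboundaries C d i"
  unfolding cohomology_def
  by (rule zero_quotient_module_iff) (use assms in \<open>auto simp: cocycles_def\<close>)

lemma subgroup_image:
  assumes "abelian_group M" "abelian_group N" and "\<And>x. x \<in> carrier M \<Longrightarrow> \<phi> x \<in> carrier N"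
    and "\<And>x y. x \<in> carrier M \<Longrightarrow> y \<in> carrier M \<Longrightarrow> \<phi> (x \<oplus>\<^bsub>M\<^esub> y) = \<phi> x \<oplus>\<^bsub>N\<^esub> \<phi> y"
  shows "subgroup (\<phi> ` carrier M) (add_monoid N)"
proof -
  interpret M: abelian_group M by fact
  interpret N: abelian_group N by fact
  interpret group_hom "add_monoid M" "add_monoid N" \<phi>
    by (auto simp: group_hom_def group_hom_axioms_def hom_def assms M.add.is_group N.add.is_group)
  show ?thesis using img_is_subgroup by simp
qed

lemma koszul_cochains_simps:
  "carrier (koszul_cochains xs M i) = koszul_basis (length xs) i \<rightarrow>\<^sub>E carrier M"
  "\<zero>\<^bsub>koszul_cochains xs M i\<^esub> = (\<lambda>S\<in>koszul_basis (length xs) i. \<zero>\<^bsub>M\<^esub>)"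
  "u \<oplus>\<^bsub>koszul_cochains xs M i\<^esub> v = (\<lambda>S\<in>koszul_basis (length xs) i. u S \<oplus>\<^bsub>M\<^esub> v S)"
  by (simp_all add: koszul_cochains_def Let_def)

lemma koszul_cochains_group:
  assumes "abelian_group M"
  shows "abelian_group (koszul_cochains xs M i)"
proof -
  interpret M: abelian_group M by fact
  let ?B = "koszul_basis (length xs) i"
  show ?thesis
  proof (rule abelian_groupI)
    fix u assume u: "u \<in> carrier (koszul_cochains xs M i)"
    then have "u S \<in> carrier M" if "S \<in> ?B" for S
      using that by (auto simp: koszul_cochains_simps)
    then show "\<exists>v\<in>carrier (koszul_cochains xs M i). v \<oplus>\<^bsub>koszul_cochains xs M i\<^esub> u = \<zero>\<^bsub>koszul_cochains xs M i\<^esub>"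
      by (intro bexI[of _ "\<lambda>S\<in>?B. \<ominus>\<^bsub>M\<^esub> u S"])
        (auto simp: koszul_cochains_simps M.l_neg intro!: restrict_ext)
  next
    fix u assume "u \<in> carrier (koszul_cochains xs M i)"
    then have "S \<in> ?B \<Longrightarrow> u S \<in> carrier M" and "S \<notin> ?B \<Longrightarrow> u S = undefined" for S
      unfolding koszul_cochains_simps using PiE_mem PiE_arb by metis+
    then show "\<zero>\<^bsub>koszul_cochains xs M i\<^esub> \<oplus>\<^bsub>koszul_cochains xs M i\<^esub> u = u"
      by (auto simp: koszul_cochains_simps fun_eq_iff restrict_def)
  qed (auto simp: koszul_cochains_simps intro!: restrict_ext M.a_assoc M.a_comm)
qed

lemma koszul_differential_closed_add:
  assumes "module R M" and xs: "set xs \<subseteq> carrier R"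
    and u: "u \<in> carrier (koszul_cochains xs M i)" and v: "v \<in> carrier (koszul_cochains xs M i)"
  shows "koszul_differential R xs M i u \<in> carrier (koszul_cochains xs M (Suc i))"
    and "koszul_differential R xs M i (u \<oplus>\<^bsub>koszul_cochains xs M i\<^esub> v) =
      koszul_differential R xs M i u \<oplus>\<^bsub>koszul_cochains xs M (Suc i)\<^esub> koszul_differential R xs M i v"
proof -
  interpret M: module R M by fact
  let ?c = "\<lambda>j S. (\<ominus>\<^bsub>R\<^esub> \<one>\<^bsub>R\<^esub>) [^]\<^bsub>R\<^esub> card {k\<in>S. k < j} \<otimes>\<^bsub>R\<^esub> xs ! j"
  have c: "?c j S \<in> carrier R" if "S \<in> koszul_basis (length xs) n" "j \<in> S" for j S n
    using that xs nth_mem[of j xs] by (fastforce simp: koszul_basis_def)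
  have sub: "S - {j} \<in> koszul_basis (length xs) i" if "S \<in> koszul_basis (length xs) (Suc i)" "j \<in> S" for j S
    using that by (auto simp: koszul_basis_def)
  have mem: "w (S - {j}) \<in> carrier M"
    if "w \<in> carrier (koszul_cochains xs M i)" "S \<in> koszul_basis (length xs) (Suc i)" "j \<in> S" for w j S
    using that sub[OF that(2,3)] by (auto simp: koszul_cochains_simps)
  show "koszul_differential R xs M i u \<in> carrier (koszul_cochains xs M (Suc i))"
    unfolding koszul_differential_def using c mem[OF u]
    by (auto simp: koszul_cochains_simps intro!: M.M.finsum_closed)
  have "finsum M (\<lambda>j. ?c j S \<odot>\<^bsub>M\<^esub> (u \<oplus>\<^bsub>koszul_cochains xs M i\<^esub> v) (S - {j})) S =
      finsum M (\<lambda>j. ?c j S \<odot>\<^bsub>M\<^esub> u (S - {j})) S \<oplus>\<^bsub>M\<^esub> finsum M (\<lambda>j. ?c j S \<odot>\<^bsub>M\<^esub> v (S - {j})) S"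
    if S: "S \<in> koszul_basis (length xs) (Suc i)" for S
  proof -
    have "finsum M (\<lambda>j. ?c j S \<odot>\<^bsub>M\<^esub> (u \<oplus>\<^bsub>koszul_cochains xs M i\<^esub> v) (S - {j})) S =
        finsum M (\<lambda>j. ?c j S \<odot>\<^bsub>M\<^esub> u (S - {j}) \<oplus>\<^bsub>M\<^esub> ?c j S \<odot>\<^bsub>M\<^esub> v (S - {j})) S"
      by (rule M.M.finsum_cong')
        (use S c mem[OF u S] mem[OF v S] sub[OF S] in \<open>auto simp: M.smult_r_distr koszul_cochains_simps(3)\<close>)
    also have "\<dots> = finsum M (\<lambda>j. ?c j S \<odot>\<^bsub>M\<^esub> u (S - {j})) S \<oplus>\<^bsub>M\<^esub> finsum M (\<lambda>j. ?c j S \<odot>\<^bsub>M\<^esub> v (S - {j})) S"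
      by (rule M.M.finsum_addf) (use S c mem[OF u S] mem[OF v S] in auto)
    finally show ?thesis .
  qed
  then show "koszul_differential R xs M i (u \<oplus>\<^bsub>koszul_cochains xs M i\<^esub> v) =
      koszul_differential R xs M i u \<oplus>\<^bsub>koszul_cochains xs M (Suc i)\<^esub> koszul_differential R xs M i v"
    unfolding koszul_differential_def koszul_cochains_simps(3)[where i = "Suc i"]
    by (intro restrict_ext) simp
qed

lemma zero_koszul_cohomology_iff:
  assumes "module R M" and "set xs \<subseteq> carrier R"
  shows "zero_module (koszul_cohomology R xs M (Suc i)) \<longleftrightarrow>
    (\<forall>u\<in>carrier (koszul_cochains xs M (Suc i)).
       koszul_differential R xs M (Suc i) u = \<zero>\<^bsub>koszul_cochains xs M (Suc (Suc i))\<^esub> \<longrightarrow>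
       (\<exists>v\<in>carrier (koszul_cochains xs M i). u = koszul_differential R xs M i v))"
proof -
  let ?C = "koszul_cochains xs M" and ?d = "koszul_differential R xs M"
  interpret M: module R M by fact
  have grp: "abelian_group (?C j)" for j by (rule koszul_cochains_group) (rule M.M.abelian_group_axioms)
  note d = koszul_differential_closed_add[OF assms]
  interpret A: abelian_group "?C (Suc i)" by (rule grp)
  interpret B: abelian_group "?C (Suc (Suc i))" by (rule grp)
  have "?d (Suc i) \<zero>\<^bsub>?C (Suc i)\<^esub> \<oplus>\<^bsub>?C (Suc (Suc i))\<^esub> ?d (Suc i) \<zero>\<^bsub>?C (Suc i)\<^esub> = ?d (Suc i) \<zero>\<^bsub>?C (Suc i)\<^esub>"
    using d(2)[of "\<zero>\<^bsub>?C (Suc i)\<^esub>" "Suc i" "\<zero>\<^bsub>?C (Suc i)\<^esub>"] by simp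
  then have "?d (Suc i) \<zero>\<^bsub>?C (Suc i)\<^esub> = \<zero>\<^bsub>?C (Suc (Suc i))\<^esub>"
    using d(1)[of "\<zero>\<^bsub>?C (Suc i)\<^esub>" "Suc i"] A.zero_closed B.add.r_cancel_one' by metis
  then have "cocycles ?C ?d (Suc i) \<noteq> {}" by (auto simp: cocycles_def)
  moreover have "subgroup (coboundaries ?C ?d (Suc i)) (add_monoid (?C (Suc i)))"
    unfolding coboundaries_def by (simp, rule subgroup_image[OF grp grp]) (use d in auto)
  ultimately show ?thesis
    unfolding koszul_cohomology_def by (subst zero_cohomology_iff[OF grp])
      (auto simp: cocycles_def coboundaries_def)
qed

text \<open>The last differential of the Koszul complex on three elements, where \<open>a\<close>,
  \<open>b\<close>, \<open>c\<close> are the coefficients at \<open>{1,2}\<close>,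
  \<open>{0,2}\<close>, \<open>{0,1}\<close>. The bracketing is the one that nested
  \<open>cone_diff\<close> produces.\<close>

abbreviation three_combination :: "'a \<Rightarrow> 'a \<Rightarrow> 'a \<Rightarrow> ('a, 'b) module \<Rightarrow> 'b \<Rightarrow> 'b \<Rightarrow> 'b \<Rightarrow> 'b" where
  "three_combination f g h M a b c \<equiv> f \<odot>\<^bsub>M\<^esub> a \<ominus>\<^bsub>M\<^esub> (g \<odot>\<^bsub>M\<^esub> b \<ominus>\<^bsub>M\<^esub> h \<odot>\<^bsub>M\<^esub> c)"

text \<open>The image of the preceding Koszul differential: \<open>p\<close>, \<open>q\<close>,
  \<open>r\<close> are the coefficients at \<open>{2}\<close>, \<open>{1}\<close>,
  \<open>{0}\<close>.\<close>

abbreviation trivial_syzygy :: "'a \<Rightarrow> 'a \<Rightarrow> 'a \<Rightarrow> ('a, 'b) module \<Rightarrow> 'b \<Rightarrow> 'b \<Rightarrow> 'b \<Rightarrow> bool" where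
  "trivial_syzygy f g h M a b c \<equiv> \<exists>p\<in>carrier M. \<exists>q\<in>carrier M. \<exists>r\<in>carrier M.
     a = g \<odot>\<^bsub>M\<^esub> p \<ominus>\<^bsub>M\<^esub> h \<odot>\<^bsub>M\<^esub> q \<and> b = f \<odot>\<^bsub>M\<^esub> p \<ominus>\<^bsub>M\<^esub> h \<odot>\<^bsub>M\<^esub> r \<and> c = f \<odot>\<^bsub>M\<^esub> q \<ominus>\<^bsub>M\<^esub> g \<odot>\<^bsub>M\<^esub> r"

abbreviation three_generate :: "'a \<Rightarrow> 'a \<Rightarrow> 'a \<Rightarrow> ('a, 'b) module \<Rightarrow> bool" where
  "three_generate f g h M \<equiv> \<forall>m\<in>carrier M. \<exists>a\<in>carrier M. \<exists>b\<in>carrier M. \<exists>c\<in>carrier M.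
     m = three_combination f g h M a b c"

abbreviation only_trivial_syzygies :: "'a \<Rightarrow> 'a \<Rightarrow> 'a \<Rightarrow> ('a, 'b) module \<Rightarrow> bool" where
  "only_trivial_syzygies f g h M \<equiv> \<forall>a\<in>carrier M. \<forall>b\<in>carrier M. \<forall>c\<in>carrier M.
     three_combination f g h M a b c = \<zero>\<^bsub>M\<^esub> \<longrightarrow> trivial_syzygy f g h M a b c"

text \<open>Vanishing of Koszul cohomology in degrees three and two, in a form that mentions neither
  functions on subsets nor trees. Both versions of the Koszul complex are compared with it.\<close>

definition syzygy_conditions :: "'a \<Rightarrow> 'a \<Rightarrow> 'a \<Rightarrow> ('a, 'b) module \<Rightarrow> bool" where
  "syzygy_conditions f g h M \<longleftrightarrow> three_generate f g h M \<and> only_trivial_syzygies f g h M"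

lemma koszul_basis_three:
  "koszul_basis 3 (Suc 0) = {{0}, {1}, {2}}"
  "koszul_basis 3 (Suc (Suc 0)) = {{0,1}, {0,2}, {1,2}}"
  "koszul_basis 3 (Suc (Suc (Suc 0))) = {{0,1,2}}"
  "4 \<le> i \<Longrightarrow> koszul_basis 3 i = {}"
proof -
  have three: "{..<3::nat} = {0,1,2}" by auto
  have all: "Pow {..<3::nat} = {{}, {0}, {1}, {2}, {0,1}, {0,2}, {1,2}, {0,1,2}}"
    unfolding three by (simp add: Pow_insert) auto
  have eq: "koszul_basis 3 i = {S \<in> Pow {..<3}. card S = i}" for i
    by (auto simp: koszul_basis_def)
  show "koszul_basis 3 (Suc 0) = {{0}, {1}, {2}}"
    "koszul_basis 3 (Suc (Suc 0)) = {{0,1}, {0,2}, {1,2}}"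
    "koszul_basis 3 (Suc (Suc (Suc 0))) = {{0,1,2}}"
    unfolding eq all by auto
  show "koszul_basis 3 i = {}" if "4 \<le> i"
    using that unfolding eq all by auto
qed

lemma koszul_cohomology_three_iff:
  assumes "module R M" and fgh: "f \<in> carrier R" "g \<in> carrier R" "h \<in> carrier R"
  shows "(\<forall>i\<ge>2. zero_module (koszul_cohomology R [f, g, h] M i)) \<longleftrightarrow> syzygy_conditions f g h M"
proof -
  interpret M: module R M by fact
  let ?xs = "[f, g, h]"
  let ?C = "koszul_cochains ?xs M" and ?d = "koszul_differential R ?xs M"
  have len: "length ?xs = 3" by simp
  have xs: "set ?xs \<subseteq> carrier R" using fgh by simp
  have carr: "carrier (?C i) = koszul_basis 3 i \<rightarrow>\<^sub>E carrier M" for i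
    unfolding koszul_cochains_simps len ..
  \<comment> \<open>Above degree three the basis is empty and the only cochain is the everywhere
    undefined function, which is a coboundary.\<close>
  have high: "zero_module (koszul_cohomology R ?xs M (Suc i))" if "4 \<le> Suc i" for i
  proof -
    have "?d i (\<lambda>S\<in>koszul_basis 3 i. \<zero>\<^bsub>M\<^esub>) = (\<lambda>_. undefined)"
      unfolding koszul_differential_def len koszul_basis_three(4)[OF that] by auto
    moreover have "(\<lambda>S\<in>koszul_basis 3 i. \<zero>\<^bsub>M\<^esub>) \<in> carrier (?C i)" by (auto simp: carr)
    ultimately show ?thesis
      unfolding zero_koszul_cohomology_iff[OF assms(1) xs] carr[of "Suc i"]
        koszul_basis_three(4)[OF that] by (auto intro!: bexI)
  qed
  have "{k\<in>{0,1}. k < (0::nat)} = {}" "{k\<in>{0,1}. k < (1::nat)} = {0}"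
    "{k\<in>{0,2}. k < (0::nat)} = {}" "{k\<in>{0,2}. k < (2::nat)} = {0}"
    "{k\<in>{1,2}. k < (1::nat)} = {}" "{k\<in>{1,2}. k < (2::nat)} = {1}"
    "{k\<in>{0,1,2}. k < (0::nat)} = {}" "{k\<in>{0,1,2}. k < (1::nat)} = {0}"
    "{k\<in>{0,1,2}. k < (2::nat)} = {0,1}" by auto
  note sets = this
  have cards: "card {k\<in>{0,1}. k < (0::nat)} = 0" "card {k\<in>{0,1}. k < (1::nat)} = 1"
    "card {k\<in>{0,2}. k < (0::nat)} = 0" "card {k\<in>{0,2}. k < (2::nat)} = 1"
    "card {k\<in>{1,2}. k < (1::nat)} = 0" "card {k\<in>{1,2}. k < (2::nat)} = 1"
    "card {k\<in>{0,1,2}. k < (0::nat)} = 0" "card {k\<in>{0,1,2}. k < (1::nat)} = 1"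
    "card {k\<in>{0,1,2}. k < (2::nat)} = 2"
    unfolding sets by simp_all
  have diffs: "{0,1} - {0} = {1::nat}" "{0,1} - {1} = {0::nat}" "{0,2} - {0} = {2::nat}"
    "{0,2} - {2} = {0::nat}" "{1,2} - {1} = {2::nat}" "{1,2} - {2} = {1::nat}"
    "{0,1,2} - {0} = {1,2::nat}" "{0,1,2} - {1} = {0,2::nat}" "{0,1,2} - {2} = {0,1::nat}" by auto
  have nth: "?xs ! 0 = f" "?xs ! 1 = g" "?xs ! 2 = h" by auto
  have two: "(\<ominus>\<^bsub>R\<^esub> \<one>\<^bsub>R\<^esub>) [^]\<^bsub>R\<^esub> (2::nat) = \<one>\<^bsub>R\<^esub>"
    by (simp add: numeral_2_eq_2 M.R.l_minus M.R.r_minus)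
  have one: "(\<ominus>\<^bsub>R\<^esub> \<one>\<^bsub>R\<^esub>) [^]\<^bsub>R\<^esub> (1::nat) = \<ominus>\<^bsub>R\<^esub> \<one>\<^bsub>R\<^esub>" by simp
  have basis: "{0,1} \<in> koszul_basis 3 (Suc (Suc 0))" "{0,2} \<in> koszul_basis 3 (Suc (Suc 0))"
    "{1,2} \<in> koszul_basis 3 (Suc (Suc 0))" "{0,1,2} \<in> koszul_basis 3 (Suc (Suc (Suc 0)))"
    by (simp_all only: koszul_basis_three insert_iff simp_thms)
  have neg: "(\<ominus>\<^bsub>R\<^esub> \<one>\<^bsub>R\<^esub> \<otimes>\<^bsub>R\<^esub> x) \<odot>\<^bsub>M\<^esub> m = \<ominus>\<^bsub>M\<^esub> (x \<odot>\<^bsub>M\<^esub> m)" if "x \<in> carrier R" "m \<in> carrier M" for x m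
    using that by (simp add: M.R.l_minus M.smult_l_minus)
  have pos: "(\<one>\<^bsub>R\<^esub> \<otimes>\<^bsub>R\<^esub> x) \<odot>\<^bsub>M\<^esub> m = x \<odot>\<^bsub>M\<^esub> m" if "x \<in> carrier R" "m \<in> carrier M" for x m
    using that by simp
  have zero: "(\<ominus>\<^bsub>R\<^esub> \<one>\<^bsub>R\<^esub>) [^]\<^bsub>R\<^esub> (0::nat) = \<one>\<^bsub>R\<^esub>" by simp
  have sum2: "finsum M F {i, j} = x \<oplus>\<^bsub>M\<^esub> y"
    if "i \<noteq> j" "F i = x" "F j = y" "x \<in> carrier M" "y \<in> carrier M" for F x y and i j :: nat
    using that by simp
  have sum3: "finsum M F {i, j, k} = x \<oplus>\<^bsub>M\<^esub> (y \<oplus>\<^bsub>M\<^esub> z)"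
    if "i \<noteq> j" "i \<noteq> k" "j \<noteq> k" "F i = x" "F j = y" "F k = z"
      "x \<in> carrier M" "y \<in> carrier M" "z \<in> carrier M" for F x y z and i j k :: nat
    using that by simp
  have d1: "?d (Suc 0) v {0,1} = f \<odot>\<^bsub>M\<^esub> v {1} \<ominus>\<^bsub>M\<^esub> g \<odot>\<^bsub>M\<^esub> v {0}"
    "?d (Suc 0) v {0,2} = f \<odot>\<^bsub>M\<^esub> v {2} \<ominus>\<^bsub>M\<^esub> h \<odot>\<^bsub>M\<^esub> v {0}"
    "?d (Suc 0) v {1,2} = g \<odot>\<^bsub>M\<^esub> v {2} \<ominus>\<^bsub>M\<^esub> h \<odot>\<^bsub>M\<^esub> v {1}"
    if v: "v {0} \<in> carrier M" "v {1} \<in> carrier M" "v {2} \<in> carrier M" for v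
    unfolding koszul_differential_def len restrict_apply a_minus_def
    by (simp_all only: basis if_True)
      (rule sum2; simp only: diffs cards nth zero one two pos neg fgh v M.smult_closed M.M.a_inv_closed;
        simp)+
  have d2: "?d (Suc (Suc 0)) u {0,1,2} =
      f \<odot>\<^bsub>M\<^esub> u {1,2} \<ominus>\<^bsub>M\<^esub> (g \<odot>\<^bsub>M\<^esub> u {0,2} \<ominus>\<^bsub>M\<^esub> h \<odot>\<^bsub>M\<^esub> u {0,1})"
    if u: "u {0,1} \<in> carrier M" "u {0,2} \<in> carrier M" "u {1,2} \<in> carrier M" for u
  proof -
    have "?d (Suc (Suc 0)) u {0,1,2} = f \<odot>\<^bsub>M\<^esub> u {1,2} \<oplus>\<^bsub>M\<^esub>
        (\<ominus>\<^bsub>M\<^esub> (g \<odot>\<^bsub>M\<^esub> u {0,2}) \<oplus>\<^bsub>M\<^esub> h \<odot>\<^bsub>M\<^esub> u {0,1})"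
      unfolding koszul_differential_def len restrict_apply
      by (simp only: basis if_True)
        (rule sum3; simp only: diffs cards nth zero one two pos neg fgh u M.smult_closed M.M.a_inv_closed;
          simp)
    then show ?thesis using u fgh by (simp add: a_minus_def M.M.minus_add M.M.a_comm)
  qed
  have low: "zero_module (koszul_cohomology R ?xs M (Suc (Suc 0))) \<and>
      zero_module (koszul_cohomology R ?xs M (Suc (Suc (Suc 0)))) \<longleftrightarrow> syzygy_conditions f g h M"
  proof -
    have top: "koszul_basis 3 (Suc (Suc (Suc (Suc 0)))) = {}" by (rule koszul_basis_three(4)) simp
    have ext3: "u = w \<longleftrightarrow> u {0,1,2} = w {0,1,2}"
      if "u \<in> carrier (?C (Suc (Suc (Suc 0))))" "w \<in> carrier (?C (Suc (Suc (Suc 0))))" for u w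
      using that unfolding carr koszul_basis_three by (auto intro: PiE_ext)
    have ext2: "u = w \<longleftrightarrow> u {0,1} = w {0,1} \<and> u {0,2} = w {0,2} \<and> u {1,2} = w {1,2}"
      if "u \<in> carrier (?C (Suc (Suc 0)))" "w \<in> carrier (?C (Suc (Suc 0)))" for u w
      using that unfolding carr koszul_basis_three by (auto intro: PiE_ext)
    have mem2: "u {0,1} \<in> carrier M" "u {0,2} \<in> carrier M" "u {1,2} \<in> carrier M"
      if "u \<in> carrier (?C (Suc (Suc 0)))" for u
      using that unfolding carr koszul_basis_three by auto
    have mem1: "u {0} \<in> carrier M" "u {1} \<in> carrier M" "u {2} \<in> carrier M"
      if "u \<in> carrier (?C (Suc 0))" for u
      using that unfolding carr koszul_basis_three by auto
    let ?u2 = "\<lambda>a b c. \<lambda>S\<in>koszul_basis 3 (Suc (Suc 0)). if S = {1,2} then a else if S = {0,2} then b else c"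
    let ?u1 = "\<lambda>p q r. \<lambda>S\<in>koszul_basis 3 (Suc 0). if S = {2} then p else if S = {1} then q else r"
    have restrict_closed: "(\<lambda>S\<in>B. F S) \<in> B \<rightarrow>\<^sub>E carrier M" if "\<And>S. F S \<in> carrier M"
      for B and F :: "nat set \<Rightarrow> _"
      using that by (simp add: PiE_def)
    have "2 \<notin> {0,1::nat}" "1 \<notin> {0,2::nat}" by simp_all
    then have ne: "{0,2} \<noteq> {1,2::nat}" "{0,1} \<noteq> {1,2::nat}" "{0,1} \<noteq> {0,2::nat}" by blast+
    have u2: "?u2 a b c \<in> carrier (?C (Suc (Suc 0)))" "?u2 a b c {1,2} = a" "?u2 a b c {0,2} = b" "?u2 a b c {0,1} = c"
      if "a \<in> carrier M" "b \<in> carrier M" "c \<in> carrier M" for a b c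
    proof -
      show "?u2 a b c \<in> carrier (?C (Suc (Suc 0)))"
        unfolding carr by (rule restrict_closed) (simp add: that split: if_split)
      show "?u2 a b c {1,2} = a" "?u2 a b c {0,2} = b" "?u2 a b c {0,1} = c"
        by (simp_all only: basis restrict_apply if_True if_False ne simp_thms)
    qed
    have basis1: "{0} \<in> koszul_basis 3 (Suc 0)" "{1} \<in> koszul_basis 3 (Suc 0)" "{2} \<in> koszul_basis 3 (Suc 0)"
      by (simp_all only: koszul_basis_three insert_iff simp_thms)
    have u1: "?u1 p q r \<in> carrier (?C (Suc 0))" "?u1 p q r {2} = p" "?u1 p q r {1} = q" "?u1 p q r {0} = r"
      if "p \<in> carrier M" "q \<in> carrier M" "r \<in> carrier M" for p q r
    proof -
      show "?u1 p q r \<in> carrier (?C (Suc 0))"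
        unfolding carr by (rule restrict_closed) (simp add: that split: if_split)
      have ne1: "{1} \<noteq> {2::nat}" "{0} \<noteq> {2::nat}" "{0} \<noteq> {1::nat}" by auto
      show "?u1 p q r {2} = p" "?u1 p q r {1} = q" "?u1 p q r {0} = r"
        by (simp_all only: basis1 restrict_apply if_True if_False ne1 simp_thms)
    qed
    have u3: "(\<lambda>S\<in>koszul_basis 3 (Suc (Suc (Suc 0))). m) \<in> carrier (?C (Suc (Suc (Suc 0))))"
      "(\<lambda>S\<in>koszul_basis 3 (Suc (Suc (Suc 0))). m) {0,1,2} = m" if "m \<in> carrier M" for m
    proof -
      show "(\<lambda>S\<in>koszul_basis 3 (Suc (Suc (Suc 0))). m) \<in> carrier (?C (Suc (Suc (Suc 0))))"
        unfolding carr by (rule restrict_closed) (rule that)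
      show "(\<lambda>S\<in>koszul_basis 3 (Suc (Suc (Suc 0))). m) {0,1,2} = m"
        by (simp only: basis restrict_apply if_True)
    qed
    have mem3: "u {0,1,2} \<in> carrier M" if "u \<in> carrier (?C (Suc (Suc (Suc 0))))" for u
      using that unfolding carr koszul_basis_three by auto
    have dcl: "?d i u \<in> carrier (?C (Suc i))" if "u \<in> carrier (?C i)" for u i
      by (rule koszul_differential_closed_add(1)[OF assms(1) xs that that])
    have zero3: "\<zero>\<^bsub>?C (Suc (Suc (Suc 0)))\<^esub> {0,1,2} = \<zero>\<^bsub>M\<^esub>"
      unfolding koszul_cochains_simps len using basis by simp
    interpret C3: abelian_group "?C (Suc (Suc (Suc 0)))"
      by (rule koszul_cochains_group[OF M.M.abelian_group_axioms])
    have H2: "zero_module (koszul_cohomology R ?xs M (Suc (Suc 0))) \<longleftrightarrow>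
        only_trivial_syzygies f g h M"
      (is "_ \<longleftrightarrow> ?P")
      unfolding zero_koszul_cohomology_iff[OF assms(1) xs]
    proof (intro iffI ballI impI)
      fix a b c
      assume hyp: "\<forall>u\<in>carrier (?C (Suc (Suc 0))). ?d (Suc (Suc 0)) u = \<zero>\<^bsub>?C (Suc (Suc (Suc 0)))\<^esub> \<longrightarrow>
          (\<exists>v\<in>carrier (?C (Suc 0)). u = ?d (Suc 0) v)"
        and abc: "a \<in> carrier M" "b \<in> carrier M" "c \<in> carrier M"
        and eq: "three_combination f g h M a b c = \<zero>\<^bsub>M\<^esub>"
      note u = u2[OF abc]
      have "?d (Suc (Suc 0)) (?u2 a b c) = \<zero>\<^bsub>?C (Suc (Suc (Suc 0)))\<^esub>"
        by (rule iffD2[OF ext3[OF dcl[OF u(1)] C3.zero_closed]])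
          (simp only: d2[OF mem2[OF u(1)]] zero3 u eq)
      then obtain v where v: "v \<in> carrier (?C (Suc 0))" "?u2 a b c = ?d (Suc 0) v"
        using hyp u(1) by blast
      then have "a = ?d (Suc 0) v {1,2}" "b = ?d (Suc 0) v {0,2}" "c = ?d (Suc 0) v {0,1}"
        using u(2-4) by metis+
      then show "trivial_syzygy f g h M a b c"
        unfolding d1[OF mem1[OF v(1)]] using mem1[OF v(1)] by blast
    next
      fix u
      assume P: ?P and u: "u \<in> carrier (?C (Suc (Suc 0)))"
        and "?d (Suc (Suc 0)) u = \<zero>\<^bsub>?C (Suc (Suc (Suc 0)))\<^esub>"
      then have "?d (Suc (Suc 0)) u {0,1,2} = \<zero>\<^bsub>M\<^esub>" using zero3 by metis
      from P[rule_format, OF mem2(3,2,1)[OF u] this[unfolded d2[OF mem2[OF u]]]] obtain p q r where pqr: "p \<in> carrier M" "q \<in> carrier M" "r \<in> carrier M"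
        and eq: "u {1,2} = g \<odot>\<^bsub>M\<^esub> p \<ominus>\<^bsub>M\<^esub> h \<odot>\<^bsub>M\<^esub> q" "u {0,2} = f \<odot>\<^bsub>M\<^esub> p \<ominus>\<^bsub>M\<^esub> h \<odot>\<^bsub>M\<^esub> r"
          "u {0,1} = f \<odot>\<^bsub>M\<^esub> q \<ominus>\<^bsub>M\<^esub> g \<odot>\<^bsub>M\<^esub> r"
        by blast
      note v = u1[OF pqr]
      have "u = ?d (Suc 0) (?u1 p q r)"
        by (rule iffD2[OF ext2[OF u dcl[OF v(1)]]]) (simp only: d1[OF mem1[OF v(1)]] v eq simp_thms)
      then show "\<exists>v\<in>carrier (?C (Suc 0)). u = ?d (Suc 0) v" using v(1) by blast
    qed
    have H3: "zero_module (koszul_cohomology R ?xs M (Suc (Suc (Suc 0)))) \<longleftrightarrow>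
        three_generate f g h M" (is "_ \<longleftrightarrow> ?Q")
      unfolding zero_koszul_cohomology_iff[OF assms(1) xs]
    proof (intro iffI ballI impI)
      fix m
      assume hyp: "\<forall>u\<in>carrier (?C (Suc (Suc (Suc 0)))).
          ?d (Suc (Suc (Suc 0))) u = \<zero>\<^bsub>?C (Suc (Suc (Suc (Suc 0))))\<^esub> \<longrightarrow>
          (\<exists>v\<in>carrier (?C (Suc (Suc 0))). u = ?d (Suc (Suc 0)) v)"
        and m: "m \<in> carrier M"
      note u = u3[OF m]
      \<comment> \<open>Degree four has no basis elements, so every cochain of degree three is a
        cocycle.\<close>
      have "?d (Suc (Suc (Suc 0))) w = \<zero>\<^bsub>?C (Suc (Suc (Suc (Suc 0))))\<^esub>" for w
        unfolding koszul_differential_def koszul_cochains_simps len top by (simp add: restrict_def)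
      then obtain v where v: "v \<in> carrier (?C (Suc (Suc 0)))"
        "(\<lambda>S\<in>koszul_basis 3 (Suc (Suc (Suc 0))). m) = ?d (Suc (Suc 0)) v"
        using hyp u(1) by blast
      then have "m = ?d (Suc (Suc 0)) v {0,1,2}" using u(2) by metis
      then show "\<exists>a\<in>carrier M. \<exists>b\<in>carrier M. \<exists>c\<in>carrier M.
          m = three_combination f g h M a b c"
        unfolding d2[OF mem2[OF v(1)]] using mem2[OF v(1)] by blast
    next
      fix u
      assume Q: ?Q and u: "u \<in> carrier (?C (Suc (Suc (Suc 0))))"
      obtain a b c where abc: "a \<in> carrier M" "b \<in> carrier M" "c \<in> carrier M"
        and eq: "u {0,1,2} = three_combination f g h M a b c"
        using Q[rule_format, OF mem3[OF u]] by blast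
      note v = u2[OF abc]
      have "u = ?d (Suc (Suc 0)) (?u2 a b c)"
        by (rule iffD2[OF ext3[OF u dcl[OF v(1)]]]) (simp only: d2[OF mem2[OF v(1)]] v eq)
      then show "\<exists>v\<in>carrier (?C (Suc (Suc 0))). u = ?d (Suc (Suc 0)) v" using v(1) by blast
    qed
    show ?thesis unfolding H2 H3 syzygy_conditions_def by blast
  qed
  show ?thesis
  proof
    assume "\<forall>i\<ge>2. zero_module (koszul_cohomology R ?xs M i)"
    then show "syzygy_conditions f g h M" unfolding low[symmetric] by simp
  next
    assume s: "syzygy_conditions f g h M"
    show "\<forall>i\<ge>2. zero_module (koszul_cohomology R ?xs M i)"
    proof (intro allI impI)
      fix i :: nat assume "2 \<le> i"
      then consider "i = Suc (Suc 0)" | "i = Suc (Suc (Suc 0))" | "4 \<le> i" by linarith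
      then show "zero_module (koszul_cohomology R ?xs M i)"
      proof cases
        case 3
        then obtain j where "i = Suc j" by (cases i) auto
        with high[of j] 3 show ?thesis by simp
      qed (use s low in auto)
    qed
  qed
qed

section \<open>Complexes concentrated in a single degree\<close>

definition zero_submodule :: "('a, 'b) module \<Rightarrow> ('a, 'b) module" where
  "zero_submodule M = M\<lparr>carrier := {\<zero>\<^bsub>M\<^esub>}\<rparr>"

lemma zero_submodule_simps [simp]:
  "carrier (zero_submodule M) = {\<zero>\<^bsub>M\<^esub>}" "\<zero>\<^bsub>zero_submodule M\<^esub> = \<zero>\<^bsub>M\<^esub>"
  "x \<oplus>\<^bsub>zero_submodule M\<^esub> y = x \<oplus>\<^bsub>M\<^esub> y" "a \<odot>\<^bsub>zero_submodule M\<^esub> x = a \<odot>\<^bsub>M\<^esub> x"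
  by (simp_all add: zero_submodule_def)

lemma zero_submodule_module:
  assumes "module R M"
  shows "module R (zero_submodule M)"
proof -
  interpret M: module R M by fact
  show ?thesis
    unfolding zero_submodule_def by (rule M.submodule_module, rule M.submoduleI) auto
qed

definition stalk :: "nat \<Rightarrow> ('a, 'b) module \<Rightarrow> nat \<Rightarrow> ('a, 'b) module" where
  "stalk n M i = (if i = n then M else zero_submodule M)"

lemma stalk_simps [simp]:
  "\<zero>\<^bsub>stalk n M i\<^esub> = \<zero>\<^bsub>M\<^esub>" "x \<oplus>\<^bsub>stalk n M i\<^esub> y = x \<oplus>\<^bsub>M\<^esub> y" "a \<odot>\<^bsub>stalk n M i\<^esub> x = a \<odot>\<^bsub>M\<^esub> x"
  "carrier (stalk n M i) = (if i = n then carrier M else {\<zero>\<^bsub>M\<^esub>})"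
  by (simp_all add: stalk_def)

lemma stalk_complex:
  assumes "module R M"
  shows "cochain_complex R (stalk n M) (\<lambda>_ _. \<zero>\<^bsub>M\<^esub>)"
proof -
  interpret M: module R M by fact
  show ?thesis
    by (rule cochain_complex.intro)
      (auto simp: mod_hom_def stalk_def assms zero_submodule_module)
qed

lemma leaf_module_minus:
  assumes "module R M" and "x \<in> carrier M" "y \<in> carrier M"
  shows "Leaf x \<ominus>\<^bsub>leaf_module M\<^esub> Leaf y = Leaf (x \<ominus>\<^bsub>M\<^esub> y)"
proof -
  interpret M: module R M by fact
  interpret L: module R "leaf_module M" by (rule leaf_module_module) fact
  have "\<ominus>\<^bsub>leaf_module M\<^esub> Leaf y = Leaf (\<ominus>\<^bsub>M\<^esub> y)"
    by (rule L.minus_equality) (simp_all add: assms M.l_neg)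
  then show ?thesis by (simp add: a_minus_def)
qed

lemma cone_minus:
  assumes "cochain_complex R C d"
    and "x \<in> carrier (C (Suc i))" "x' \<in> carrier (C (Suc i))" "y \<in> carrier (C i)" "y' \<in> carrier (C i)"
  shows "Node x y \<ominus>\<^bsub>cone C i\<^esub> Node x' y' = Node (x \<ominus>\<^bsub>C (Suc i)\<^esub> x') (y \<ominus>\<^bsub>C i\<^esub> y')"
proof -
  interpret C: cochain_complex R C d by fact
  show ?thesis unfolding cone_def
    by (rule pair_module_minus) (use assms C.module_C in auto)
qed

text \<open>The bound five is that of a Koszul complex over a stalk at index four. Only indices
  three and four carry a condition, and at index four every element is a cocycle.\<close>

lemma exact_from_three_bounded:
  assumes "cochain_complex R C d" and high: "\<And>i. 5 \<le> i \<Longrightarrow> carrier (C i) = {\<zero>\<^bsub>C i\<^esub>}"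
  shows "exact_from_three C d \<longleftrightarrow>
    (\<forall>x\<in>carrier (C 3). d 3 x = \<zero>\<^bsub>C 4\<^esub> \<longrightarrow> x \<in> d 2 ` carrier (C 2)) \<and>
    (\<forall>x\<in>carrier (C 4). x \<in> d 3 ` carrier (C 3))"
proof -
  interpret C: cochain_complex R C d by fact
  define E where "E i \<longleftrightarrow> (\<forall>x\<in>carrier (C (Suc i)). d (Suc i) x = \<zero>\<^bsub>C (Suc (Suc i))\<^esub> \<longrightarrow> x \<in> d i ` carrier (C i))" for i
  have top: "d 4 x = \<zero>\<^bsub>C 5\<^esub>" if "x \<in> carrier (C 4)" for x
    using C.d_closed[OF that] high[of 5] by simp
  have E: "exact_from_three C d \<longleftrightarrow> (\<forall>i\<ge>2. E i)" unfolding exact_from_three_def E_def ..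
  have E2: "E 2 \<longleftrightarrow> (\<forall>x\<in>carrier (C 3). d 3 x = \<zero>\<^bsub>C 4\<^esub> \<longrightarrow> x \<in> d 2 ` carrier (C 2))"
    by (simp add: E_def)
  have E3: "E 3 \<longleftrightarrow> (\<forall>x\<in>carrier (C 4). x \<in> d 3 ` carrier (C 3))"
    by (simp add: E_def top)
  have E4: "E i" if "4 \<le> i" for i
    unfolding E_def
  proof (intro ballI impI)
    fix x assume "x \<in> carrier (C (Suc i))"
    then have "x = d i \<zero>\<^bsub>C i\<^esub>" using high[of "Suc i"] that by simp
    then show "x \<in> d i ` carrier (C i)" by blast
  qed
  have "i = 2 \<or> i = 3 \<or> 4 \<le> i" if "2 \<le> i" for i :: nat using that by linarith
  then show ?thesis unfolding E E2[symmetric] E3[symmetric] using E4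
    by (metis order_refl numeral_le_iff semiring_norm(69,72))
qed

text \<open>Three cones over a stalk at index four put Koszul degree \<open>p\<close> at index
  \<open>p + 1\<close>, so exactness from index three on is the vanishing in degrees two and
  three.\<close>

lemma exact_koszul_stalk_iff:
  assumes "module R M" and fgh: "f \<in> carrier R" "g \<in> carrier R" "h \<in> carrier R"
  shows "exact_from_three (koszul [f, g, h] (leaves (stalk 4 M)))
      (koszul_diff [f, g, h] (leaves (stalk 4 M)) (leaf_diff (\<lambda>_ _. \<zero>\<^bsub>M\<^esub>))) \<longleftrightarrow> syzygy_conditions f g h M"
proof -
  interpret M: module R M by fact
  let ?X = "leaves (stalk 4 M)" and ?d = "leaf_diff (\<lambda>_ _. \<zero>\<^bsub>M\<^esub>)"
  let ?Z = "koszul [h] ?X" and ?dZ = "koszul_diff [h] ?X ?d"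
  let ?Y = "koszul [g, h] ?X" and ?dY = "koszul_diff [g, h] ?X ?d"
  let ?K = "koszul [f, g, h] ?X" and ?D = "koszul_diff [f, g, h] ?X ?d"
  have S: "cochain_complex R (stalk 4 M) (\<lambda>_ _. \<zero>\<^bsub>M\<^esub>)" by (rule stalk_complex) fact
  interpret S: cochain_complex R "stalk 4 M" "\<lambda>_ _. \<zero>\<^bsub>M\<^esub>" by (rule S)
  have X: "cochain_complex R ?X ?d" by (rule leaves_complex[OF S])
  have Z: "cochain_complex R ?Z ?dZ" and Y: "cochain_complex R ?Y ?dY"
    by (rule koszul_complex[OF X]; use fgh in simp)+
  have K: "cochain_complex R ?K ?D"
    by (rule koszul_complex[OF X]; use fgh in simp)
  note Xm = leaf_module_minus[OF S.module_C]
  note Zm = cone_minus[OF X] and Ym = cone_minus[OF Z[simplified]]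
  have Sm: "x \<ominus>\<^bsub>stalk 4 M i\<^esub> y = x \<ominus>\<^bsub>M\<^esub> y" if "x \<in> carrier (stalk 4 M i)" "y \<in> carrier (stalk 4 M i)" for x y i
  proof (cases "i = 4")
    case False
    then have "x \<ominus>\<^bsub>stalk 4 M i\<^esub> y \<in> {\<zero>\<^bsub>M\<^esub>}" using that S.C_closed(3)[of x i y] by simp
    then show ?thesis using that False M.M.minus_eq_zero_iff[of "\<zero>\<^bsub>M\<^esub>" "\<zero>\<^bsub>M\<^esub>"] by simp
  qed (simp add: stalk_def)
  let ?z = "Leaf \<zero>\<^bsub>M\<^esub>"
  \<comment> \<open>Each left branch raises the index by one, and only leaves that end up at index
    four can be nonzero. At indices two, three and four these are the paths with two, one and no
    left branches.\<close>
  let ?T2 = "\<lambda>p q r. Node (Node (Node ?z (Leaf p)) (Node (Leaf q) ?z)) (Node (Node (Leaf r) ?z) (Node ?z ?z))"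
  let ?T3 = "\<lambda>a b c. Node (Node (Node ?z ?z) (Node ?z (Leaf a))) (Node (Node ?z (Leaf b)) (Node (Leaf c) ?z))"
  let ?T4 = "\<lambda>m. Node (Node (Node ?z ?z) (Node ?z ?z)) (Node (Node ?z ?z) (Node ?z (Leaf m)))"
  have carr: "carrier (?K 2) = {?T2 p q r |p q r. p \<in> carrier M \<and> q \<in> carrier M \<and> r \<in> carrier M}"
    "carrier (?K 3) = {?T3 a b c |a b c. a \<in> carrier M \<and> b \<in> carrier M \<and> c \<in> carrier M}"
    "carrier (?K 4) = {?T4 m |m. m \<in> carrier M}"
    by (auto elim!: coneE simp: image_iff)
  have zero: "\<zero>\<^bsub>?K i\<^esub> = ?T4 \<zero>\<^bsub>M\<^esub>" for i by simp
  have m0: "x \<ominus>\<^bsub>M\<^esub> \<zero>\<^bsub>M\<^esub> = x" if "x \<in> carrier M" for x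
    using S.C_neutral(3)[of x 4] that by (simp add: stalk_def)
  have D2: "?D 2 (?T2 p q r) = ?T3 (g \<odot>\<^bsub>M\<^esub> p \<ominus>\<^bsub>M\<^esub> h \<odot>\<^bsub>M\<^esub> q) (f \<odot>\<^bsub>M\<^esub> p \<ominus>\<^bsub>M\<^esub> h \<odot>\<^bsub>M\<^esub> r) (f \<odot>\<^bsub>M\<^esub> q \<ominus>\<^bsub>M\<^esub> g \<odot>\<^bsub>M\<^esub> r)"
    if "p \<in> carrier M" "q \<in> carrier M" "r \<in> carrier M" for p q r
    using that fgh by (simp add: Ym Zm Xm Sm m0)
  have D3: "?D 3 (?T3 a b c) = ?T4 (three_combination f g h M a b c)"
    if "a \<in> carrier M" "b \<in> carrier M" "c \<in> carrier M" for a b c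
    using that fgh by (simp add: Ym Zm Xm Sm m0)
  have high: "carrier (?K i) = {\<zero>\<^bsub>?K i\<^esub>}" if "5 \<le> i" for i
    by (rule koszul_trivial[of 5]) (use that in auto)
  have "exact_from_three ?K ?D \<longleftrightarrow>
      (\<forall>x\<in>carrier (?K 3). ?D 3 x = \<zero>\<^bsub>?K 4\<^esub> \<longrightarrow> x \<in> ?D 2 ` carrier (?K 2)) \<and>
      (\<forall>x\<in>carrier (?K 4). x \<in> ?D 3 ` carrier (?K 3))"
    by (rule exact_from_three_bounded[OF K high])
  also have "\<dots> \<longleftrightarrow> syzygy_conditions f g h M"
  proof -
    define K D where "K = ?K" and "D = ?D"
    note KD = K_def[symmetric] D_def[symmetric]
    note carr' = carr[unfolded KD] and D2' = D2[unfolded KD] and D3' = D3[unfolded KD]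
      and zero' = zero[unfolded KD]
    have A: "(\<forall>x\<in>carrier (K 3). D 3 x = \<zero>\<^bsub>K 4\<^esub> \<longrightarrow> x \<in> D 2 ` carrier (K 2)) \<longleftrightarrow>
        only_trivial_syzygies f g h M"
    proof -
      have all: "(\<forall>x\<in>carrier (K 3). P x) \<longleftrightarrow> (\<forall>a\<in>carrier M. \<forall>b\<in>carrier M. \<forall>c\<in>carrier M. P (?T3 a b c))" for P
        unfolding carr'(2) by blast
      have F1: "D 3 (?T3 a b c) = \<zero>\<^bsub>K 4\<^esub> \<longleftrightarrow> three_combination f g h M a b c = \<zero>\<^bsub>M\<^esub>"
        if "a \<in> carrier M" "b \<in> carrier M" "c \<in> carrier M" for a b c
        using that by (simp add: D3' zero')
      have F2: "?T3 a b c \<in> D 2 ` carrier (K 2) \<longleftrightarrow> trivial_syzygy f g h M a b c"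
        (is "?l \<longleftrightarrow> ?r") for a b c
      proof
        assume ?l
        then obtain p q r where pqr: "p \<in> carrier M" "q \<in> carrier M" "r \<in> carrier M"
          and "?T3 a b c = D 2 (?T2 p q r)" unfolding carr'(1) by blast
        then show ?r unfolding D2'[OF pqr] by blast
      next
        assume ?r
        then obtain p q r where pqr: "p \<in> carrier M" "q \<in> carrier M" "r \<in> carrier M"
          and "a = g \<odot>\<^bsub>M\<^esub> p \<ominus>\<^bsub>M\<^esub> h \<odot>\<^bsub>M\<^esub> q" "b = f \<odot>\<^bsub>M\<^esub> p \<ominus>\<^bsub>M\<^esub> h \<odot>\<^bsub>M\<^esub> r" "c = f \<odot>\<^bsub>M\<^esub> q \<ominus>\<^bsub>M\<^esub> g \<odot>\<^bsub>M\<^esub> r"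
          by blast
        then have "?T3 a b c = D 2 (?T2 p q r)" unfolding D2'[OF pqr] by blast
        then show ?l using pqr unfolding carr'(1) by blast
      qed
      show ?thesis unfolding all F2 by (simp only: F1 cong: ball_cong)
    qed
    have B: "(\<forall>x\<in>carrier (K 4). x \<in> D 3 ` carrier (K 3)) \<longleftrightarrow>
       three_generate f g h M"
    proof -
      have all: "(\<forall>x\<in>carrier (K 4). P x) \<longleftrightarrow> (\<forall>m\<in>carrier M. P (?T4 m))" for P
        unfolding carr'(3) by blast
      have F: "?T4 m \<in> D 3 ` carrier (K 3) \<longleftrightarrow> (\<exists>a\<in>carrier M. \<exists>b\<in>carrier M. \<exists>c\<in>carrier M.
        m = three_combination f g h M a b c)"
        (is "?l \<longleftrightarrow> ?r") for m
      proof
        assume ?l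
        then obtain a b c where abc: "a \<in> carrier M" "b \<in> carrier M" "c \<in> carrier M"
          and "?T4 m = D 3 (?T3 a b c)" unfolding carr'(2) by blast
        then show ?r unfolding D3'[OF abc] by blast
      next
        assume ?r
        then obtain a b c where abc: "a \<in> carrier M" "b \<in> carrier M" "c \<in> carrier M"
          and "m = three_combination f g h M a b c" by blast
        then have "?T4 m = D 3 (?T3 a b c)" unfolding D3'[OF abc] by blast
        then show ?l using abc unfolding carr'(2) by blast
      qed
      show ?thesis unfolding all F ..
    qed
    show ?thesis unfolding KD A B syzygy_conditions_def by blast
  qed
  finally show ?thesis .
qed

section \<open>Torsion and injective modules\<close>

text \<open>Torsion is imposed element by element rather than by powers of an ideal, so that passing
  from \<open>S\<close> to \<open>insert a S\<close> adds exactly one condition; the comparison of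
  Koszul complexes proceeds along such steps.\<close>

definition element_torsion :: "('a, 'z) ring_scheme \<Rightarrow> 'a set \<Rightarrow> ('a, 'b) module \<Rightarrow> ('a, 'b) module" where
  "element_torsion R S M = M\<lparr>carrier :=
     {x \<in> carrier M. \<forall>a\<in>S. \<exists>n::nat. a [^]\<^bsub>R\<^esub> n \<odot>\<^bsub>M\<^esub> x = \<zero>\<^bsub>M\<^esub>}\<rparr>"

lemma element_torsion_simps [simp]:
  "x \<in> carrier (element_torsion R S M) \<longleftrightarrow>
     x \<in> carrier M \<and> (\<forall>a\<in>S. \<exists>n::nat. a [^]\<^bsub>R\<^esub> n \<odot>\<^bsub>M\<^esub> x = \<zero>\<^bsub>M\<^esub>)"
  "\<zero>\<^bsub>element_torsion R S M\<^esub> = \<zero>\<^bsub>M\<^esub>" "x \<oplus>\<^bsub>element_torsion R S M\<^esub> y = x \<oplus>\<^bsub>M\<^esub> y"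
  "a \<odot>\<^bsub>element_torsion R S M\<^esub> x = a \<odot>\<^bsub>M\<^esub> x"
  by (simp_all add: element_torsion_def)

lemma (in module) smult_left_commute:
  "\<lbrakk>a \<in> carrier R; b \<in> carrier R; x \<in> carrier M\<rbrakk> \<Longrightarrow> a \<odot>\<^bsub>M\<^esub> (b \<odot>\<^bsub>M\<^esub> x) = b \<odot>\<^bsub>M\<^esub> (a \<odot>\<^bsub>M\<^esub> x)"
  by (simp add: smult_assoc1[symmetric] R.m_comm)

context
  fixes R (structure) and M :: "('a, 'b) module"
  assumes M: "module R M"
begin

interpretation module R M by (rule M)

lemma annihilator_ideal:
  assumes "x \<in> carrier M"
  shows "ideal {r \<in> carrier R. r \<odot>\<^bsub>M\<^esub> x = \<zero>\<^bsub>M\<^esub>} R"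
proof (rule idealI)
  show "ring R" by (rule R.ring_axioms)
  show "subgroup {r \<in> carrier R. r \<odot>\<^bsub>M\<^esub> x = \<zero>\<^bsub>M\<^esub>} (add_monoid R)"
    by (rule R.add.subgroupI)
      (use assms in \<open>auto simp: smult_l_distr smult_l_minus a_inv_def[symmetric]\<close>)
next
  fix r b assume "r \<in> {r \<in> carrier R. r \<odot>\<^bsub>M\<^esub> x = \<zero>\<^bsub>M\<^esub>}" and b: "b \<in> carrier R"
  then have r: "r \<in> carrier R" "r \<odot>\<^bsub>M\<^esub> x = \<zero>\<^bsub>M\<^esub>" by auto
  then have "(b \<otimes> r) \<odot>\<^bsub>M\<^esub> x = \<zero>\<^bsub>M\<^esub>" using b assms by (simp add: smult_assoc1)
  then show "b \<otimes> r \<in> {r \<in> carrier R. r \<odot>\<^bsub>M\<^esub> x = \<zero>\<^bsub>M\<^esub>}"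
    and "r \<otimes> b \<in> {r \<in> carrier R. r \<odot>\<^bsub>M\<^esub> x = \<zero>\<^bsub>M\<^esub>}"
    using r b by (auto simp: R.m_comm)
qed

lemma pow_smult_mono:
  assumes "a \<in> carrier R" "x \<in> carrier M" "a [^] (n::nat) \<odot>\<^bsub>M\<^esub> x = \<zero>\<^bsub>M\<^esub>" "n \<le> m"
  shows "a [^] m \<odot>\<^bsub>M\<^esub> x = \<zero>\<^bsub>M\<^esub>"
proof -
  have "a [^] m = a [^] (m - n) \<otimes> a [^] n" using assms by (simp add: R.nat_pow_mult)
  then show ?thesis using assms by (simp add: smult_assoc1)
qed

lemma element_torsion_submodule:
  assumes "S \<subseteq> carrier R"
  shows "submodule (carrier (element_torsion R S M)) R M"
proof (rule submoduleI)
  fix x y assume x: "x \<in> carrier (element_torsion R S M)" and y: "y \<in> carrier (element_torsion R S M)"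
  show "x \<oplus>\<^bsub>M\<^esub> y \<in> carrier (element_torsion R S M)"
    unfolding element_torsion_simps
  proof (intro conjI ballI)
    fix a assume a: "a \<in> S"
    then obtain m n where "a [^] (m::nat) \<odot>\<^bsub>M\<^esub> x = \<zero>\<^bsub>M\<^esub>" "a [^] (n::nat) \<odot>\<^bsub>M\<^esub> y = \<zero>\<^bsub>M\<^esub>"
      using x y unfolding element_torsion_simps by blast
    then have "a [^] (m + n) \<odot>\<^bsub>M\<^esub> x = \<zero>\<^bsub>M\<^esub>" "a [^] (m + n) \<odot>\<^bsub>M\<^esub> y = \<zero>\<^bsub>M\<^esub>"
      using pow_smult_mono[of a x m "m + n"] pow_smult_mono[of a y n "m + n"] x y a assms by auto
    then have "a [^] (m + n) \<odot>\<^bsub>M\<^esub> (x \<oplus>\<^bsub>M\<^esub> y) = \<zero>\<^bsub>M\<^esub>"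
      using x y a assms by (auto simp: smult_r_distr)
    then show "\<exists>n::nat. a [^] n \<odot>\<^bsub>M\<^esub> (x \<oplus>\<^bsub>M\<^esub> y) = \<zero>\<^bsub>M\<^esub>" by blast
  qed (use x y in auto)
next
  fix b x assume b: "b \<in> carrier R" and x: "x \<in> carrier (element_torsion R S M)"
  have "a [^] n \<odot>\<^bsub>M\<^esub> (b \<odot>\<^bsub>M\<^esub> x) = b \<odot>\<^bsub>M\<^esub> (a [^] n \<odot>\<^bsub>M\<^esub> x)" if "a \<in> S" for a and n :: nat
    using that assms b x by (auto simp: smult_assoc1[symmetric] R.m_comm subset_iff)
  then show "b \<odot>\<^bsub>M\<^esub> x \<in> carrier (element_torsion R S M)"
    using b x by auto (metis smult_r_null)
next
  fix x assume x: "x \<in> carrier (element_torsion R S M)"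
  have "a [^] n \<odot>\<^bsub>M\<^esub> (\<ominus>\<^bsub>M\<^esub> x) = \<ominus>\<^bsub>M\<^esub> (a [^] n \<odot>\<^bsub>M\<^esub> x)" if "a \<in> S" for a and n :: nat
    using that assms x by (auto simp: smult_r_minus subset_iff)
  note neg = this
  have zz: "\<ominus>\<^bsub>M\<^esub> \<zero>\<^bsub>M\<^esub> = \<zero>\<^bsub>M\<^esub>" by (rule M.minus_equality) simp_all
  show "\<ominus>\<^bsub>M\<^esub> x \<in> carrier (element_torsion R S M)"
    unfolding element_torsion_simps
  proof (intro conjI ballI)
    fix a assume a: "a \<in> S"
    then obtain n where "a [^] (n::nat) \<odot>\<^bsub>M\<^esub> x = \<zero>\<^bsub>M\<^esub>" using x unfolding element_torsion_simps by blast
    then have "a [^] n \<odot>\<^bsub>M\<^esub> (\<ominus>\<^bsub>M\<^esub> x) = \<zero>\<^bsub>M\<^esub>" using neg[OF a, of n] zz by simp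
    then show "\<exists>n::nat. a [^] n \<odot>\<^bsub>M\<^esub> (\<ominus>\<^bsub>M\<^esub> x) = \<zero>\<^bsub>M\<^esub>" by blast
  qed (use x in simp)
qed (use assms in auto)

lemma element_torsion_module:
  assumes "S \<subseteq> carrier R"
  shows "module R (element_torsion R S M)"
  using submodule_module[OF element_torsion_submodule[OF assms]]
  by (simp add: element_torsion_def)

text \<open>Induction on the total exponent: if \<open>a\<close> is one of the generators, then \<open>a x\<close> is killed by
  generators to a smaller total exponent.\<close>

lemma ideal_power_annihilates:
  assumes "finite S" "S \<subseteq> carrier R" "x \<in> carrier M"
    and "\<And>a. a \<in> S \<Longrightarrow> a [^] (n a :: nat) \<odot>\<^bsub>M\<^esub> x = \<zero>\<^bsub>M\<^esub>" and "sum n S \<le> w"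
    and "r \<in> (genideal R S) [^]\<^bsub>ideals_set R\<^esub> (Suc w)"
  shows "r \<odot>\<^bsub>M\<^esub> x = \<zero>\<^bsub>M\<^esub>"
  using assms(3-)
proof (induction w arbitrary: x n r)
  let ?I = "genideal R S"
  interpret Id: comm_monoid "ideals_set R" by (rule R.ideals_set_is_comm_monoid)
  have ideal: "ideal ?I R" using assms(2) by (rule R.genideal_ideal)
  have pow: "ideal (?I [^]\<^bsub>ideals_set R\<^esub> k) R" for k :: nat
    using Id.nat_pow_closed[of ?I k] ideal by (simp add: ideals_set_def)
  have ann: "i \<odot>\<^bsub>M\<^esub> y = \<zero>\<^bsub>M\<^esub>" if "y \<in> carrier M" "\<And>a. a \<in> S \<Longrightarrow> a \<odot>\<^bsub>M\<^esub> y = \<zero>\<^bsub>M\<^esub>" "i \<in> ?I" for y i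
    using R.genideal_minimal[OF annihilator_ideal[OF that(1)], of S] that assms(2) by auto
  {
    case 0
    have "a \<odot>\<^bsub>M\<^esub> x = \<zero>\<^bsub>M\<^esub>" if "a \<in> S" for a
    proof -
      \<comment> \<open>The total exponent is zero, so already the zeroth power of \<open>a\<close>
        kills \<open>x\<close>, that is, \<open>x\<close> is zero.\<close>
      have "n a = 0" using 0(3) assms(1) that by simp
      then have "x = \<zero>\<^bsub>M\<^esub>" using 0(1) 0(2)[OF that] by simp
      then show ?thesis using that assms(2) by auto
    qed
    moreover have "r \<in> ?I"
    proof -
      \<comment> \<open>The zeroth power of an ideal is the whole ring, so the first power unfolds
        to its product with the ring.\<close>
      have "r \<in> ideal_prod R (carrier R) ?I" using 0(4) by (simp add: ideals_set_def nat_pow_def)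
      then show ?thesis using R.ideal_prod_inter[OF R.oneideal ideal] by blast
    qed
    ultimately show ?case using ann 0(1) by blast
  next
    case (Suc w)
    show ?case
    proof (cases "x = \<zero>\<^bsub>M\<^esub>")
      case True
      have "r \<in> carrier R" using ideal.Icarr[OF pow Suc.prems(4)] .
      then show ?thesis using True by simp
    next
      case False
      have step: "q \<odot>\<^bsub>M\<^esub> (a \<odot>\<^bsub>M\<^esub> x) = \<zero>\<^bsub>M\<^esub>"
        if a: "a \<in> S" and q: "q \<in> ?I [^]\<^bsub>ideals_set R\<^esub> (Suc w)" for a q
      proof (rule Suc.IH)
        have aR: "a \<in> carrier R" using a assms(2) by blast
        have na: "n a \<noteq> 0"
        proof
          assume "n a = 0"
          then show False using Suc.prems(2)[OF a] Suc.prems(1) False by simp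
        qed
        let ?n = "n(a := n a - 1)"
        show "a \<odot>\<^bsub>M\<^esub> x \<in> carrier M" using aR Suc.prems(1) by simp
        have "sum n S = n a + sum n (S - {a})" using a assms(1) by (simp add: sum.remove)
        moreover have "sum ?n S = (n a - 1) + sum n (S - {a})" using a assms(1) by (simp add: sum.remove)
        ultimately show "sum ?n S \<le> w" using Suc.prems(3) na by linarith
        show "b [^] ?n b \<odot>\<^bsub>M\<^esub> (a \<odot>\<^bsub>M\<^esub> x) = \<zero>\<^bsub>M\<^esub>" if b: "b \<in> S" for b
        proof (cases "b = a")
          case True
          have "a [^] (n a - 1) \<otimes> a = a [^] n a" using na aR by (cases "n a") auto
          then show ?thesis using True aR Suc.prems(1) Suc.prems(2)[OF a] by (simp add: smult_assoc1[symmetric])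
        next
          case False
          have bR: "b \<in> carrier R" using b assms(2) by blast
          have "b [^] n b \<odot>\<^bsub>M\<^esub> (a \<odot>\<^bsub>M\<^esub> x) = a \<odot>\<^bsub>M\<^esub> (b [^] n b \<odot>\<^bsub>M\<^esub> x)"
            using aR bR Suc.prems(1) by (simp add: smult_assoc1[symmetric] R.m_comm)
          then show ?thesis using False Suc.prems(2)[OF b] aR by simp
        qed
      qed (rule q)
      have "r \<in> ideal_prod R (?I [^]\<^bsub>ideals_set R\<^esub> (Suc w)) ?I"
        using Suc.prems(4) by (simp add: ideals_set_def nat_pow_def)
      then show ?thesis
      proof induction
        case (prod q i)
        have q: "q \<in> carrier R" by (rule ideal.Icarr[OF pow prod(1)])
        have i: "i \<in> carrier R" by (rule ideal.Icarr[OF ideal prod(2)])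
        have "a \<odot>\<^bsub>M\<^esub> (q \<odot>\<^bsub>M\<^esub> x) = \<zero>\<^bsub>M\<^esub>" if a: "a \<in> S" for a
          using step[OF a prod(1)] smult_left_commute[of a q x] a assms(2) q Suc.prems(1) by auto
        moreover have "q \<odot>\<^bsub>M\<^esub> x \<in> carrier M" using q Suc.prems(1) by simp
        ultimately have "i \<odot>\<^bsub>M\<^esub> (q \<odot>\<^bsub>M\<^esub> x) = \<zero>\<^bsub>M\<^esub>" using ann[of "q \<odot>\<^bsub>M\<^esub> x" i] prod(2) by blast
        then show ?case using q i Suc.prems(1) by (simp add: smult_assoc1 smult_left_commute[of q i x])
      next
        case (sum s1 s2)
        have "s1 \<in> carrier R" "s2 \<in> carrier R"
          using sum(1,2) R.ideal_prod_in_carrier[OF pow ideal] by blast+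
        then show ?case using sum Suc.prems(1) by (simp add: smult_l_distr)
      qed
    qed
  }
qed

lemma nat_pow_in_ideal_power:
  assumes "ideal I R" "a \<in> I"
  shows "a [^] n \<in> I [^]\<^bsub>ideals_set R\<^esub> (n::nat)"
proof (induction n)
  case 0
  then show ?case by (simp add: ideals_set_def nat_pow_def)
next
  case (Suc n)
  then show ?case using assms(2)
    by (simp add: ideals_set_def nat_pow_def ideal_prod.prod)
qed

text \<open>Since \<open>S\<close> generates \<open>I\<close> only up to radical, two rounds are
  needed. The exponents on \<open>S\<close> give a power of the ideal of \<open>S\<close> that kills
  \<open>x\<close>, hence some power of every element of \<open>I\<close> kills \<open>x\<close>; a
  finite set \<open>T\<close> that generates \<open>I\<close> itself turns this into a power of
  \<open>I\<close>.\<close>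

lemma torsion_eq_element_torsion:
  assumes "ideal I R" "finite S" "S \<subseteq> I" and rad: "\<And>a. a \<in> I \<Longrightarrow> \<exists>n::nat. a [^] n \<in> genideal R S"
    and fg: "noetherian_ring R"
  shows "torsion R I M = element_torsion R S M"
proof -
  interpret I: ideal I R by fact
  have S: "S \<subseteq> carrier R" using assms(3) I.Icarr by blast
  have "(\<exists>n::nat. \<forall>a \<in> I [^]\<^bsub>ideals_set R\<^esub> n. a \<odot>\<^bsub>M\<^esub> x = \<zero>\<^bsub>M\<^esub>) \<longleftrightarrow>
      (\<forall>a\<in>S. \<exists>n::nat. a [^] n \<odot>\<^bsub>M\<^esub> x = \<zero>\<^bsub>M\<^esub>)" if x: "x \<in> carrier M" for x
  proof
    assume "\<exists>n::nat. \<forall>a \<in> I [^]\<^bsub>ideals_set R\<^esub> n. a \<odot>\<^bsub>M\<^esub> x = \<zero>\<^bsub>M\<^esub>"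
    then show "\<forall>a\<in>S. \<exists>n::nat. a [^] n \<odot>\<^bsub>M\<^esub> x = \<zero>\<^bsub>M\<^esub>"
      using nat_pow_in_ideal_power[OF assms(1)] assms(3) by blast
  next
    have kill: "\<exists>w. \<forall>r\<in>(genideal R T) [^]\<^bsub>ideals_set R\<^esub> (w::nat). r \<odot>\<^bsub>M\<^esub> x = \<zero>\<^bsub>M\<^esub>"
      if "finite T" "T \<subseteq> carrier R" and T: "\<forall>a\<in>T. \<exists>n::nat. a [^] n \<odot>\<^bsub>M\<^esub> x = \<zero>\<^bsub>M\<^esub>" for T
    proof -
      obtain n where "\<And>a. a \<in> T \<Longrightarrow> a [^] (n a :: nat) \<odot>\<^bsub>M\<^esub> x = \<zero>\<^bsub>M\<^esub>" using T by metis
      then show ?thesis using ideal_power_annihilates[OF that(1,2) x _ order_refl] by blast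
    qed
    assume "\<forall>a\<in>S. \<exists>n::nat. a [^] n \<odot>\<^bsub>M\<^esub> x = \<zero>\<^bsub>M\<^esub>"
    then obtain w where w: "\<And>r. r \<in> (genideal R S) [^]\<^bsub>ideals_set R\<^esub> (w::nat) \<Longrightarrow> r \<odot>\<^bsub>M\<^esub> x = \<zero>\<^bsub>M\<^esub>"
      using kill[OF assms(2) S] by blast
    have all: "\<exists>n::nat. a [^] n \<odot>\<^bsub>M\<^esub> x = \<zero>\<^bsub>M\<^esub>" if a: "a \<in> I" for a
    proof -
      obtain k :: nat where "a [^] k \<in> genideal R S" using rad[OF a] by blast
      note k = this
      have "(a [^] k) [^] w \<odot>\<^bsub>M\<^esub> x = \<zero>\<^bsub>M\<^esub>"
        using w nat_pow_in_ideal_power[OF R.genideal_ideal[OF S] k] by blast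
      then show ?thesis using I.Icarr[OF a] by (auto simp: R.nat_pow_pow)
    qed
    obtain T where T: "finite T" "T \<subseteq> carrier R" "I = genideal R T"
      using noetherian_ring.finetely_gen[OF fg assms(1)] by blast
    then have "T \<subseteq> I" using R.genideal_self by blast
    then show "\<exists>n::nat. \<forall>a \<in> I [^]\<^bsub>ideals_set R\<^esub> n. a \<odot>\<^bsub>M\<^esub> x = \<zero>\<^bsub>M\<^esub>"
      using kill[OF T(1,2)] all T(3) by blast
  qed
  then have "{x \<in> carrier M. \<exists>n::nat. \<forall>a \<in> I [^]\<^bsub>ideals_set R\<^esub> n. a \<odot>\<^bsub>M\<^esub> x = \<zero>\<^bsub>M\<^esub>} =
      {x \<in> carrier M. \<forall>a\<in>S. \<exists>n::nat. a [^] n \<odot>\<^bsub>M\<^esub> x = \<zero>\<^bsub>M\<^esub>}" by blast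
  then show ?thesis by (simp add: torsion_def element_torsion_def)
qed

end

section \<open>The ring as a module, and division in injective modules\<close>

lemma self_module_simps [simp]:
  "carrier (self_module R) = carrier R" "\<zero>\<^bsub>self_module R\<^esub> = \<zero>\<^bsub>R\<^esub>"
  "x \<oplus>\<^bsub>self_module R\<^esub> y = x \<oplus>\<^bsub>R\<^esub> y" "a \<odot>\<^bsub>self_module R\<^esub> x = a \<otimes>\<^bsub>R\<^esub> x"
  by (simp_all add: self_module_def)

lemma self_module_module:
  assumes "cring R"
  shows "module R (self_module R)"
proof -
  interpret cring R by fact
  have "abelian_group (self_module R)"
    by (rule abelian_groupI) (auto simp: a_ac intro: bexI[of _ "\<ominus>\<^bsub>R\<^esub> x" for x] l_neg)
  then show ?thesis
    by (rule moduleI[OF assms]) (auto simp: l_distr r_distr m_assoc)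
qed

lemma ideal_submodule:
  assumes "cring R" "ideal I R"
  shows "submodule I R (self_module R)"
proof -
  interpret cring R by fact
  interpret I: ideal I R by fact
  interpret S: module R "self_module R" by (rule self_module_module) fact
  have neg: "\<ominus>\<^bsub>self_module R\<^esub> x = \<ominus>\<^bsub>R\<^esub> x" if "x \<in> carrier R" for x
    by (rule S.minus_equality) (use that in \<open>auto simp: l_neg\<close>)
  show ?thesis
    by (rule S.submoduleI) (auto simp: neg I.Icarr I.I_l_closed)
qed

text \<open>Extending \<open>r a\<^sup>n\<^sup>+\<^sup>1 + k \<mapsto> r a\<^sup>n x\<close>, for \<open>k\<close> annihilating \<open>x\<close>, from an ideal to the ring; the map is
  well-defined once the annihilators of the \<open>a\<^sup>n x\<close> have become stationary.\<close>

lemma injective_module_divide: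
  fixes E :: "('a, 'b) module"
  assumes R: "cring R" "noetherian_ring R" and E: "injective_module R E"
    and x: "x \<in> carrier E" and a: "a \<in> carrier R"
  shows "\<exists>y\<in>carrier E. (\<exists>n::nat. a [^]\<^bsub>R\<^esub> n \<odot>\<^bsub>E\<^esub> (x \<ominus>\<^bsub>E\<^esub> a \<odot>\<^bsub>E\<^esub> y) = \<zero>\<^bsub>E\<^esub>) \<and>
    (\<forall>r\<in>carrier R. r \<odot>\<^bsub>E\<^esub> x = \<zero>\<^bsub>E\<^esub> \<longrightarrow> r \<odot>\<^bsub>E\<^esub> y = \<zero>\<^bsub>E\<^esub>)"
proof -
  interpret R: cring R by fact
  interpret E: module R E using E by (simp add: injective_module_def)
  interpret S: module R "self_module R" by (rule self_module_module) fact
  define A where "A n = {r \<in> carrier R. r \<odot>\<^bsub>E\<^esub> (a [^]\<^bsub>R\<^esub> (n::nat) \<odot>\<^bsub>E\<^esub> x) = \<zero>\<^bsub>E\<^esub>}" for n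
  have A_ideal: "ideal (A n) R" for n
    unfolding A_def by (rule annihilator_ideal[OF E.module_axioms]) (use a x in simp)
  have A_mono: "A m \<subseteq> A n" if "m \<le> n" for m n
  proof
    fix r assume r: "r \<in> A m"
    have "a [^]\<^bsub>R\<^esub> n = a [^]\<^bsub>R\<^esub> (n - m) \<otimes>\<^bsub>R\<^esub> a [^]\<^bsub>R\<^esub> m" using that a by (simp add: R.nat_pow_mult)
    note pow = this
    have "r \<odot>\<^bsub>E\<^esub> (a [^]\<^bsub>R\<^esub> n \<odot>\<^bsub>E\<^esub> x) = a [^]\<^bsub>R\<^esub> (n - m) \<odot>\<^bsub>E\<^esub> (r \<odot>\<^bsub>E\<^esub> (a [^]\<^bsub>R\<^esub> m \<odot>\<^bsub>E\<^esub> x))"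
      unfolding pow using r a x by (simp add: A_def E.smult_assoc1 E.smult_left_commute[of r])
    then show "r \<in> A n" using r a by (simp add: A_def)
  qed
  have "subset.chain {J. ideal J R} (range A)"
    unfolding subset.chain_def
  proof (intro conjI ballI)
    fix U V assume "U \<in> range A" "V \<in> range A"
    then obtain m k where UV: "U = A m" "V = A k" by blast
    have "A m \<subseteq> A k \<or> A k \<subseteq> A m" using A_mono linear[of m k] by blast
    then show "(\<subset>)\<^sup>=\<^sup>= U V \<or> (\<subset>)\<^sup>=\<^sup>= V U" unfolding UV by blast
  qed (use A_ideal in auto)
  then have "\<Union>(range A) \<in> range A"
    using noetherian_ring.ideal_chain_is_trivial[OF R(2), of "range A"] by blast
  \<comment> \<open>With this \<open>n\<close>, whenever \<open>r a^m x = 0\<close> for some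
    \<open>m\<close>, already \<open>r a^n x = 0\<close>. It is also the exponent of the torsion in
    the conclusion.\<close>
  then obtain n where n: "\<And>m. A m \<subseteq> A n" by blast
  define K where "K = {r \<in> carrier R. r \<odot>\<^bsub>E\<^esub> x = \<zero>\<^bsub>E\<^esub>}"
  interpret K: ideal K R unfolding K_def by (rule annihilator_ideal[OF E.module_axioms x])
  \<comment> \<open>\<open>P u r\<close> presents \<open>u\<close> in the ideal generated by
    \<open>a^(n+1)\<close> and \<open>K\<close>. The annihilator \<open>K\<close> of
    \<open>x\<close> is included so that the extended map sends it to zero, which makes
    \<open>y\<close> inherit the annihilators of \<open>x\<close>.\<close>
  define P where "P u r \<longleftrightarrow> r \<in> carrier R \<and> (\<exists>k\<in>K. u = r \<otimes>\<^bsub>R\<^esub> a [^]\<^bsub>R\<^esub> Suc n \<oplus>\<^bsub>R\<^esub> k)" for u r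
  define U where "U = {u. \<exists>r. P u r}"
  define \<phi> where "\<phi> u = (SOME r. P u r) \<odot>\<^bsub>E\<^esub> (a [^]\<^bsub>R\<^esub> n \<odot>\<^bsub>E\<^esub> x)" for u
  have \<phi>_eq: "\<phi> u = r \<odot>\<^bsub>E\<^esub> (a [^]\<^bsub>R\<^esub> n \<odot>\<^bsub>E\<^esub> x)" if p: "P u r" for u r
  proof -
    define s where "s = (SOME r. P u r)"
    have s: "P u s" unfolding s_def by (rule someI[where P = "P u"]) (rule p)
    obtain k k' where k: "k \<in> K" "k' \<in> K" and u: "u = r \<otimes>\<^bsub>R\<^esub> a [^]\<^bsub>R\<^esub> Suc n \<oplus>\<^bsub>R\<^esub> k" "u = s \<otimes>\<^bsub>R\<^esub> a [^]\<^bsub>R\<^esub> Suc n \<oplus>\<^bsub>R\<^esub> k'"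
      and rs: "r \<in> carrier R" "s \<in> carrier R"
      using p s unfolding P_def by blast
    have diff: "(r \<ominus>\<^bsub>R\<^esub> s) \<odot>\<^bsub>E\<^esub> v = r \<odot>\<^bsub>E\<^esub> v \<ominus>\<^bsub>E\<^esub> s \<odot>\<^bsub>E\<^esub> v" if "v \<in> carrier E" for v
      using rs that by (simp add: a_minus_def E.smult_l_distr E.smult_l_minus)
    define p where "p = a [^]\<^bsub>R\<^esub> Suc n"
    have pR: "p \<in> carrier R" using a by (simp add: p_def del: R.nat_pow_Suc)
    have val: "(q \<otimes>\<^bsub>R\<^esub> p \<oplus>\<^bsub>R\<^esub> l) \<odot>\<^bsub>E\<^esub> x = q \<odot>\<^bsub>E\<^esub> (p \<odot>\<^bsub>E\<^esub> x)" if q: "q \<in> carrier R" and l: "l \<in> K" for q l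
    proof -
      have "l \<in> carrier R" "l \<odot>\<^bsub>E\<^esub> x = \<zero>\<^bsub>E\<^esub>" using l unfolding K_def by blast+
      then show ?thesis using q pR x by (simp add: E.smult_l_distr E.smult_assoc1)
    qed
    have "r \<odot>\<^bsub>E\<^esub> (p \<odot>\<^bsub>E\<^esub> x) = s \<odot>\<^bsub>E\<^esub> (p \<odot>\<^bsub>E\<^esub> x)"
      using val[OF rs(1) k(1)] val[OF rs(2) k(2)] u unfolding p_def by metis
    then have "(r \<ominus>\<^bsub>R\<^esub> s) \<odot>\<^bsub>E\<^esub> (p \<odot>\<^bsub>E\<^esub> x) = \<zero>\<^bsub>E\<^esub>"
      using rs pR x by (simp add: diff E.minus_eq_zero_iff)
    then have "r \<ominus>\<^bsub>R\<^esub> s \<in> A (Suc n)" using rs unfolding A_def p_def by blast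
    \<comment> \<open>Two presentations of \<open>u\<close> differ by something that kills
      \<open>a^(n+1) x\<close>; by the choice of \<open>n\<close> it kills \<open>a^n x\<close>
      too.\<close>
    then have "r \<ominus>\<^bsub>R\<^esub> s \<in> A n" using n by blast
    then have "r \<odot>\<^bsub>E\<^esub> (a [^]\<^bsub>R\<^esub> n \<odot>\<^bsub>E\<^esub> x) \<ominus>\<^bsub>E\<^esub> s \<odot>\<^bsub>E\<^esub> (a [^]\<^bsub>R\<^esub> n \<odot>\<^bsub>E\<^esub> x) = \<zero>\<^bsub>E\<^esub>"
      using a x diff[of "a [^]\<^bsub>R\<^esub> n \<odot>\<^bsub>E\<^esub> x"] by (simp add: A_def)
    then show ?thesis
      using rs a x by (simp add: E.minus_eq_zero_iff \<phi>_def s_def[symmetric])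
  qed
  have Padd: "P (u \<oplus>\<^bsub>R\<^esub> v) (r \<oplus>\<^bsub>R\<^esub> s)" if p: "P u r" "P v s" for u v r s
  proof -
    obtain k l where k: "k \<in> K" "l \<in> K" and u: "u = r \<otimes>\<^bsub>R\<^esub> a [^]\<^bsub>R\<^esub> Suc n \<oplus>\<^bsub>R\<^esub> k" "v = s \<otimes>\<^bsub>R\<^esub> a [^]\<^bsub>R\<^esub> Suc n \<oplus>\<^bsub>R\<^esub> l"
      and rs: "r \<in> carrier R" "s \<in> carrier R"
      using p unfolding P_def by blast
    have "u \<oplus>\<^bsub>R\<^esub> v = (r \<oplus>\<^bsub>R\<^esub> s) \<otimes>\<^bsub>R\<^esub> a [^]\<^bsub>R\<^esub> Suc n \<oplus>\<^bsub>R\<^esub> (k \<oplus>\<^bsub>R\<^esub> l)"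
      unfolding u using rs k a K.Icarr by (simp add: R.l_distr R.a_ac del: R.nat_pow_Suc)
    then show ?thesis using rs k unfolding P_def by (intro conjI bexI[of _ "k \<oplus>\<^bsub>R\<^esub> l"]) auto
  qed
  have Psmult: "P (b \<otimes>\<^bsub>R\<^esub> u) (b \<otimes>\<^bsub>R\<^esub> r)" if p: "P u r" and b: "b \<in> carrier R" for b u r
  proof -
    obtain k where k: "k \<in> K" and u: "u = r \<otimes>\<^bsub>R\<^esub> a [^]\<^bsub>R\<^esub> Suc n \<oplus>\<^bsub>R\<^esub> k" and r: "r \<in> carrier R"
      using p unfolding P_def by blast
    have "b \<otimes>\<^bsub>R\<^esub> u = (b \<otimes>\<^bsub>R\<^esub> r) \<otimes>\<^bsub>R\<^esub> a [^]\<^bsub>R\<^esub> Suc n \<oplus>\<^bsub>R\<^esub> (b \<otimes>\<^bsub>R\<^esub> k)"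
      unfolding u using r k a b K.Icarr by (simp add: R.r_distr R.m_assoc del: R.nat_pow_Suc)
    then show ?thesis using r k b K.I_l_closed unfolding P_def
      by (intro conjI bexI[of _ "b \<otimes>\<^bsub>R\<^esub> k"]) auto
  qed
  have Pcarr: "u \<in> carrier R" if "P u r" for u r using that a K.Icarr by (auto simp: P_def)
  have PK: "P k \<zero>\<^bsub>R\<^esub>" if "k \<in> K" for k
    using that K.Icarr a unfolding P_def by (intro conjI bexI[of _ k]) (auto simp del: R.nat_pow_Suc)
  have Pa: "P (a [^]\<^bsub>R\<^esub> Suc n) \<one>\<^bsub>R\<^esub>"
    unfolding P_def using a K.zero_closed by (intro conjI bexI[of _ "\<zero>\<^bsub>R\<^esub>"]) (auto simp del: R.nat_pow_Suc)
  have sub: "submodule U R (self_module R)"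
  proof (rule S.submoduleI)
    fix u assume "u \<in> U"
    then obtain r where "P u r" by (auto simp: U_def)
    then have "P ((\<ominus>\<^bsub>R\<^esub> \<one>\<^bsub>R\<^esub>) \<otimes>\<^bsub>R\<^esub> u) ((\<ominus>\<^bsub>R\<^esub> \<one>\<^bsub>R\<^esub>) \<otimes>\<^bsub>R\<^esub> r)" by (rule Psmult) simp
    moreover have "\<ominus>\<^bsub>self_module R\<^esub> u = (\<ominus>\<^bsub>R\<^esub> \<one>\<^bsub>R\<^esub>) \<otimes>\<^bsub>R\<^esub> u"
      by (rule S.minus_equality) (use Pcarr[OF \<open>P u r\<close>] in \<open>auto simp: R.l_minus R.l_neg\<close>)
    ultimately show "\<ominus>\<^bsub>self_module R\<^esub> u \<in> U" unfolding U_def by auto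
  qed (use Pcarr PK[OF K.zero_closed] in \<open>auto simp: U_def intro: Padd Psmult\<close>)
  have hom: "\<phi> \<in> mod_hom R ((self_module R)\<lparr>carrier := U\<rparr>) E"
    unfolding mod_hom_def
  proof (safe; simp)
    fix u assume "u \<in> U"
    then obtain r where r: "P u r" by (auto simp: U_def)
    then have rR: "r \<in> carrier R" by (simp add: P_def)
    show "\<phi> u \<in> carrier E" using \<phi>_eq[OF r] rR a x by simp
    show "\<phi> (b \<otimes>\<^bsub>R\<^esub> u) = b \<odot>\<^bsub>E\<^esub> \<phi> u" if "b \<in> carrier R" for b
      using \<phi>_eq[OF r] \<phi>_eq[OF Psmult[OF r that]] rR that a x by (simp add: E.smult_assoc1)
    show "\<phi> (u \<oplus>\<^bsub>R\<^esub> v) = \<phi> u \<oplus>\<^bsub>E\<^esub> \<phi> v" if v: "v \<in> U" for v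
    proof -
      obtain s where s: "P v s" using v by (auto simp: U_def)
      then have "s \<in> carrier R" by (simp add: P_def)
      then show ?thesis
        using \<phi>_eq[OF r] \<phi>_eq[OF s] \<phi>_eq[OF Padd[OF r s]] rR a x by (simp add: E.smult_l_distr)
    qed
  qed
  obtain \<psi> where \<psi>: "\<psi> \<in> mod_hom R (self_module R) E" and agree: "\<And>u. u \<in> U \<Longrightarrow> \<psi> u = \<phi> u"
    using E hom sub S.module_axioms unfolding injective_module_def by blast
  \<comment> \<open>A map from the ring is multiplication into its value at one. Its value at
    \<open>a^(n+1)\<close> gives \<open>a^(n+1) y = a^n x\<close>, and its values on
    \<open>K\<close> give the annihilators.\<close>
  define y where "y = \<psi> \<one>\<^bsub>R\<^esub>"
  have y: "y \<in> carrier E" using mod_homD(1)[OF \<psi>] by (simp add: y_def)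
  have \<psi>_eq: "\<psi> u = u \<odot>\<^bsub>E\<^esub> y" if "u \<in> carrier R" for u
    using mod_homD(3)[OF \<psi>, of u "\<one>\<^bsub>R\<^esub>"] that by (simp add: y_def)
  have "r \<odot>\<^bsub>E\<^esub> y = \<zero>\<^bsub>E\<^esub>" if "r \<in> carrier R" "r \<odot>\<^bsub>E\<^esub> x = \<zero>\<^bsub>E\<^esub>" for r
  proof -
    have "r \<in> K" unfolding K_def using that by blast
    then have P: "P r \<zero>\<^bsub>R\<^esub>" by (rule PK)
    have "r \<odot>\<^bsub>E\<^esub> y = \<psi> r" by (rule \<psi>_eq[OF that(1), symmetric])
    also have "\<dots> = \<phi> r" using agree[of r] P unfolding U_def by blast
    also have "\<dots> = \<zero>\<^bsub>R\<^esub> \<odot>\<^bsub>E\<^esub> (a [^]\<^bsub>R\<^esub> n \<odot>\<^bsub>E\<^esub> x)" by (rule \<phi>_eq[OF P])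
    also have "\<dots> = \<zero>\<^bsub>E\<^esub>" using a x by simp
    finally show ?thesis .
  qed
  moreover have "a [^]\<^bsub>R\<^esub> n \<odot>\<^bsub>E\<^esub> (x \<ominus>\<^bsub>E\<^esub> a \<odot>\<^bsub>E\<^esub> y) = \<zero>\<^bsub>E\<^esub>"
  proof -
    have "a [^]\<^bsub>R\<^esub> Suc n \<odot>\<^bsub>E\<^esub> y = \<psi> (a [^]\<^bsub>R\<^esub> Suc n)" by (rule \<psi>_eq[OF Pcarr[OF Pa], symmetric])
    also have "\<dots> = \<phi> (a [^]\<^bsub>R\<^esub> Suc n)" using Pa agree unfolding U_def by blast
    also have "\<dots> = \<one>\<^bsub>R\<^esub> \<odot>\<^bsub>E\<^esub> (a [^]\<^bsub>R\<^esub> n \<odot>\<^bsub>E\<^esub> x)" by (rule \<phi>_eq[OF Pa])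
    also have "\<dots> = a [^]\<^bsub>R\<^esub> n \<odot>\<^bsub>E\<^esub> x" using a x by simp
    finally have "a [^]\<^bsub>R\<^esub> n \<odot>\<^bsub>E\<^esub> (a \<odot>\<^bsub>E\<^esub> y) = a [^]\<^bsub>R\<^esub> n \<odot>\<^bsub>E\<^esub> x"
      using a y by (simp add: E.smult_assoc1)
    then show ?thesis using a x y by (simp add: E.smult_minus_distr E.minus_eq_zero_iff)
  qed
  ultimately show ?thesis using y by blast
qed

section \<open>Quasi-isomorphisms around an injective resolution\<close>

lemma quotient_module_simps:
  "carrier (quotient_module Z B) = a_rcosets\<^bsub>Z\<^esub> B" "\<zero>\<^bsub>quotient_module Z B\<^esub> = B"
  "U \<oplus>\<^bsub>quotient_module Z B\<^esub> V = U <+>\<^bsub>Z\<^esub> V"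
  "a \<odot>\<^bsub>quotient_module Z B\<^esub> U = (\<Union>x\<in>U. B +>\<^bsub>Z\<^esub> (a \<odot>\<^bsub>Z\<^esub> x))"
  by (simp_all add: quotient_module_def)

lemma quotient_module:
  assumes "module R Z" and B: "submodule B R Z"
  shows quotient_module_module: "module R (quotient_module Z B)"
    and coset_mod_hom: "(\<lambda>x. B +>\<^bsub>Z\<^esub> x) \<in> mod_hom R Z (quotient_module Z B)"
    and coset_surj: "carrier (quotient_module Z B) = (\<lambda>x. B +>\<^bsub>Z\<^esub> x) ` carrier Z"
    and coset_zero_iff: "x \<in> carrier Z \<Longrightarrow> B +>\<^bsub>Z\<^esub> x = \<zero>\<^bsub>quotient_module Z B\<^esub> \<longleftrightarrow> x \<in> B"
proof -
  interpret Z: module R Z by fact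
  note B' = Z.submoduleE[OF B]
  interpret B: abelian_subgroup B Z
    by (rule abelian_subgroupI3) (use submodule.axioms(1)[OF B] in
        \<open>auto simp: additive_subgroup_def Z.abelian_group_axioms\<close>)
  let ?Q = "quotient_module Z B" and ?c = "\<lambda>x. B +>\<^bsub>Z\<^esub> x"
  show surj: "carrier ?Q = ?c ` carrier Z"
    by (auto simp: quotient_module_simps A_RCOSETS_def')
  show zero: "?c x = \<zero>\<^bsub>?Q\<^esub> \<longleftrightarrow> x \<in> B" if "x \<in> carrier Z" for x
    using Z.a_coset_join1[OF _ that B.a_subgroup] Z.a_coset_join2[OF that B.a_subgroup]
    by (auto simp: quotient_module_simps)
  have add: "?c (x \<oplus>\<^bsub>Z\<^esub> y) = ?c x \<oplus>\<^bsub>?Q\<^esub> ?c y" if "x \<in> carrier Z" "y \<in> carrier Z" for x y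
    using B.a_rcos_sum[OF that] by (simp add: quotient_module_simps)
  have smult: "a \<odot>\<^bsub>?Q\<^esub> ?c x = ?c (a \<odot>\<^bsub>Z\<^esub> x)" if a: "a \<in> carrier R" and x: "x \<in> carrier Z" for a x
  proof -
    \<comment> \<open>Scalar multiplication of a coset is a union over all representatives; it is a
      single coset because they all give the same one.\<close>
    have "?c (a \<odot>\<^bsub>Z\<^esub> y) = ?c (a \<odot>\<^bsub>Z\<^esub> x)" if y: "y \<in> ?c x" for y
    proof -
      obtain b where b: "b \<in> B" "y = b \<oplus>\<^bsub>Z\<^esub> x" using y by (auto simp: a_r_coset_def')
      then have "b \<in> carrier Z" using B' by blast
      then have "a \<odot>\<^bsub>Z\<^esub> y = a \<odot>\<^bsub>Z\<^esub> b \<oplus>\<^bsub>Z\<^esub> a \<odot>\<^bsub>Z\<^esub> x" using a x b by (simp add: Z.smult_r_distr)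
      moreover have "a \<odot>\<^bsub>Z\<^esub> b \<in> B" using B'(4)[OF a b(1)] .
      ultimately have "a \<odot>\<^bsub>Z\<^esub> y \<in> ?c (a \<odot>\<^bsub>Z\<^esub> x)" by (auto simp: a_r_coset_def')
      then show ?thesis
        using B.a_repr_independence'[of "a \<odot>\<^bsub>Z\<^esub> y" "a \<odot>\<^bsub>Z\<^esub> x"] a x by simp
    qed
    then have "(\<Union>y\<in>?c x. ?c (a \<odot>\<^bsub>Z\<^esub> y)) = (\<Union>y\<in>?c x. ?c (a \<odot>\<^bsub>Z\<^esub> x))" by (intro SUP_cong refl)
    also have "\<dots> = ?c (a \<odot>\<^bsub>Z\<^esub> x)" using B.a_rcos_self[OF x] by blast
    finally show ?thesis unfolding quotient_module_simps .
  qed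
  have grp: "abelian_group ?Q"
  proof (rule abelian_groupI)
    have zero': "\<zero>\<^bsub>?Q\<^esub> = ?c \<zero>\<^bsub>Z\<^esub>" using zero[of "\<zero>\<^bsub>Z\<^esub>"] by simp
    show "\<zero>\<^bsub>?Q\<^esub> \<in> carrier ?Q" unfolding zero' surj by blast
    fix u assume "u \<in> carrier ?Q"
    then obtain x where x: "x \<in> carrier Z" "u = ?c x" unfolding surj by blast
    show "\<zero>\<^bsub>?Q\<^esub> \<oplus>\<^bsub>?Q\<^esub> u = u" unfolding zero' x(2) using x(1) by (simp add: add[symmetric])
    show "\<exists>v\<in>carrier ?Q. v \<oplus>\<^bsub>?Q\<^esub> u = \<zero>\<^bsub>?Q\<^esub>"
      unfolding zero' x(2) surj using x(1)
      by (intro bexI[of _ "?c (\<ominus>\<^bsub>Z\<^esub> x)"] imageI) (simp_all add: add[symmetric] Z.l_neg)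
    fix v assume "v \<in> carrier ?Q"
    then obtain y where y: "y \<in> carrier Z" "v = ?c y" unfolding surj by blast
    show "u \<oplus>\<^bsub>?Q\<^esub> v \<in> carrier ?Q" unfolding surj x(2) y(2) add[OF x(1) y(1), symmetric] using x y by blast
    show "u \<oplus>\<^bsub>?Q\<^esub> v = v \<oplus>\<^bsub>?Q\<^esub> u" using x y by (simp add: add[symmetric] Z.a_comm)
    fix w assume "w \<in> carrier ?Q"
    then obtain z where z: "z \<in> carrier Z" "w = ?c z" unfolding surj by blast
    show "u \<oplus>\<^bsub>?Q\<^esub> v \<oplus>\<^bsub>?Q\<^esub> w = u \<oplus>\<^bsub>?Q\<^esub> (v \<oplus>\<^bsub>?Q\<^esub> w)"
      using x y z by (simp add: add[symmetric] Z.a_assoc)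
  qed
  show "module R ?Q"
    by (rule moduleI[OF Z.R.is_cring grp])
      (auto simp: surj smult add[symmetric] Z.smult_l_distr Z.smult_r_distr Z.smult_assoc1)
  show "?c \<in> mod_hom R Z ?Q"
    by (auto simp: mod_hom_def surj add smult)
qed

section \<open>Padding, truncation and passage to cohomology\<close>

lemma chain_map_inclusion:
  assumes "cochain_complex R C d" "cochain_complex R D d"
    and "\<And>i. carrier (C i) \<subseteq> carrier (D i)"
    and "\<And>i x y. x \<oplus>\<^bsub>C i\<^esub> y = x \<oplus>\<^bsub>D i\<^esub> y" "\<And>i a x. a \<odot>\<^bsub>C i\<^esub> x = a \<odot>\<^bsub>D i\<^esub> x"
  shows "chain_map R C d D d (\<lambda>i x. x)"
  by (intro chain_map.intro assms chain_map_axioms.intro) (use assms in \<open>auto simp: mod_hom_def\<close>)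

text \<open>Cones lower the index by one, see \<^const>\<open>cone\<close>. The padding puts degree zero at index two, so that
  top cohomology classes and the cochains before them never meet the missing negative indices.\<close>

definition pad :: "(nat \<Rightarrow> ('a, 'b) module) \<Rightarrow> nat \<Rightarrow> ('a, 'b) module" where
  "pad C i = (if i < 2 then zero_submodule (C 0) else C (i - 2))"

definition pad_diff :: "(nat \<Rightarrow> ('a, 'b) module) \<Rightarrow> (nat \<Rightarrow> 'b \<Rightarrow> 'b) \<Rightarrow> nat \<Rightarrow> 'b \<Rightarrow> 'b" where
  "pad_diff C d i x = (if i < 2 then \<zero>\<^bsub>C 0\<^esub> else d (i - 2) x)"

lemma pad_simps [simp]:
  "i < 2 \<Longrightarrow> pad C i = zero_submodule (C 0)" "pad C (Suc (Suc i)) = C i"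
  "i < 2 \<Longrightarrow> pad_diff C d i x = \<zero>\<^bsub>C 0\<^esub>" "pad_diff C d (Suc (Suc i)) x = d i x"
  by (simp_all add: pad_def pad_diff_def)

lemma pad_cases:
  obtains "i = 0" | "i = Suc 0" | j where "i = Suc (Suc j)"
  by (metis not0_implies_Suc)

lemma pad_complex:
  assumes "cochain_complex R C d"
  shows "cochain_complex R (pad C) (pad_diff C d)"
proof -
  interpret C: cochain_complex R C d by fact
  interpret M: module R "C 0" by (rule C.module_C)
  show ?thesis
  proof (rule cochain_complex.intro)
    fix i
    show "module R (pad C i)"
      by (cases i rule: pad_cases) (auto simp: zero_submodule_module C.module_C)
    show "pad_diff C d i \<in> mod_hom R (pad C i) (pad C (Suc i))"
      by (cases i rule: pad_cases) (auto simp: mod_hom_def C.d_add C.d_smult)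
  next
    fix x i assume "x \<in> carrier (pad C i)"
    then show "pad_diff C d (Suc i) (pad_diff C d i x) = \<zero>\<^bsub>pad C (Suc (Suc i))\<^esub>"
      by (cases i rule: pad_cases) (auto simp: C.d_d)
  qed
qed

text \<open>A complex with quasi-isomorphisms both to \<open>C\<close> and to the second cohomology of \<open>C\<close>, if the other
  cohomology vanishes.\<close>

definition truncation :: "(nat \<Rightarrow> ('a, 'b) module) \<Rightarrow> (nat \<Rightarrow> 'b \<Rightarrow> 'b) \<Rightarrow> nat \<Rightarrow> ('a, 'b) module" where
  "truncation C d i = (if i < 4 then pad C i
     else if i = 4 then (C 2)\<lparr>carrier := cocycles C d 2\<rparr> else zero_submodule (C (i - 2)))"

lemma truncation_simps:
  "truncation C d 0 = zero_submodule (C 0)" "truncation C d (Suc 0) = zero_submodule (C 0)"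
  "truncation C d (Suc (Suc 0)) = C 0" "truncation C d (Suc (Suc (Suc 0))) = C (Suc 0)"
  "truncation C d (Suc (Suc (Suc (Suc 0)))) = (C (Suc (Suc 0)))\<lparr>carrier := cocycles C d (Suc (Suc 0))\<rparr>"
  "truncation C d (Suc (Suc (Suc (Suc (Suc i))))) = zero_submodule (C (Suc (Suc (Suc i))))"
  by (simp_all add: truncation_def numeral_2_eq_2)

lemma truncation_cases:
  obtains "i = 0" | "i = Suc 0" | "i = Suc (Suc 0)" | "i = Suc (Suc (Suc 0))"
    | "i = Suc (Suc (Suc (Suc 0)))" | j where "i = Suc (Suc (Suc (Suc (Suc j))))"
  by (metis not0_implies_Suc)

lemma cocycles_submodule:
  assumes "cochain_complex R C d"
  shows "submodule (cocycles C d i) R (C i)"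
proof -
  interpret C: cochain_complex R C d by fact
  interpret M: module R "C i" by (rule C.module_C)
  interpret N: module R "C (Suc i)" by (rule C.module_C)
  show ?thesis
    by (rule M.submoduleI) (auto simp: cocycles_def C.d_uminus C.d_add C.d_smult N.minus_equality)
qed

lemma truncation_complex:
  assumes "cochain_complex R C d"
  shows "cochain_complex R (truncation C d) (pad_diff C d)"
proof -
  interpret C: cochain_complex R C d by fact
  interpret P: cochain_complex R "pad C" "pad_diff C d" by (rule pad_complex) fact
  note Z = cocycles_submodule[OF assms]
  show ?thesis
  proof (rule cochain_complex.intro)
    fix i
    show "module R (truncation C d i)"
      by (cases i rule: truncation_cases)
        (auto simp: truncation_simps zero_submodule_module C.module_C module.submodule_module[OF C.module_C Z])
    show "pad_diff C d i \<in> mod_hom R (truncation C d i) (truncation C d (Suc i))"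
      by (cases i rule: truncation_cases)
        (auto simp: truncation_simps mod_hom_def C.d_add C.d_smult cocycles_def C.d_d)
  next
    fix x i assume "x \<in> carrier (truncation C d i)"
    then show "pad_diff C d (Suc i) (pad_diff C d i x) = \<zero>\<^bsub>truncation C d (Suc (Suc i))\<^esub>"
      by (cases i rule: truncation_cases) (auto simp: truncation_simps C.d_d cocycles_def)
  qed
qed

text \<open>The inclusion of a canonical truncation: up to the cut cohomology is unchanged, and
  above it the hypothesis leaves \<open>C\<close> none.\<close>

lemma truncation_quasi_iso:
  assumes "cochain_complex R C d"
    and exact: "\<And>i x. \<lbrakk>2 \<le> i; x \<in> carrier (C (Suc i)); d (Suc i) x = \<zero>\<^bsub>C (Suc (Suc i))\<^esub>\<rbrakk> \<Longrightarrow> x \<in> d i ` carrier (C i)"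
  shows "quasi_iso R (truncation C d) (pad_diff C d) (pad C) (pad_diff C d) (\<lambda>i x. x)"
proof -
  interpret C: cochain_complex R C d by fact
  interpret P: cochain_complex R "pad C" "pad_diff C d" by (rule pad_complex) fact
  have sub: "carrier (truncation C d i) \<subseteq> carrier (pad C i)" for i
    by (cases i rule: truncation_cases) (auto simp: truncation_simps cocycles_def)
  have op: "x \<oplus>\<^bsub>truncation C d i\<^esub> y = x \<oplus>\<^bsub>pad C i\<^esub> y" "a \<odot>\<^bsub>truncation C d i\<^esub> x = a \<odot>\<^bsub>pad C i\<^esub> x" for i a x y
    by (cases i rule: truncation_cases; simp add: truncation_simps)+
  show ?thesis
  proof (intro quasi_iso.intro chain_map_inclusion truncation_complex pad_complex assms(1) sub op
      quasi_iso_axioms.intro)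
    fix x y i
    assume x: "x \<in> carrier (truncation C d (Suc (Suc i)))" and y: "y \<in> carrier (pad C (Suc i))"
      and eq: "x = pad_diff C d (Suc i) y"
    \<comment> \<open>Either \<open>y\<close> itself serves as \<open>x'\<close>, or
      \<open>y\<close> lies above the cut, where \<open>x\<close> is zero, exactness makes
      \<open>y\<close> a boundary, and \<open>x'\<close> may be zero.\<close>
    have "y \<in> carrier (truncation C d (Suc i)) \<or> (\<exists>y'\<in>carrier (pad C i). y = pad_diff C d i y' \<and>
        x = \<zero>\<^bsub>C i\<^esub> \<and> \<zero>\<^bsub>pad C (Suc i)\<^esub> \<in> carrier (truncation C d (Suc i)) \<and>
        pad_diff C d (Suc i) \<zero>\<^bsub>pad C (Suc i)\<^esub> = x)"
    proof (cases i rule: truncation_cases)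
      case 4
      then show ?thesis using x y eq by (simp add: truncation_simps cocycles_def)
    next
      case 5
      then have "d (Suc (Suc (Suc 0))) y = \<zero>\<^bsub>C (Suc (Suc (Suc (Suc 0))))\<^esub>"
        using x eq by (simp add: truncation_simps)
      then obtain y' where "y' \<in> carrier (C (Suc (Suc 0)))" "y = d (Suc (Suc 0)) y'"
        using exact[of "Suc (Suc 0)" y] y 5 by auto
      then show ?thesis using 5 x by (auto simp: truncation_simps)
    next
      case (6 j)
      let ?j = "Suc (Suc (Suc j))"
      have "d (Suc ?j) y = \<zero>\<^bsub>C (Suc (Suc ?j))\<^esub>"
        using x eq 6 by (simp add: truncation_simps)
      then obtain y' where "y' \<in> carrier (C ?j)" "y = d ?j y'"
        using exact[of ?j y] y 6 by auto
      then show ?thesis using 6 x by (auto simp: truncation_simps)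
    qed (use y in \<open>auto simp: truncation_simps\<close>)
    then show "\<exists>x'\<in>carrier (truncation C d (Suc i)). \<exists>y'\<in>carrier (pad C i).
        x = pad_diff C d (Suc i) x' \<and> y = x' \<oplus>\<^bsub>pad C (Suc i)\<^esub> pad_diff C d i y'"
    proof (elim disjE bexE conjE)
      assume "y \<in> carrier (truncation C d (Suc i))"
      then show ?thesis using eq y by (intro bexI[of _ y] bexI[of _ "\<zero>\<^bsub>pad C i\<^esub>"]) auto
    next
      fix y' assume y': "y' \<in> carrier (pad C i)" "y = pad_diff C d i y'"
        and z: "\<zero>\<^bsub>pad C (Suc i)\<^esub> \<in> carrier (truncation C d (Suc i))"
          "pad_diff C d (Suc i) \<zero>\<^bsub>pad C (Suc i)\<^esub> = x"
      show ?thesis using y' z P.C_neutral(2)[OF P.d_closed[OF y'(1)]]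
        by (intro bexI[of _ "\<zero>\<^bsub>pad C (Suc i)\<^esub>"] bexI[of _ y']) auto
    qed
  qed
qed

lemma coboundaries_submodule:
  assumes "cochain_complex R C d"
  shows "submodule (d i ` carrier (C i)) R ((C (Suc i))\<lparr>carrier := cocycles C d (Suc i)\<rparr>)"
proof -
  interpret C: cochain_complex R C d by fact
  let ?Z = "(C (Suc i))\<lparr>carrier := cocycles C d (Suc i)\<rparr>"
  note Z = cocycles_submodule[OF assms, of "Suc i"]
  interpret Z: module R ?Z by (rule module.submodule_module[OF C.module_C Z])
  have im: "d i x \<in> cocycles C d (Suc i)" if "x \<in> carrier (C i)" for x
    using that by (simp add: cocycles_def C.d_d)
  show ?thesis
  proof (rule Z.submoduleI)
    fix z assume "z \<in> d i ` carrier (C i)"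
    then obtain x where x: "x \<in> carrier (C i)" "z = d i x" by blast
    then have "\<ominus>\<^bsub>?Z\<^esub> z = d i (\<ominus>\<^bsub>C i\<^esub> x)"
      using restrict_a_inv[OF C.module_C Z im[OF x(1)]] by (simp add: C.d_uminus)
    then show "\<ominus>\<^bsub>?Z\<^esub> z \<in> d i ` carrier (C i)" using x by blast
  next
    fix a z assume "a \<in> carrier R" "z \<in> d i ` carrier (C i)"
    then show "a \<odot>\<^bsub>?Z\<^esub> z \<in> d i ` carrier (C i)" by (auto simp: C.d_smult[symmetric])
  next
    fix z w assume "z \<in> d i ` carrier (C i)" "w \<in> d i ` carrier (C i)"
    then show "z \<oplus>\<^bsub>?Z\<^esub> w \<in> d i ` carrier (C i)" by (auto simp: C.d_add[symmetric])
  next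
    have "d i \<zero>\<^bsub>C i\<^esub> = \<zero>\<^bsub>C (Suc i)\<^esub>" by simp
    then show "\<zero>\<^bsub>?Z\<^esub> \<in> d i ` carrier (C i)" by force
  qed (use im in auto)
qed

lemma cohomology_module:
  assumes "cochain_complex R C d"
  shows "module R (cohomology C d (Suc i))"
  unfolding cohomology_def coboundaries_def nat.case
  using assms cochain_complex.module_C[OF assms]
  by (intro quotient_module_module coboundaries_submodule module.submodule_module cocycles_submodule)

text \<open>In degree two the truncation consists of cocycles, so taking cosets there is a chain map
  to the stalk. What it forgets is the coboundaries in degree two together with the lower degrees,
  and these form an exact complex.\<close>

lemma cohomology_quasi_iso:
  assumes "cochain_complex R C d"
    and inj: "\<And>x. \<lbrakk>x \<in> carrier (C 0); d 0 x = \<zero>\<^bsub>C 1\<^esub>\<rbrakk> \<Longrightarrow> x = \<zero>\<^bsub>C 0\<^esub>"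
    and exact: "\<And>x. \<lbrakk>x \<in> carrier (C 1); d 1 x = \<zero>\<^bsub>C 2\<^esub>\<rbrakk> \<Longrightarrow> x \<in> d 0 ` carrier (C 0)"
    and M: "M = cohomology C d 2"
  shows "quasi_iso R (truncation C d) (pad_diff C d) (stalk 4 M) (\<lambda>_ _. \<zero>\<^bsub>M\<^esub>)
    (\<lambda>i x. if i = 4 then d 1 ` carrier (C 1) +>\<^bsub>(C 2)\<lparr>carrier := cocycles C d 2\<rparr>\<^esub> x else \<zero>\<^bsub>M\<^esub>)"
proof -
  interpret C: cochain_complex R C d by fact
  let ?B = "d (Suc 0) ` carrier (C (Suc 0))"
  let ?Z = "(C (Suc (Suc 0)))\<lparr>carrier := cocycles C d (Suc (Suc 0))\<rparr>"
  have two: "(2::nat) = Suc (Suc 0)" "(1::nat) = Suc 0" "(4::nat) = Suc (Suc (Suc (Suc 0)))" by simp_all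
  have Q: "M = quotient_module ?Z ?B" unfolding M cohomology_def coboundaries_def two by simp
  have Zm: "module R ?Z"
    by (rule module.submodule_module[OF C.module_C cocycles_submodule[OF assms(1)]])
  note B = coboundaries_submodule[OF assms(1), of "Suc 0"]
  note q = quotient_module[OF Zm B, folded Q]
  interpret Q: module R M by (rule q(1))
  interpret T: cochain_complex R "truncation C d" "pad_diff C d" by (rule truncation_complex) fact
  note hom = mod_homD[OF q(2)]
  show ?thesis
    unfolding two
  proof (intro quasi_iso.intro chain_map.intro truncation_complex stalk_complex assms(1) q(1)
      chain_map_axioms.intro quasi_iso_axioms.intro)
    fix i
    show "(\<lambda>x. if i = Suc (Suc (Suc (Suc 0))) then ?B +>\<^bsub>?Z\<^esub> x else \<zero>\<^bsub>M\<^esub>) \<in>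
        mod_hom R (truncation C d i) (stalk (Suc (Suc (Suc (Suc 0)))) M i)"
      using q(2) by (cases i rule: truncation_cases) (auto simp: truncation_simps mod_hom_def)
  next
    fix x i assume x: "x \<in> carrier (truncation C d i)"
    show "(if Suc i = Suc (Suc (Suc (Suc 0))) then ?B +>\<^bsub>?Z\<^esub> pad_diff C d i x else \<zero>\<^bsub>M\<^esub>) = \<zero>\<^bsub>M\<^esub>"
    proof (cases "i = Suc (Suc (Suc 0))")
      case True
      then have "pad_diff C d i x \<in> ?B" using x by (simp add: truncation_simps)
      moreover from this have "pad_diff C d i x \<in> carrier ?Z"
        using module.submoduleE(1)[OF Zm B] by blast
      ultimately have "?B +>\<^bsub>?Z\<^esub> pad_diff C d i x = \<zero>\<^bsub>M\<^esub>" using q(4) by blast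
      then show ?thesis by presburger
    qed simp
  next
    fix x y i
    let ?n = "Suc (Suc (Suc (Suc 0)))"
    let ?p = "\<lambda>i x. if i = ?n then ?B +>\<^bsub>?Z\<^esub> x else \<zero>\<^bsub>M\<^esub>"
    assume x: "x \<in> carrier (truncation C d (Suc (Suc i)))" and y: "y \<in> carrier (stalk ?n M (Suc i))"
      and dx: "pad_diff C d (Suc (Suc i)) x = \<zero>\<^bsub>truncation C d (Suc (Suc (Suc i)))\<^esub>"
      and eq: "?p (Suc (Suc i)) x = \<zero>\<^bsub>M\<^esub>"
    \<comment> \<open>The differentials of the stalk vanish, so no boundary on that side can correct
      \<open>y\<close>; it has to be the image of \<open>x'\<close> exactly.\<close>
    have "\<exists>x'\<in>carrier (truncation C d (Suc i)). x = pad_diff C d (Suc i) x' \<and> y = ?p (Suc i) x'"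
    proof (cases i rule: truncation_cases)
      case 1
      have "x = \<zero>\<^bsub>C 0\<^esub>" using inj[of x] x dx 1 by (simp add: truncation_simps)
      then show ?thesis using y 1 by (auto simp: truncation_simps)
    next
      case 2
      have "x \<in> d 0 ` carrier (C 0)" using exact[of x] x dx 2 by (simp add: truncation_simps numeral_2_eq_2)
      then show ?thesis using y 2 by (auto simp: truncation_simps)
    next
      case 3
      have "x \<in> ?B" using q(4)[of x] x eq 3 by (simp add: truncation_simps)
      then show ?thesis using y 3 by (auto simp: truncation_simps)
    next
      case 4
      have "x = \<zero>\<^bsub>C (Suc (Suc (Suc 0)))\<^esub>" using x 4 by (simp add: truncation_simps)
      moreover obtain z where "z \<in> cocycles C d (Suc (Suc 0))" "y = ?B +>\<^bsub>?Z\<^esub> z"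
        using y 4 q(3) by auto
      ultimately show ?thesis using 4 by (auto simp: truncation_simps cocycles_def)
    next
      case 5
      then show ?thesis using x y by (auto simp: truncation_simps)
    next
      case (6 j)
      then show ?thesis using x y by (auto simp: truncation_simps)
    qed
    then show "\<exists>x'\<in>carrier (truncation C d (Suc i)). \<exists>y'\<in>carrier (stalk ?n M i).
        x = pad_diff C d (Suc i) x' \<and> y = ?p (Suc i) x' \<oplus>\<^bsub>stalk ?n M (Suc i)\<^esub> \<zero>\<^bsub>M\<^esub>"
    proof (elim bexE conjE)
      fix x' assume x': "x' \<in> carrier (truncation C d (Suc i))" "x = pad_diff C d (Suc i) x'" "y = ?p (Suc i) x'"
      have "y \<in> carrier M" using y by (auto split: if_splits)
      then show ?thesis using x' by (intro bexI[of _ x'] bexI[of _ "\<zero>\<^bsub>M\<^esub>"]) auto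
    qed
  qed
qed

section \<open>Injective resolutions and their torsion subcomplexes\<close>

lemma injective_resolutionD:
  assumes "injective_resolution R N E d e"
  shows "injective_module R (E i)" "module R (E i)" "d i \<in> mod_hom R (E i) (E (Suc i))"
    "e \<in> mod_hom R N (E 0)" "inj_on e (carrier N)" "e ` carrier N = cocycles E d 0"
    "d i ` carrier (E i) = cocycles E d (Suc i)"
  using assms by (auto simp: injective_resolution_def injective_module_def)

lemma injective_resolution_complex:
  assumes "injective_resolution R N E d e"
  shows "cochain_complex R E d"
proof (rule cochain_complex.intro)
  note r = injective_resolutionD[OF assms]
  show "module R (E i)" "d i \<in> mod_hom R (E i) (E (Suc i))" for i by (rule r)+
  show "d (Suc i) (d i x) = \<zero>\<^bsub>E (Suc (Suc i))\<^esub>" if "x \<in> carrier (E i)" for x i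
    using r(7)[of i] that by (auto simp: cocycles_def)
qed

lemma element_torsion_complex:
  assumes "cochain_complex R E d" "S \<subseteq> carrier R"
  shows "cochain_complex R (\<lambda>i. element_torsion R S (E i)) d"
proof -
  interpret E: cochain_complex R E d by fact
  interpret M: module R "E 0" by (rule E.module_C)
  have "a [^]\<^bsub>R\<^esub> (n::nat) \<odot>\<^bsub>E (Suc i)\<^esub> d i x = \<zero>\<^bsub>E (Suc i)\<^esub>"
    if "a \<in> S" "x \<in> carrier (E i)" "a [^]\<^bsub>R\<^esub> (n::nat) \<odot>\<^bsub>E i\<^esub> x = \<zero>\<^bsub>E i\<^esub>" for a n i x
    using E.d_smult[of "a [^]\<^bsub>R\<^esub> n" x i] that assms(2) by (auto simp: subset_iff)
  then have tor: "d i x \<in> carrier (element_torsion R S (E (Suc i)))"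
    if "x \<in> carrier (element_torsion R S (E i))" for i x
    using that unfolding element_torsion_simps by (meson E.d_closed)
  show ?thesis
    by (rule cochain_complex.intro)
      (use tor in \<open>simp_all add: element_torsion_module E.module_C assms mod_hom_def E.d_add E.d_smult E.d_d\<close>)
qed

text \<open>A torsion submodule has the same zero as the whole module, so one differential serves
  before and after taking torsion.\<close>

lemma pad_diff_cong: "\<zero>\<^bsub>C 0\<^esub> = \<zero>\<^bsub>D 0\<^esub> \<Longrightarrow> pad_diff C d = pad_diff D d"
  by (auto simp: pad_diff_def fun_eq_iff)

text \<open>On the \<open>S\<close>-torsion modulo its \<open>a\<close>-torsion, \<open>a\<close> is
  injective because an element with \<open>a\<close>-torsion multiple \<open>a y\<close> is itself
  \<open>a\<close>-torsion, and surjective by \<open>injective_module_divide\<close>. The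
  annihilator clause there is what keeps the quotient \<open>y'\<close> inside the
  \<open>S\<close>-torsion.\<close>

lemma element_torsion_inverting:
  assumes R: "cring R" "noetherian_ring R" and E: "injective_resolution R N E d e"
    and S: "S \<subseteq> carrier R" and a: "a \<in> carrier R"
  shows "chain_map_inverting R (pad (\<lambda>i. element_torsion R (insert a S) (E i))) (pad_diff E d)
    (pad (\<lambda>i. element_torsion R S (E i))) (pad_diff E d) (\<lambda>i x. x) a"
proof -
  let ?T = "\<lambda>S i. element_torsion R S (E i)"
  note r = injective_resolutionD[OF E]
  have Ec: "cochain_complex R E d" by (rule injective_resolution_complex[OF E])
  interpret E: cochain_complex R E d by (rule Ec)
  have eq: "pad_diff (?T S) d = pad_diff E d" for S by (rule pad_diff_cong) simp
  have T: "cochain_complex R (pad (?T S)) (pad_diff E d)" if "S \<subseteq> carrier R" for S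
    using pad_complex[OF element_torsion_complex[OF Ec that]] unfolding eq .
  show ?thesis
  proof (intro chain_map_inverting.intro chain_map_inclusion T chain_map_inverting_axioms.intro a S)
    show "insert a S \<subseteq> carrier R" using a S by simp
    show "inj_on (\<lambda>x. x) (carrier (pad (?T (insert a S)) i))" for i by simp
    show "carrier (pad (?T (insert a S)) i) \<subseteq> carrier (pad (?T S) i)" for i
      by (cases i rule: pad_cases) auto
    show "x \<oplus>\<^bsub>pad (?T (insert a S)) i\<^esub> y = x \<oplus>\<^bsub>pad (?T S) i\<^esub> y"
      "b \<odot>\<^bsub>pad (?T (insert a S)) i\<^esub> x = b \<odot>\<^bsub>pad (?T S) i\<^esub> x" for i x y b
      by (cases i rule: pad_cases; simp)+
  next
    fix y i
    assume y: "y \<in> carrier (pad (?T S) i)"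
      and ay: "a \<odot>\<^bsub>pad (?T S) i\<^esub> y \<in> (\<lambda>x. x) ` carrier (pad (?T (insert a S)) i)"
    show "y \<in> (\<lambda>x. x) ` carrier (pad (?T (insert a S)) i)"
    proof (cases i rule: pad_cases)
      case (3 j)
      interpret M: module R "E j" by (rule r)
      obtain n where "a [^]\<^bsub>R\<^esub> (n::nat) \<odot>\<^bsub>E j\<^esub> (a \<odot>\<^bsub>E j\<^esub> y) = \<zero>\<^bsub>E j\<^esub>"
        using ay 3 by auto
      then have "a [^]\<^bsub>R\<^esub> Suc n \<odot>\<^bsub>E j\<^esub> y = \<zero>\<^bsub>E j\<^esub>"
        using a y 3 by (simp add: M.smult_assoc1)
      then have "\<exists>n::nat. a [^]\<^bsub>R\<^esub> n \<odot>\<^bsub>E j\<^esub> y = \<zero>\<^bsub>E j\<^esub>" by blast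
      then show ?thesis using y 3 by simp
    qed (use y in auto)
  next
    fix y i
    assume y: "y \<in> carrier (pad (?T S) i)"
    interpret P: cochain_complex R "pad (?T S)" "pad_diff E d" by (rule T[OF S])
    show "\<exists>x\<in>carrier (pad (?T (insert a S)) i). \<exists>y'\<in>carrier (pad (?T S) i).
        y = x \<oplus>\<^bsub>pad (?T S) i\<^esub> a \<odot>\<^bsub>pad (?T S) i\<^esub> y'"
    proof (cases i rule: pad_cases)
      case (3 j)
      interpret M: module R "E j" by (rule r)
      have yE: "y \<in> carrier (E j)" using y 3 by simp
      obtain y' n where y': "y' \<in> carrier (E j)"
        and n: "a [^]\<^bsub>R\<^esub> (n::nat) \<odot>\<^bsub>E j\<^esub> (y \<ominus>\<^bsub>E j\<^esub> a \<odot>\<^bsub>E j\<^esub> y') = \<zero>\<^bsub>E j\<^esub>"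
        and ann: "\<And>b. b \<in> carrier R \<Longrightarrow> b \<odot>\<^bsub>E j\<^esub> y = \<zero>\<^bsub>E j\<^esub> \<Longrightarrow> b \<odot>\<^bsub>E j\<^esub> y' = \<zero>\<^bsub>E j\<^esub>"
        using injective_module_divide[OF R r(1) yE a] by blast
      have y'T: "y' \<in> carrier (?T S j)"
        unfolding element_torsion_simps
      proof (intro conjI ballI y')
        fix b assume b: "b \<in> S"
        then obtain m where "b [^]\<^bsub>R\<^esub> (m::nat) \<odot>\<^bsub>E j\<^esub> y = \<zero>\<^bsub>E j\<^esub>" using y 3 by auto
        then show "\<exists>m::nat. b [^]\<^bsub>R\<^esub> m \<odot>\<^bsub>E j\<^esub> y' = \<zero>\<^bsub>E j\<^esub>"
          using ann[of "b [^]\<^bsub>R\<^esub> m"] b S by blast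
      qed
      note sub = M.submoduleE[OF element_torsion_submodule[OF r(2) S]]
      have "a \<odot>\<^bsub>E j\<^esub> y' \<in> carrier (?T S j)" by (rule sub(4)[OF a y'T])
      then have "y \<ominus>\<^bsub>E j\<^esub> a \<odot>\<^bsub>E j\<^esub> y' \<in> carrier (?T S j)"
        using sub(3,5) y 3 by (simp add: a_minus_def del: element_torsion_simps(1))
      then have "y \<ominus>\<^bsub>E j\<^esub> a \<odot>\<^bsub>E j\<^esub> y' \<in> carrier (?T (insert a S) j)" using n by auto
      moreover have "y = (y \<ominus>\<^bsub>E j\<^esub> a \<odot>\<^bsub>E j\<^esub> y') \<oplus>\<^bsub>E j\<^esub> a \<odot>\<^bsub>E j\<^esub> y'"
        using yE y' a by (simp add: M.add_minus_cancel M.a_comm)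
      ultimately show ?thesis using y'T 3
        by (intro bexI[of _ "y \<ominus>\<^bsub>E j\<^esub> a \<odot>\<^bsub>E j\<^esub> y'"] bexI[of _ y']) simp_all
    qed (use y a in auto)
  qed
qed

lemma quasi_iso_id:
  assumes "cochain_complex R C d"
  shows "quasi_iso R C d C d (\<lambda>i x. x)"
proof -
  interpret C: cochain_complex R C d by fact
  show ?thesis
  proof (intro quasi_iso.intro chain_map_inclusion assms quasi_iso_axioms.intro)
    fix x y i
    assume y: "y \<in> carrier (C (Suc i))" and "x = d (Suc i) y"
    then show "\<exists>x'\<in>carrier (C (Suc i)). \<exists>y'\<in>carrier (C i). x = d (Suc i) x' \<and> y = x' \<oplus>\<^bsub>C (Suc i)\<^esub> d i y'"
      by (intro bexI[of _ y] bexI[of _ "\<zero>\<^bsub>C i\<^esub>"]) auto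
  qed auto
qed

text \<open>Torsion with respect to one more element \<open>a\<close> changes an injective module by a quotient on which
  \<open>a\<close> is bijective, and the Koszul complex on a sequence containing \<open>a\<close> does not see that quotient.\<close>

lemma koszul_torsion_quasi_iso:
  fixes E :: "nat \<Rightarrow> ('a, 'b) module"
  assumes R: "cring R" "noetherian_ring R" and E: "injective_resolution R N E d e"
    and bs: "set bs \<subseteq> carrier R" and "set as \<subseteq> set bs"
  shows "quasi_iso R (koszul bs (leaves (pad (\<lambda>i. element_torsion R (set as) (E i)))))
    (koszul_diff bs (leaves (pad (\<lambda>i. element_torsion R (set as) (E i)))) (leaf_diff (pad_diff E d)))
    (koszul bs (leaves (pad E))) (koszul_diff bs (leaves (pad E)) (leaf_diff (pad_diff E d)))
    (koszul_map bs (leaf_diff (\<lambda>i x. x)))"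
  using assms(5)
proof (induction as)
  case Nil
  have "(\<lambda>i. element_torsion R (set []) (E i)) = E" by (simp add: element_torsion_def)
  moreover have "quasi_iso R (pad E) (pad_diff E d) (pad E) (pad_diff E d) (\<lambda>i x. x)"
    by (intro quasi_iso_id pad_complex injective_resolution_complex[OF E])
  ultimately show ?case by (simp only:) (intro koszul_quasi_iso leaves_quasi_iso bs)
next
  case (Cons a as)
  have a: "a \<in> set bs" "a \<in> carrier R" "set as \<subseteq> carrier R" using Cons.prems bs by auto
  have "chain_map_inverting R (pad (\<lambda>i. element_torsion R (set (a # as)) (E i))) (pad_diff E d)
      (pad (\<lambda>i. element_torsion R (set as) (E i))) (pad_diff E d) (\<lambda>i x. x) a"
    using element_torsion_inverting[OF R E a(3,2)] by simp
  from quasi_iso_comp[OF koszul_inverting_quasi_iso[OF leaves_inverting[OF this] a(1) bs] Cons.IH]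
  have "quasi_iso R (koszul bs (leaves (pad (\<lambda>i. element_torsion R (set (a # as)) (E i)))))
    (koszul_diff bs (leaves (pad (\<lambda>i. element_torsion R (set (a # as)) (E i)))) (leaf_diff (pad_diff E d)))
    (koszul bs (leaves (pad E))) (koszul_diff bs (leaves (pad E)) (leaf_diff (pad_diff E d)))
    (\<lambda>i u. koszul_map bs (leaf_diff (\<lambda>i x. x)) i (koszul_map bs (leaf_diff (\<lambda>i x. x)) i u))"
    using Cons.prems by simp
  moreover have "(\<lambda>i x. leaf_diff (\<lambda>i x. x) i (leaf_diff (\<lambda>i x. x) i x)) = leaf_diff (\<lambda>i x. x :: 'b)"
    by (simp add: leaf_diff_def fun_eq_iff)
  ultimately show ?case by (simp only: koszul_map_comp)
qed

text \<open>Padding puts degree zero at index two. Injectivity of \<open>e\<close>, its image being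
  the degree zero cocycles, and exactness in higher degrees each settle one range of
  indices.\<close>

lemma resolution_quasi_iso:
  assumes R: "cring R" and E: "injective_resolution R (self_module R) E d e"
  shows "quasi_iso R (stalk 2 (self_module R)) (\<lambda>_ _. \<zero>\<^bsub>self_module R\<^esub>) (pad E) (pad_diff E d)
    (\<lambda>i x. if i = 2 then e x else \<zero>\<^bsub>pad E i\<^esub>)"
proof -
  note r = injective_resolutionD[OF E]
  have Ec: "cochain_complex R E d" by (rule injective_resolution_complex[OF E])
  interpret E: cochain_complex R E d by (rule Ec)
  interpret P: cochain_complex R "pad E" "pad_diff E d" by (rule pad_complex[OF Ec])
  have S: "module R (self_module R)" by (rule self_module_module[OF R])
  have e0: "e \<zero>\<^bsub>R\<^esub> = \<zero>\<^bsub>E 0\<^esub>" using mod_hom_zero_minus(1)[OF r(4) S r(2)] by simp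
  have two: "(2::nat) = Suc (Suc 0)" by simp
  have e_inj: "x = \<zero>\<^bsub>R\<^esub>" if "x \<in> carrier R" "e x = \<zero>\<^bsub>E 0\<^esub>" for x
    using inj_onD[OF r(5), of x "\<zero>\<^bsub>R\<^esub>"] that e0 module.axioms(1)[OF S] by (simp add: cring.cring_simprules)
  show ?thesis
    unfolding two
  proof (intro quasi_iso.intro chain_map.intro stalk_complex S P.cochain_complex_axioms
      chain_map_axioms.intro quasi_iso_axioms.intro)
    fix i
    show "(\<lambda>x. if i = Suc (Suc 0) then e x else \<zero>\<^bsub>pad E i\<^esub>) \<in>
        mod_hom R (stalk (Suc (Suc 0)) (self_module R) i) (pad E i)"
      using r(4) by (cases "i = Suc (Suc 0)") (auto simp: mod_hom_def stalk_def)
  next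
    fix x i assume x: "x \<in> carrier (stalk (Suc (Suc 0)) (self_module R) i)"
    show "(if Suc i = Suc (Suc 0) then e \<zero>\<^bsub>self_module R\<^esub> else \<zero>\<^bsub>pad E (Suc i)\<^esub>) =
        pad_diff E d i (if i = Suc (Suc 0) then e x else \<zero>\<^bsub>pad E i\<^esub>)"
    proof (cases "i = Suc (Suc 0)")
      case True
      then have "e x \<in> cocycles E d 0" using x r(6) by auto
      then show ?thesis using True by (simp add: cocycles_def)
    next
      case False
      then show ?thesis using P.d_zero[of i] e0 by auto
    qed
  next
    fix x y i
    let ?n = "Suc (Suc 0)"
    let ?p = "\<lambda>i x. if i = ?n then e x else \<zero>\<^bsub>pad E i\<^esub>"
    assume x: "x \<in> carrier (stalk ?n (self_module R) (Suc (Suc i)))" and y: "y \<in> carrier (pad E (Suc i))"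
      and eq: "?p (Suc (Suc i)) x = pad_diff E d (Suc i) y"
    show "\<exists>x'\<in>carrier (stalk ?n (self_module R) (Suc i)). \<exists>y'\<in>carrier (pad E i).
        x = \<zero>\<^bsub>self_module R\<^esub> \<and> y = ?p (Suc i) x' \<oplus>\<^bsub>pad E (Suc i)\<^esub> pad_diff E d i y'"
    proof (cases i rule: pad_cases)
      case 1
      have "x = \<zero>\<^bsub>R\<^esub>" using e_inj x eq y 1 by simp
      moreover have "\<zero>\<^bsub>E 0\<^esub> \<oplus>\<^bsub>E 0\<^esub> \<zero>\<^bsub>E 0\<^esub> = \<zero>\<^bsub>E 0\<^esub>" by simp
      ultimately show ?thesis using y 1 by auto
    next
      case 2
      then have "y \<in> cocycles E d 0" using y eq by (simp add: cocycles_def)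
      then obtain x' where x': "x' \<in> carrier R" "y = e x'" using r(6) by auto
      moreover have "e x' \<oplus>\<^bsub>E 0\<^esub> \<zero>\<^bsub>E 0\<^esub> = e x'" using y 2 x' by simp
      ultimately show ?thesis using x 2 by (auto intro!: bexI[of _ x'])
    next
      case (3 j)
      then have "y \<in> cocycles E d (Suc j)" using y eq by (simp add: cocycles_def)
      then obtain y' where y': "y' \<in> carrier (E j)" "y = d j y'" using r(7)[of j] by auto
      moreover have "\<zero>\<^bsub>E (Suc j)\<^esub> \<oplus>\<^bsub>E (Suc j)\<^esub> d j y' = d j y'" using y' by simp
      ultimately show ?thesis using x 3 by (auto intro!: bexI[of _ y'])
    qed
  qed
qed

lemma koszul_map_append [simp]: "koszul_map (bs @ cs) \<phi> = koszul_map bs (koszul_map cs \<phi>)"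
  by (induction bs) auto

section \<open>Regular sequences and vanishing of low local cohomology\<close>

context cring
begin

lemma genideal_empty: "genideal R {} = {\<zero>}"
proof -
  interpret I: ideal "genideal R {}" R by (rule genideal_ideal) simp
  show ?thesis using genideal_minimal[OF zeroideal, of "{}"] I.zero_closed by blast
qed

lemma regular_sequenceD:
  assumes "regular_sequence R [f, h]"
  shows "f \<in> carrier R" "h \<in> carrier R"
    and "\<And>a. \<lbrakk>a \<in> carrier R; f \<otimes> a = \<zero>\<rbrakk> \<Longrightarrow> a = \<zero>"
    and "\<And>a b. \<lbrakk>a \<in> carrier R; b \<in> carrier R; h \<otimes> a = f \<otimes> b\<rbrakk> \<Longrightarrow> \<exists>c\<in>carrier R. a = f \<otimes> c"
proof -
  show f: "f \<in> carrier R" and h: "h \<in> carrier R" using assms by (auto simp: regular_sequence_def)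
  have reg: "\<And>k a. \<lbrakk>k < 2; a \<in> carrier R; [f, h] ! k \<otimes> a \<in> genideal R (set (take k [f, h]))\<rbrakk>
      \<Longrightarrow> a \<in> genideal R (set (take k [f, h]))"
    using assms by (simp add: regular_sequence_def numeral_2_eq_2)
  show "a = \<zero>" if "a \<in> carrier R" "f \<otimes> a = \<zero>" for a
    using reg[of 0 a] that by (simp add: genideal_empty)
  show "\<exists>c\<in>carrier R. a = f \<otimes> c" if ab: "a \<in> carrier R" "b \<in> carrier R" "h \<otimes> a = f \<otimes> b" for a b
  proof -
    have "f \<otimes> b \<in> PIdl f" using ab f by (auto simp: cgenideal_def m_comm)
    then have "a \<in> PIdl f" using reg[of 1 a] ab f by (simp add: cgenideal_eq_genideal)
    then show ?thesis using f by (auto simp: cgenideal_def m_comm)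
  qed
qed

text \<open>The exponents are raised one after the other. For \<open>f\<close>, cancelling the
  nonzerodivisor \<open>f^n\<close> reduces to exponent one; for \<open>h\<close>, one factor is
  peeled off at a time while the power of \<open>f\<close> stays fixed.\<close>

lemma regular_sequence_powers:
  assumes "regular_sequence R [f, h]"
  shows "\<And>a. \<lbrakk>a \<in> carrier R; f [^] (n::nat) \<otimes> a = \<zero>\<rbrakk> \<Longrightarrow> a = \<zero>"
    and "\<And>a b. \<lbrakk>a \<in> carrier R; b \<in> carrier R; h [^] (m::nat) \<otimes> a = f [^] (n::nat) \<otimes> b\<rbrakk> \<Longrightarrow>
      \<exists>c\<in>carrier R. a = f [^] n \<otimes> c"
proof -
  note reg = regular_sequenceD[OF assms]
  show nzd: "a = \<zero>" if "a \<in> carrier R" "f [^] n \<otimes> a = \<zero>" for a and n :: nat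
    using that
  proof (induction n arbitrary: a)
    case (Suc n)
    have "f [^] n \<otimes> (f \<otimes> a) = \<zero>" using Suc.prems reg(1) by (simp add: m_assoc)
    then have "f \<otimes> a = \<zero>" using Suc.IH[of "f \<otimes> a"] Suc.prems(1) reg(1) by blast
    then show ?case using Suc.prems(1) reg(3) by blast
  qed simp
  have one: "\<exists>c\<in>carrier R. a = f [^] n \<otimes> c"
    if "a \<in> carrier R" "b \<in> carrier R" "h \<otimes> a = f [^] n \<otimes> b" for a b and n :: nat
    using that
  proof (induction n arbitrary: a b)
    case (Suc n)
    have eq: "h \<otimes> a = f [^] n \<otimes> (f \<otimes> b)" using Suc.prems reg(1) by (simp add: m_assoc)
    then obtain c where c: "c \<in> carrier R" "a = f [^] n \<otimes> c"
      using Suc.IH[of a "f \<otimes> b"] Suc.prems(1,2) reg(1) by blast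
    have "f [^] n \<otimes> (h \<otimes> c) = f [^] n \<otimes> (f \<otimes> b)"
      using eq c reg(1,2) by (simp add: m_lcomm)
    then have "f [^] n \<otimes> (h \<otimes> c \<ominus> f \<otimes> b) = \<zero>"
      using c reg(1,2) Suc.prems(2) by (simp add: a_minus_def r_distr r_minus r_neg)
    then have "h \<otimes> c = f \<otimes> b"
      using nzd[of "h \<otimes> c \<ominus> f \<otimes> b" n] c reg(1,2) Suc.prems(2) by (simp add: minus_eq_zero_iff)
    then obtain c' where "c' \<in> carrier R" "c = f \<otimes> c'" using reg(4) c(1) Suc.prems(2) by blast
    moreover from this have "a = f [^] Suc n \<otimes> c'" using c reg(1) by (simp add: m_assoc)
    ultimately show ?case by blast
  qed auto
  show "\<exists>c\<in>carrier R. a = f [^] n \<otimes> c"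
    if "a \<in> carrier R" "b \<in> carrier R" "h [^] m \<otimes> a = f [^] n \<otimes> b" for a b and m n :: nat
    using that
  proof (induction m arbitrary: a b)
    case 0
    then show ?case by auto
  next
    case (Suc m)
    have "h \<otimes> (h [^] m \<otimes> a) = (h [^] m \<otimes> h) \<otimes> a"
      using reg(2) Suc.prems(1) by (simp add: m_ac)
    then have "h \<otimes> (h [^] m \<otimes> a) = f [^] n \<otimes> b" using Suc.prems(3) by simp
    then obtain c where c: "c \<in> carrier R" "h [^] m \<otimes> a = f [^] n \<otimes> c"
      using one[of "h [^] m \<otimes> a" b n] Suc.prems(1,2) reg(2) by auto
    then show ?case using Suc.IH[OF Suc.prems(1) c] by blast
  qed
qed

end

text \<open>Depth two kills local cohomology in degrees zero and one. A cocycle \<open>x\<close> of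
  degree one has a primitive \<open>y\<close> in \<open>E 0\<close>, and the point is to make it
  torsion: \<open>f^m y\<close> and \<open>h^n y\<close> come from ring elements \<open>u\<close>
  and \<open>v\<close> with \<open>h^n u = f^m v\<close>, so regularity makes \<open>u\<close>
  divisible by \<open>f^m\<close>.\<close>

lemma torsion_low_cohomology:
  assumes R: "cring R" and E: "injective_resolution R (self_module R) E d e"
    and reg: "regular_sequence R [f, h]" and S: "S \<subseteq> carrier R" "f \<in> S" "h \<in> S"
  shows "\<lbrakk>x \<in> carrier (element_torsion R S (E 0)); d 0 x = \<zero>\<^bsub>E 1\<^esub>\<rbrakk> \<Longrightarrow> x = \<zero>\<^bsub>E 0\<^esub>"
    and "\<lbrakk>x \<in> carrier (element_torsion R S (E 1)); d 1 x = \<zero>\<^bsub>E 2\<^esub>\<rbrakk> \<Longrightarrow>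
      x \<in> d 0 ` carrier (element_torsion R S (E 0))"
proof -
  interpret R: cring R by fact
  note r = injective_resolutionD[OF E]
  interpret E: cochain_complex R E d by (rule injective_resolution_complex[OF E])
  interpret E0: module R "E 0" by (rule r)
  have Sm: "module R (self_module R)" by (rule self_module_module[OF R])
  have f: "f \<in> carrier R" and h: "h \<in> carrier R" using S by auto
  have e_cl: "e a \<in> carrier (E 0)" if "a \<in> carrier R" for a using mod_homD(1)[OF r(4)] that by simp
  have e_smult: "e (b \<otimes>\<^bsub>R\<^esub> a) = b \<odot>\<^bsub>E 0\<^esub> e a" if "a \<in> carrier R" "b \<in> carrier R" for a b
    using mod_homD(3)[OF r(4), of b a] that by simp
  have e_inj: "a = b" if "e a = e b" "a \<in> carrier R" "b \<in> carrier R" for a b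
    using inj_onD[OF r(5) that(1)] that by simp
  have e0: "e \<zero>\<^bsub>R\<^esub> = \<zero>\<^bsub>E 0\<^esub>" using mod_hom_zero_minus(1)[OF r(4) Sm r(2)] by simp
  have ker: "\<exists>a\<in>carrier R. y = e a" if "y \<in> carrier (E 0)" "d 0 y = \<zero>\<^bsub>E (Suc 0)\<^esub>" for y
    using r(6) that by (auto simp: cocycles_def)
  have de: "d 0 (e a) = \<zero>\<^bsub>E (Suc 0)\<^esub>" if "a \<in> carrier R" for a
    using r(6) that by (auto simp: cocycles_def)
  show "x = \<zero>\<^bsub>E 0\<^esub>" if x: "x \<in> carrier (element_torsion R S (E 0))" "d 0 x = \<zero>\<^bsub>E 1\<^esub>"
  proof -
    obtain a where a: "a \<in> carrier R" "x = e a" using ker[of x] x by auto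
    obtain n where "f [^]\<^bsub>R\<^esub> (n::nat) \<odot>\<^bsub>E 0\<^esub> x = \<zero>\<^bsub>E 0\<^esub>" using x S(2) by auto
    then have "e (f [^]\<^bsub>R\<^esub> n \<otimes>\<^bsub>R\<^esub> a) = e \<zero>\<^bsub>R\<^esub>" using a f e0 by (simp add: e_smult)
    then have "f [^]\<^bsub>R\<^esub> n \<otimes>\<^bsub>R\<^esub> a = \<zero>\<^bsub>R\<^esub>" by (rule e_inj) (use a f in auto)
    then have "a = \<zero>\<^bsub>R\<^esub>" by (rule R.regular_sequence_powers(1)[OF reg a(1)])
    then show ?thesis using a e0 by simp
  qed
  show "x \<in> d 0 ` carrier (element_torsion R S (E 0))"
    if x: "x \<in> carrier (element_torsion R S (E 1))" "d 1 x = \<zero>\<^bsub>E 2\<^esub>"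
  proof -
    have "x \<in> cocycles E d (Suc 0)" using x by (simp add: cocycles_def numeral_2_eq_2)
    then obtain y where y: "y \<in> carrier (E 0)" "x = d 0 y" using r(7)[of 0] by auto
    have lift: "\<exists>u\<in>carrier R. b \<odot>\<^bsub>E 0\<^esub> y = e u" if "b \<in> carrier R" "b \<odot>\<^bsub>E (Suc 0)\<^esub> x = \<zero>\<^bsub>E (Suc 0)\<^esub>" for b
      using ker[of "b \<odot>\<^bsub>E 0\<^esub> y"] y that by (simp add: E.d_smult)
    obtain m n where m: "f [^]\<^bsub>R\<^esub> (m::nat) \<odot>\<^bsub>E (Suc 0)\<^esub> x = \<zero>\<^bsub>E (Suc 0)\<^esub>"
      and n: "h [^]\<^bsub>R\<^esub> (n::nat) \<odot>\<^bsub>E (Suc 0)\<^esub> x = \<zero>\<^bsub>E (Suc 0)\<^esub>"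
      using x(1) S(2,3) by (metis One_nat_def element_torsion_simps(1))
    let ?f = "f [^]\<^bsub>R\<^esub> m" and ?h = "h [^]\<^bsub>R\<^esub> n"
    have fh: "?f \<in> carrier R" "?h \<in> carrier R" using f h by auto
    obtain u where u: "u \<in> carrier R" "?f \<odot>\<^bsub>E 0\<^esub> y = e u" using lift[OF fh(1) m] by blast
    obtain v where v: "v \<in> carrier R" "?h \<odot>\<^bsub>E 0\<^esub> y = e v" using lift[OF fh(2) n] by blast
    have "e (?h \<otimes>\<^bsub>R\<^esub> u) = e (?f \<otimes>\<^bsub>R\<^esub> v)"
      using E0.smult_left_commute[OF fh y(1)] u v fh by (simp add: e_smult)
    then have "?h \<otimes>\<^bsub>R\<^esub> u = ?f \<otimes>\<^bsub>R\<^esub> v" by (rule e_inj) (use u v fh in auto)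
    then obtain w where w: "w \<in> carrier R" "u = ?f \<otimes>\<^bsub>R\<^esub> w"
      using R.regular_sequence_powers(2)[OF reg u(1) v(1)] by blast
    \<comment> \<open>Since \<open>f^m y = f^m e w\<close>, the element \<open>e w\<close> is the
      part of the primitive that comes from the ring; subtracting it does not alter the
      boundary.\<close>
    let ?y = "y \<ominus>\<^bsub>E 0\<^esub> e w"
    \<comment> \<open>Everything that kills \<open>x\<close> kills the corrected primitive, after
      cancelling the nonzerodivisor \<open>f^m\<close>. So the torsion conditions for all of
      \<open>S\<close> carry over, not only those for \<open>f\<close> and \<open>h\<close>.\<close>
    have kill: "b \<odot>\<^bsub>E 0\<^esub> ?y = \<zero>\<^bsub>E 0\<^esub>" if b: "b \<in> carrier R" "b \<odot>\<^bsub>E (Suc 0)\<^esub> x = \<zero>\<^bsub>E (Suc 0)\<^esub>" for b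
    proof -
      obtain t where t: "t \<in> carrier R" "b \<odot>\<^bsub>E 0\<^esub> y = e t" using lift[OF b] by blast
      have "e (?f \<otimes>\<^bsub>R\<^esub> t) = e (b \<otimes>\<^bsub>R\<^esub> u)"
        using E0.smult_left_commute[OF fh(1) b(1) y(1)] u t fh b by (simp add: e_smult)
      then have "?f \<otimes>\<^bsub>R\<^esub> t = b \<otimes>\<^bsub>R\<^esub> u" by (rule e_inj) (use u t b fh in auto)
      then have "?f \<otimes>\<^bsub>R\<^esub> t = ?f \<otimes>\<^bsub>R\<^esub> (b \<otimes>\<^bsub>R\<^esub> w)"
        unfolding w(2) using b w fh by (simp add: R.m_lcomm)
      then have "?f \<otimes>\<^bsub>R\<^esub> (t \<ominus>\<^bsub>R\<^esub> b \<otimes>\<^bsub>R\<^esub> w) = \<zero>\<^bsub>R\<^esub>"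
        using fh t b w by (simp add: a_minus_def R.r_distr R.r_minus R.r_neg)
      then have "t \<ominus>\<^bsub>R\<^esub> b \<otimes>\<^bsub>R\<^esub> w = \<zero>\<^bsub>R\<^esub>"
        by (rule R.regular_sequence_powers(1)[OF reg, rotated]) (use t b w in simp)
      then have "t = b \<otimes>\<^bsub>R\<^esub> w" using t b w by (simp add: R.minus_eq_zero_iff)
      then show ?thesis
        using b y w t e_cl by (simp add: E0.smult_minus_distr e_smult E0.minus_eq_zero_iff)
    qed
    have "?y \<in> carrier (element_torsion R S (E 0))"
      unfolding element_torsion_simps
    proof (intro conjI ballI)
      fix a assume a: "a \<in> S"
      obtain k where k: "a [^]\<^bsub>R\<^esub> (k::nat) \<odot>\<^bsub>E (Suc 0)\<^esub> x = \<zero>\<^bsub>E (Suc 0)\<^esub>" using x a by auto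
      have "a [^]\<^bsub>R\<^esub> k \<in> carrier R" using a S(1) by auto
      then show "\<exists>k::nat. a [^]\<^bsub>R\<^esub> k \<odot>\<^bsub>E 0\<^esub> ?y = \<zero>\<^bsub>E 0\<^esub>" using kill k by blast
    qed (use y e_cl[OF w(1)] in simp)
    moreover have "d 0 ?y = x" using y e_cl[OF w(1)] de[OF w(1)] by (simp add: E.d_minus)
    ultimately show ?thesis by blast
  qed
qed

section \<open>Comparison of Koszul complexes\<close>

lemma quasi_iso_exact_iff:
  assumes "quasi_iso R C d D d' \<phi>"
  shows "exact_from_three C d \<longleftrightarrow> exact_from_three D d'"
  using quasi_iso.exact_reflect[OF assms] quasi_iso.exact_preserve[OF assms] by blast

text \<open>A direct quasi-isomorphism between \<open>C\<close> and the stalk of its cohomology need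
  not exist; the truncation maps to both, and Koszul complexes preserve the two
  quasi-isomorphisms.\<close>

lemma syzygy_conditions_iff_exact:
  assumes C: "cochain_complex R C d"
    and "\<And>x. \<lbrakk>x \<in> carrier (C 0); d 0 x = \<zero>\<^bsub>C 1\<^esub>\<rbrakk> \<Longrightarrow> x = \<zero>\<^bsub>C 0\<^esub>"
    and "\<And>x. \<lbrakk>x \<in> carrier (C 1); d 1 x = \<zero>\<^bsub>C 2\<^esub>\<rbrakk> \<Longrightarrow> x \<in> d 0 ` carrier (C 0)"
    and "\<And>i x. \<lbrakk>2 \<le> i; x \<in> carrier (C (Suc i)); d (Suc i) x = \<zero>\<^bsub>C (Suc (Suc i))\<^esub>\<rbrakk> \<Longrightarrow> x \<in> d i ` carrier (C i)"
    and M: "M = cohomology C d 2" and fgh: "f \<in> carrier R" "g \<in> carrier R" "h \<in> carrier R"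
  shows "syzygy_conditions f g h M \<longleftrightarrow> exact_from_three (koszul [f, g, h] (leaves (pad C)))
    (koszul_diff [f, g, h] (leaves (pad C)) (leaf_diff (pad_diff C d)))"
proof -
  have fgh': "set [f, g, h] \<subseteq> carrier R" using fgh by simp
  have "module R M" unfolding M numeral_2_eq_2 by (rule cohomology_module[OF C])
  note iff = exact_koszul_stalk_iff[OF this fgh]
  show ?thesis
    using iff quasi_iso_exact_iff[OF koszul_quasi_iso[OF leaves_quasi_iso[OF cohomology_quasi_iso[OF assms(1-3) M]] fgh']]
      quasi_iso_exact_iff[OF koszul_quasi_iso[OF leaves_quasi_iso[OF truncation_quasi_iso[OF assms(1,4)]] fgh']]
    by blast
qed

lemma exact_from_three_trivial:
  assumes "cochain_complex R C d" and "\<And>i. 3 \<le> i \<Longrightarrow> carrier (C i) = {\<zero>\<^bsub>C i\<^esub>}"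
  shows "exact_from_three C d"
  unfolding exact_from_three_def
proof (intro allI impI ballI)
  interpret C: cochain_complex R C d by fact
  fix i x assume "2 \<le> i" "x \<in> carrier (C (Suc i))"
  then have "x = d i \<zero>\<^bsub>C i\<^esub>" using assms(2)[of "Suc i"] by simp
  then show "x \<in> d i ` carrier (C i)" by blast
qed

text \<open>The complex is quasi-isomorphic to the Koszul complex of \<open>R\<close>, which ends at index two.\<close>

lemma koszul_exact_of_torsion:
  assumes R: "cring R" "noetherian_ring R" and E: "injective_resolution R (self_module R) E d e"
    and bs: "set bs \<subseteq> carrier R"
  shows "exact_from_three (koszul bs (leaves (pad (\<lambda>i. element_torsion R (set bs) (E i)))))
    (koszul_diff bs (leaves (pad (\<lambda>i. element_torsion R (set bs) (E i)))) (leaf_diff (pad_diff E d)))"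
proof -
  have S: "cochain_complex R (stalk 2 (self_module R)) (\<lambda>_ _. \<zero>\<^bsub>self_module R\<^esub>)"
    by (intro stalk_complex self_module_module R)
  have "exact_from_three (koszul bs (leaves (stalk 2 (self_module R))))
      (koszul_diff bs (leaves (stalk 2 (self_module R))) (leaf_diff (\<lambda>_ _. \<zero>\<^bsub>self_module R\<^esub>)))"
    by (rule exact_from_three_trivial[OF koszul_complex[OF leaves_complex[OF S] bs] koszul_trivial[of 3]]) auto
  then show ?thesis
    using quasi_iso_exact_iff[OF koszul_quasi_iso[OF leaves_quasi_iso[OF resolution_quasi_iso[OF R(1) E]] bs]]
      quasi_iso_exact_iff[OF koszul_torsion_quasi_iso[OF R E bs order_refl]] by blast
qed

lemma (in chain_map) map_cocycle:
  "\<lbrakk>x \<in> carrier (C i); d i x = \<zero>\<^bsub>C (Suc i)\<^esub>\<rbrakk> \<Longrightarrow> d' i (\<phi> i x) = \<zero>\<^bsub>D (Suc i)\<^esub>"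
  using map_d[of x i] by simp

lemma element_torsion_inclusion:
  assumes E: "cochain_complex R E d" and S: "S \<subseteq> carrier R"
  shows "chain_map R (pad (\<lambda>i. element_torsion R S (E i))) (pad_diff E d) (pad E) (pad_diff E d) (\<lambda>i x. x)"
proof (rule chain_map_inclusion)
  have "pad_diff (\<lambda>i. element_torsion R S (E i)) d = pad_diff E d" by (rule pad_diff_cong) simp
  then show "cochain_complex R (pad (\<lambda>i. element_torsion R S (E i))) (pad_diff E d)"
    using pad_complex[OF element_torsion_complex[OF E S]] by simp
  show "cochain_complex R (pad E) (pad_diff E d)" by (rule pad_complex[OF E])
  fix i
  show "carrier (pad (\<lambda>i. element_torsion R S (E i)) i) \<subseteq> carrier (pad E i)"
    by (cases i rule: pad_cases) auto
  fix x y b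
  show "x \<oplus>\<^bsub>pad (\<lambda>i. element_torsion R S (E i)) i\<^esub> y = x \<oplus>\<^bsub>pad E i\<^esub> y"
    by (cases i rule: pad_cases) simp_all
  show "b \<odot>\<^bsub>pad (\<lambda>i. element_torsion R S (E i)) i\<^esub> x = b \<odot>\<^bsub>pad E i\<^esub> x"
    by (cases i rule: pad_cases) simp_all
qed

text \<open>If the Koszul complex on \<open>J\<close> of the derived torsion has no cohomology above the top degree of
  the Koszul complex of the ring, adjoining further generators \<open>bs\<close> up to \<open>I\<close> keeps the top cohomology
  surjective; so the unit of \<open>R / I\<close>, the top cohomology on \<open>bs @ J\<close>, comes from a torsion class in
  \<open>R / (J)\<close>.\<close>

lemma torsion_lift_of_one:
  assumes R: "cring R" "noetherian_ring R" and E: "injective_resolution R (self_module R) E d e"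
    and bs: "set bs \<subseteq> carrier R" and J: "set J \<subseteq> carrier R"
    and ex: "exact_from_three (koszul J (leaves (pad (\<lambda>i. element_torsion R (set (bs @ J)) (E i)))))
      (koszul_diff J (leaves (pad (\<lambda>i. element_torsion R (set (bs @ J)) (E i)))) (leaf_diff (pad_diff E d)))"
  shows "\<exists>r\<in>carrier R. \<one>\<^bsub>R\<^esub> \<ominus>\<^bsub>R\<^esub> r \<in> genideal R (set (bs @ J)) \<and>
    (\<forall>a\<in>set (bs @ J). \<exists>n::nat. a [^]\<^bsub>R\<^esub> n \<otimes>\<^bsub>R\<^esub> r \<in> genideal R (set J))"
proof -
  let ?as = "bs @ J"
  let ?A = "leaves (stalk 2 (self_module R))" and ?dA = "leaf_diff (\<lambda>_ _. \<zero>\<^bsub>self_module R\<^esub>)"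
  let ?E = "leaves (pad E)" and ?d = "leaf_diff (pad_diff E d)"
  let ?C = "leaves (pad (\<lambda>i. element_torsion R (set ?as) (E i)))"
  let ?e = "leaf_diff (\<lambda>i x. if i = 2 then e x else \<zero>\<^bsub>pad E i\<^esub>)"
  let ?i = "leaf_diff (\<lambda>i x. x)"
  interpret R: cring R by fact
  have as: "set ?as \<subseteq> carrier R" using bs J by simp
  note qe = leaves_quasi_iso[OF resolution_quasi_iso[OF R(1) E]]
  have Ec: "cochain_complex R E d" by (rule injective_resolution_complex[OF E])
  have Sm: "module R (self_module R)" by (rule self_module_module[OF R(1)])
  have Ac: "cochain_complex R ?A ?dA" by (intro leaves_complex stalk_complex Sm)
  have Ecp: "cochain_complex R ?E ?d" by (intro leaves_complex pad_complex Ec)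
  have "pad_diff (\<lambda>i. element_torsion R (set ?as) (E i)) d = pad_diff E d" by (rule pad_diff_cong) simp
  then have Cc: "cochain_complex R ?C ?d"
    using leaves_complex[OF pad_complex[OF element_torsion_complex[OF Ec as]]] by simp
  have "chain_map R (pad (\<lambda>i. element_torsion R (set ?as) (E i))) (pad_diff E d) (pad E) (pad_diff E d) (\<lambda>i x. x)"
    by (rule element_torsion_inclusion[OF Ec as])
  then have im: "chain_map R ?C ?d ?E ?d ?i" by (rule leaves_chain_map)

  interpret eJ: quasi_iso R "koszul J ?A" "koszul_diff J ?A ?dA" "koszul J ?E" "koszul_diff J ?E ?d" "koszul_map J ?e"
    by (rule koszul_quasi_iso[OF qe J])
  interpret ea: quasi_iso R "koszul ?as ?A" "koszul_diff ?as ?A ?dA" "koszul ?as ?E" "koszul_diff ?as ?E ?d" "koszul_map ?as ?e"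
    by (rule koszul_quasi_iso[OF qe as])
  interpret iJ: chain_map R "koszul J ?C" "koszul_diff J ?C ?d" "koszul J ?E" "koszul_diff J ?E ?d" "koszul_map J ?i"
    by (rule koszul_chain_map[OF im J])
  interpret ia: quasi_iso R "koszul ?as ?C" "koszul_diff ?as ?C ?d" "koszul ?as ?E" "koszul_diff ?as ?E ?d" "koszul_map ?as ?i"
    by (rule koszul_torsion_quasi_iso[OF R E as order_refl])
  have two: "Suc (Suc 0) = 2" "Suc 0 = 1" "Suc 1 = 2" "Suc 2 = (3::nat)" by simp_all

  let ?top = "\<lambda>r. koszul_top ?as ?A (Leaf r)" and ?topJ = "\<lambda>r. koszul_top J ?A (Leaf r)"
  have topA: "?top r \<in> carrier (koszul ?as ?A 2)" if "r \<in> carrier R" for r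
    using mod_homD(1)[OF koszul_top_hom[OF Ac as]] that by simp
  have topJ: "?topJ r \<in> carrier (koszul J ?A 2)" if "r \<in> carrier R" for r
    using mod_homD(1)[OF koszul_top_hom[OF Ac J]] that by simp
  have trivA: "carrier (koszul xs ?A 3) = {\<zero>\<^bsub>koszul xs ?A 3\<^esub>}" for xs
    by (rule koszul_trivial[of 3]) auto

  \<comment> \<open>The top class of one on the full list, transported from the ring to the
    resolution.\<close>
  define u where "u = koszul_map ?as ?e 2 (?top \<one>\<^bsub>R\<^esub>)"
  have u: "u \<in> carrier (koszul ?as ?E 2)" unfolding u_def by (rule ea.map_closed[OF topA]) simp
  have "koszul_diff ?as ?A ?dA 2 (?top \<one>\<^bsub>R\<^esub>) = \<zero>\<^bsub>koszul ?as ?A 3\<^esub>"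
    using ea.C.d_closed[OF topA[OF R.one_closed]] trivA unfolding two by blast
  then have du: "koszul_diff ?as ?E ?d 2 u = \<zero>\<^bsub>koszul ?as ?E 3\<^esub>"
    unfolding u_def by (rule ea.map_cocycle[OF topA[OF R.one_closed], unfolded two])
  \<comment> \<open>On the full list the torsion subcomplex has the same cohomology as the
    resolution, so the class has a torsion representative \<open>c\<close>.\<close>
  obtain c v where c: "c \<in> carrier (koszul ?as ?C 2)" "koszul_diff ?as ?C ?d 2 c = \<zero>\<^bsub>koszul ?as ?C 3\<^esub>"
    and v: "v \<in> carrier (koszul ?as ?E 1)"
    and u_eq: "u = koszul_map ?as ?i 2 c \<oplus>\<^bsub>koszul ?as ?E 2\<^esub> koszul_diff ?as ?E ?d 1 v"
    using ia.surj[of u 1, unfolded two, OF u du] by blast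
  \<comment> \<open>The hypothesis \<open>ex\<close> enters here: up to a boundary, \<open>c\<close>
    comes from a torsion cocycle \<open>c'\<close> on \<open>J\<close> alone.\<close>
  obtain c' w where c': "c' \<in> carrier (koszul J ?C 2)" "koszul_diff J ?C ?d 2 c' = \<zero>\<^bsub>koszul J ?C 3\<^esub>"
    and w: "w \<in> carrier (koszul ?as ?C 1)"
    and c_eq: "c = koszul_top bs (koszul J ?C) c' \<oplus>\<^bsub>koszul ?as ?C 2\<^esub> koszul_diff ?as ?C ?d 1 w"
    using koszul_cocycle[OF koszul_complex[OF Cc J] bs ex c[unfolded koszul_append koszul_diff_append]]
    unfolding koszul_append koszul_diff_append by blast
  define c'' where "c'' = koszul_map J ?i 2 c'"
  have c'': "c'' \<in> carrier (koszul J ?E 2)" unfolding c''_def by (rule iJ.map_closed[OF c'(1)])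
  have dc'': "koszul_diff J ?E ?d 2 c'' = \<zero>\<^bsub>koszul J ?E 3\<^esub>"
    unfolding c''_def by (rule iJ.map_cocycle[OF c'(1), unfolded two, OF c'(2)])
  \<comment> \<open>On \<open>J\<close> alone the torsion inclusion need not be a quasi-isomorphism,
    but the map from the ring to the resolution still is; it turns the image of \<open>c'\<close>
    into a class of the ring.\<close>
  obtain x w' where x: "x \<in> carrier (koszul J ?A 2)" and w': "w' \<in> carrier (koszul J ?E 1)"
    and c''_eq: "c'' = koszul_map J ?e 2 x \<oplus>\<^bsub>koszul J ?E 2\<^esub> koszul_diff J ?E ?d 1 w'"
    using eJ.surj[of c'' 1, unfolded two, OF c'' dc''] by blast
  have "carrier (koszul J ?A 2) = koszul_top J ?A ` carrier (?A 2)"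
    by (rule koszul_top_is_all[OF Ac J]) auto
  then obtain r where r: "r \<in> carrier R" and x_eq: "x = ?topJ r" using x by auto
  obtain w'' where w'': "w'' \<in> carrier (koszul ?as ?E 1)"
    and w''_eq: "koszul_top bs (koszul J ?E) (koszul_diff J ?E ?d 1 w') = koszul_diff ?as ?E ?d 1 w''"
    using koszul_top_boundary[OF koszul_complex[OF Ecp J] bs w'] unfolding koszul_append koszul_diff_append by blast

  note topbsE = koszul_top_hom[OF koszul_complex[OF Ecp J] bs]
  have dcl: "koszul_diff xs ?E ?d 1 t \<in> carrier (koszul xs ?E 2)"
    if "t \<in> carrier (koszul xs ?E 1)" "set xs \<subseteq> carrier R" for xs t
    using cochain_complex.d_closed[OF koszul_complex[OF Ecp that(2)] that(1)] unfolding two .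
  have eJx: "koszul_map J ?e 2 x \<in> carrier (koszul J ?E 2)" by (rule eJ.map_closed[OF x])
  have "koszul_map ?as ?i 2 (koszul_top bs (koszul J ?C) c') = koszul_top bs (koszul J ?E) c''"
    unfolding c''_def koszul_map_append by (rule koszul_top_map[OF iJ.chain_map_axioms bs])
  also have "\<dots> = koszul_top bs (koszul J ?E) (koszul_map J ?e 2 x) \<oplus>\<^bsub>koszul ?as ?E 2\<^esub> koszul_diff ?as ?E ?d 1 w''"
    unfolding c''_eq w''_eq[symmetric] koszul_append by (rule mod_homD(2)[OF topbsE eJx dcl[OF w' J]])
  also have "koszul_top bs (koszul J ?E) (koszul_map J ?e 2 x) = koszul_map ?as ?e 2 (?top r)"
    unfolding x_eq koszul_map_append koszul_top_append
    by (rule koszul_top_map[OF eJ.chain_map_axioms bs, symmetric])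
  finally have ic': "koszul_map ?as ?i 2 (koszul_top bs (koszul J ?C) c') =
      koszul_map ?as ?e 2 (?top r) \<oplus>\<^bsub>koszul ?as ?E 2\<^esub> koszul_diff ?as ?E ?d 1 w''" .
  have topC: "koszul_top bs (koszul J ?C) c' \<in> carrier (koszul ?as ?C 2)"
    using mod_homD(1)[OF koszul_top_hom[OF koszul_complex[OF Cc J] bs] c'(1)] unfolding koszul_append .
  have dw: "koszul_diff ?as ?C ?d 1 w \<in> carrier (koszul ?as ?C 2)"
    using ia.C.d_closed[OF w] unfolding two .
  have iw: "koszul_map ?as ?i 2 (koszul_diff ?as ?C ?d 1 w) = koszul_diff ?as ?E ?d 1 (koszul_map ?as ?i 1 w)"
    using ia.map_d[OF w] unfolding two .
  have iw1: "koszul_map ?as ?i 1 w \<in> carrier (koszul ?as ?E 1)" by (rule ia.map_closed[OF w])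
  have er: "koszul_map ?as ?e 2 (?top r) \<in> carrier (koszul ?as ?E 2)" by (rule ea.map_closed[OF topA[OF r]])
  interpret K: module R "koszul ?as ?E 2" by (rule ea.D.module_C)
  have dadd: "koszul_diff ?as ?E ?d 1 (s \<oplus>\<^bsub>koszul ?as ?E 1\<^esub> t) =
      koszul_diff ?as ?E ?d 1 s \<oplus>\<^bsub>koszul ?as ?E 2\<^esub> koszul_diff ?as ?E ?d 1 t"
    if "s \<in> carrier (koszul ?as ?E 1)" "t \<in> carrier (koszul ?as ?E 1)" for s t
    using ea.D.d_add[OF that] unfolding two .
  \<comment> \<open>The sum of the three primitives: \<open>v\<close> from replacing
    \<open>u\<close> by \<open>c\<close>, \<open>w\<close> from replacing \<open>c\<close> by
    \<open>c'\<close>, and \<open>w''\<close> from replacing the image of \<open>c'\<close> by the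
    class of \<open>r\<close>.\<close>
  define z where "z = w'' \<oplus>\<^bsub>koszul ?as ?E 1\<^esub> (koszul_map ?as ?i 1 w \<oplus>\<^bsub>koszul ?as ?E 1\<^esub> v)"
  have z: "z \<in> carrier (koszul ?as ?E 1)" unfolding z_def
    by (intro ea.D.C_closed w'' iw1 v)
  have dz: "koszul_diff ?as ?E ?d 1 z = koszul_diff ?as ?E ?d 1 w'' \<oplus>\<^bsub>koszul ?as ?E 2\<^esub>
      (koszul_diff ?as ?E ?d 1 (koszul_map ?as ?i 1 w) \<oplus>\<^bsub>koszul ?as ?E 2\<^esub> koszul_diff ?as ?E ?d 1 v)"
    unfolding z_def using dadd ea.D.C_closed(2)[OF iw1 v] w'' iw1 v by metis
  have "u = (koszul_map ?as ?e 2 (?top r) \<oplus>\<^bsub>koszul ?as ?E 2\<^esub> koszul_diff ?as ?E ?d 1 w'') \<oplus>\<^bsub>koszul ?as ?E 2\<^esub>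
      koszul_diff ?as ?E ?d 1 (koszul_map ?as ?i 1 w) \<oplus>\<^bsub>koszul ?as ?E 2\<^esub> koszul_diff ?as ?E ?d 1 v"
    unfolding u_eq c_eq ia.map_add[OF topC dw] ic' iw ..
  also have "\<dots> = koszul_map ?as ?e 2 (?top r) \<oplus>\<^bsub>koszul ?as ?E 2\<^esub> koszul_diff ?as ?E ?d 1 z"
    unfolding dz by (simp only: K.a_assoc er dcl[OF _ as] w'' iw1 v K.a_closed)
  finally have u_final: "u = koszul_map ?as ?e 2 (?top r) \<oplus>\<^bsub>koszul ?as ?E 2\<^esub> koszul_diff ?as ?E ?d 1 z" .

  have leaf_minus: "Leaf \<one>\<^bsub>R\<^esub> \<ominus>\<^bsub>?A 2\<^esub> Leaf r = Leaf (\<one>\<^bsub>R\<^esub> \<ominus>\<^bsub>self_module R\<^esub> r)"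
    using leaf_module_minus[OF Sm, of "\<one>\<^bsub>R\<^esub>" r] r by (simp add: stalk_def)
  interpret S: module R "self_module R" by (rule Sm)
  have neg: "\<ominus>\<^bsub>self_module R\<^esub> r = \<ominus>\<^bsub>R\<^esub> r"
    by (rule S.minus_equality) (use r in \<open>auto simp: R.l_neg\<close>)
  have sm: "\<one>\<^bsub>R\<^esub> \<ominus>\<^bsub>self_module R\<^esub> r = \<one>\<^bsub>R\<^esub> \<ominus>\<^bsub>R\<^esub> r" by (simp add: a_minus_def neg)
  have rm: "\<one>\<^bsub>R\<^esub> \<ominus>\<^bsub>R\<^esub> r \<in> carrier R" using r by simp
  have "?top (\<one>\<^bsub>R\<^esub> \<ominus>\<^bsub>R\<^esub> r) = ?top \<one>\<^bsub>R\<^esub> \<ominus>\<^bsub>koszul ?as ?A 2\<^esub> ?top r"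
    unfolding sm[symmetric] leaf_minus[symmetric]
    by (rule mod_hom_zero_minus(3)[OF koszul_top_hom[OF Ac as] cochain_complex.module_C[OF Ac] ea.C.module_C])
      (use r in simp_all)
  then have "koszul_map ?as ?e 2 (?top (\<one>\<^bsub>R\<^esub> \<ominus>\<^bsub>R\<^esub> r)) = u \<ominus>\<^bsub>koszul ?as ?E 2\<^esub> koszul_map ?as ?e 2 (?top r)"
    unfolding u_def using ea.map_minus[OF topA[OF R.one_closed] topA[OF r]] by simp
  also have "\<dots> = koszul_diff ?as ?E ?d 1 z"
    using K.eq_add_iff_minus_eq[OF u er dcl[OF z as]] u_final by blast
  finally have "koszul_map ?as ?e 2 (?top (\<one>\<^bsub>R\<^esub> \<ominus>\<^bsub>R\<^esub> r)) \<in> koszul_diff ?as ?E ?d 1 ` carrier (koszul ?as ?E 1)"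
    using z by blast
  moreover have cocycle: "koszul_diff xs ?A ?dA 2 t = \<zero>\<^bsub>koszul xs ?A 3\<^esub>"
    if "t \<in> carrier (koszul xs ?A 2)" "set xs \<subseteq> carrier R" for xs t
    using cochain_complex.d_closed[OF koszul_complex[OF Ac that(2)] that(1)] trivA unfolding two by blast
  \<comment> \<open>Injectivity on cohomology brings the comparison back to the ring, where top
    boundaries are combinations of the list.\<close>
  ultimately have one_b: "?top (\<one>\<^bsub>R\<^esub> \<ominus>\<^bsub>R\<^esub> r) \<in> koszul_diff ?as ?A ?dA 1 ` carrier (koszul ?as ?A 1)"
    using ea.inj[of "?top (\<one>\<^bsub>R\<^esub> \<ominus>\<^bsub>R\<^esub> r)" 0, unfolded two] topA[OF rm] as by blast

  have boundary: "s \<in> genideal R (set xs)"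
    if xs: "set xs \<subseteq> carrier R" and s: "s \<in> carrier R"
      and b: "koszul_top xs ?A (Leaf s) \<in> koszul_diff xs ?A ?dA 1 ` carrier (koszul xs ?A 1)" for s xs
  proof -
    interpret G: ideal "genideal R (set xs)" R by (rule R.genideal_ideal[OF xs])
    interpret L: module R "leaf_module (self_module R)" by (rule leaf_module_module[OF Sm])
    have Lneg: "\<ominus>\<^bsub>leaf_module (self_module R)\<^esub> Leaf t = Leaf (\<ominus>\<^bsub>R\<^esub> t)" if "t \<in> carrier R" for t
      by (rule L.minus_equality) (use that in \<open>auto simp: R.l_neg\<close>)
    have "submodule (Leaf ` genideal R (set xs)) R (leaf_module (self_module R))"
      by (rule L.submoduleI) (auto simp: Lneg G.Icarr G.I_l_closed)
    then have H: "submodule (Leaf ` genideal R (set xs)) R (?A 2)" by (simp add: stalk_def)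
    have "Leaf s \<in> Leaf ` genideal R (set xs)"
    proof (rule koszul_top_boundaryD[OF Ac xs _ _ H _ _ b])
      fix b y assume "b \<in> set xs" "y \<in> carrier (?A 2)"
      then show "b \<odot>\<^bsub>?A 2\<^esub> y \<in> Leaf ` genideal R (set xs)"
        using R.genideal_self[OF xs] G.I_r_closed by auto
    qed (use s in auto)
    then show ?thesis by blast
  qed
  have "\<one>\<^bsub>R\<^esub> \<ominus>\<^bsub>R\<^esub> r \<in> genideal R (set ?as)" by (rule boundary[OF as rm one_b])
  moreover have "\<exists>n::nat. a [^]\<^bsub>R\<^esub> n \<otimes>\<^bsub>R\<^esub> r \<in> genideal R (set J)" if a: "a \<in> set ?as" for a
  proof -
    have aR: "a \<in> carrier R" using a as by blast
    have "\<exists>n::nat. a [^]\<^bsub>R\<^esub> n \<odot>\<^bsub>?C i\<^esub> t = \<zero>\<^bsub>?C i\<^esub>" if "t \<in> carrier (?C i)" for t i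
    proof (cases i rule: pad_cases)
      case (3 j)
      then show ?thesis using that a by auto
    qed (use that aR cochain_complex.C_neutral(4)[OF Ec] in auto)
    \<comment> \<open>The cochain \<open>c'\<close> itself, not only its class, is killed by a power
      of \<open>a\<close>; seen in the ring, this says that the same power takes \<open>r\<close>
      into the ideal of \<open>J\<close>.\<close>
    then obtain n where n: "a [^]\<^bsub>R\<^esub> (n::nat) \<odot>\<^bsub>koszul J ?C 2\<^esub> c' = \<zero>\<^bsub>koszul J ?C 2\<^esub>"
      using koszul_torsion[OF Cc aR J _ c'(1)] by blast
    let ?b = "a [^]\<^bsub>R\<^esub> n"
    have b: "?b \<in> carrier R" using aR by simp
    interpret KJ: module R "koszul J ?E 2" by (rule eJ.D.module_C)
    have "?b \<odot>\<^bsub>koszul J ?E 2\<^esub> c'' = \<zero>\<^bsub>koszul J ?E 2\<^esub>"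
      unfolding c''_def iJ.map_smult[OF b c'(1), symmetric] n by (rule iJ.map_zero)
    moreover have "?b \<odot>\<^bsub>koszul J ?E 2\<^esub> c'' = koszul_map J ?e 2 (?b \<odot>\<^bsub>koszul J ?A 2\<^esub> x) \<oplus>\<^bsub>koszul J ?E 2\<^esub>
        koszul_diff J ?E ?d 1 (?b \<odot>\<^bsub>koszul J ?E 1\<^esub> w')"
      unfolding c''_eq eJ.map_smult[OF b x] eJ.D.d_smult[OF b w', unfolded two]
      by (rule KJ.smult_r_distr[OF b eJx dcl[OF w' J]])
    ultimately have sum0: "\<zero>\<^bsub>koszul J ?E 2\<^esub> = koszul_map J ?e 2 (?b \<odot>\<^bsub>koszul J ?A 2\<^esub> x) \<oplus>\<^bsub>koszul J ?E 2\<^esub>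
        koszul_diff J ?E ?d 1 (?b \<odot>\<^bsub>koszul J ?E 1\<^esub> w')" by metis
    have bx: "?b \<odot>\<^bsub>koszul J ?A 2\<^esub> x \<in> carrier (koszul J ?A 2)" by (rule eJ.C.C_closed(5)[OF b x])
    have bw: "?b \<odot>\<^bsub>koszul J ?E 1\<^esub> w' \<in> carrier (koszul J ?E 1)" by (rule eJ.D.C_closed(5)[OF b w'])
    have "koszul_map J ?e 2 (?b \<odot>\<^bsub>koszul J ?A 2\<^esub> x) = \<ominus>\<^bsub>koszul J ?E 2\<^esub> koszul_diff J ?E ?d 1 (?b \<odot>\<^bsub>koszul J ?E 1\<^esub> w')"
      using KJ.minus_equality[OF sum0[symmetric] dcl[OF bw J] eJ.map_closed[OF bx]] by simp
    also have "\<dots> = koszul_diff J ?E ?d 1 (\<ominus>\<^bsub>koszul J ?E 1\<^esub> (?b \<odot>\<^bsub>koszul J ?E 1\<^esub> w'))"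
      using eJ.D.d_uminus[OF bw, unfolded two] by simp
    finally have "koszul_map J ?e 2 (?b \<odot>\<^bsub>koszul J ?A 2\<^esub> x) \<in> koszul_diff J ?E ?d 1 ` carrier (koszul J ?E 1)"
      using eJ.D.C_closed(4)[OF bw] by blast
    then have "?b \<odot>\<^bsub>koszul J ?A 2\<^esub> x \<in> koszul_diff J ?A ?dA 1 ` carrier (koszul J ?A 1)"
      using eJ.inj[of "?b \<odot>\<^bsub>koszul J ?A 2\<^esub> x" 0, unfolded two] bx cocycle[OF bx J] by blast
    moreover have "?b \<odot>\<^bsub>koszul J ?A 2\<^esub> x = ?topJ (?b \<otimes>\<^bsub>R\<^esub> r)"
      using mod_homD(3)[OF koszul_top_hom[OF Ac J] b, of "Leaf r"] r by (simp add: x_eq)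
    ultimately have "?b \<otimes>\<^bsub>R\<^esub> r \<in> genideal R (set J)"
      using boundary[OF J, of "?b \<otimes>\<^bsub>R\<^esub> r"] b r by simp
    then show ?thesis by blast
  qed
  ultimately show ?thesis using r by blast
qed

section \<open>Local and graded rings\<close>

lemma colon_ideal:
  fixes R (structure)
  assumes "cring R" and J: "ideal J R" and r: "r \<in> carrier R"
  shows "ideal {s \<in> carrier R. s \<otimes>\<^bsub>R\<^esub> r \<in> J} R"
proof -
  interpret cring R by fact
  interpret J: ideal J R by fact
  show ?thesis
  proof (rule idealI)
    show "subgroup {s \<in> carrier R. s \<otimes> r \<in> J} (add_monoid R)"
      by (rule add.subgroupI) (use r in \<open>auto simp: l_distr l_minus a_inv_def[symmetric]\<close>)
  next
    fix s b assume "s \<in> {s \<in> carrier R. s \<otimes> r \<in> J}" and b: "b \<in> carrier R"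
    then have s: "s \<in> carrier R" "s \<otimes> r \<in> J" by auto
    have "(b \<otimes> s) \<otimes> r \<in> J" using J.I_l_closed[OF s(2) b] s b r by (simp add: m_assoc)
    then show "b \<otimes> s \<in> {s \<in> carrier R. s \<otimes> r \<in> J}" "s \<otimes> b \<in> {s \<in> carrier R. s \<otimes> r \<in> J}"
      using s b by (auto simp: m_comm)
  qed (rule ring_axioms)
qed

text \<open>The power of \<open>a + b\<close> annihilates the class of \<open>1\<close> in \<open>R / J\<close>, as powers of \<open>a\<close> and \<open>b\<close> do.\<close>

lemma radical_ideal:
  fixes R (structure)
  assumes "cring R" and J: "ideal J R"
  shows "ideal (radical R J) R"
proof -
  interpret cring R by fact
  interpret J: ideal J R by fact
  let ?N = "quotient_module (self_module R) J" and ?x = "J +>\<^bsub>self_module R\<^esub> \<one>"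
  note q = quotient_module[OF self_module_module[OF assms(1)] ideal_submodule[OF assms]]
  interpret N: module R ?N by (rule q(1))
  have x: "?x \<in> carrier ?N" using q(3) by auto
  have zero: "a \<odot>\<^bsub>?N\<^esub> ?x = \<zero>\<^bsub>?N\<^esub> \<longleftrightarrow> a \<in> J" if "a \<in> carrier R" for a
    using mod_homD(3)[OF q(2) that, of \<one>] q(4)[of a] that by simp
  have add: "a \<oplus> b \<in> radical R J" if "a \<in> radical R J" "b \<in> radical R J" for a b
  proof -
    have ab: "{a, b} \<subseteq> carrier R" using that by (auto simp: radical_def)
    have "\<exists>n::nat. c [^] n \<odot>\<^bsub>?N\<^esub> ?x = \<zero>\<^bsub>?N\<^esub>" if "c \<in> {a, b}" for c
      using that \<open>a \<in> radical R J\<close> \<open>b \<in> radical R J\<close> zero ab by (auto simp: radical_def)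
    then obtain n where n: "\<And>c. c \<in> {a, b} \<Longrightarrow> c [^] (n c :: nat) \<odot>\<^bsub>?N\<^esub> ?x = \<zero>\<^bsub>?N\<^esub>" by metis
    interpret G: ideal "genideal R {a, b}" R by (rule genideal_ideal[OF ab])
    have "a \<oplus> b \<in> genideal R {a, b}" using genideal_self[OF ab] by blast
    then have "(a \<oplus> b) [^] Suc (sum n {a, b}) \<odot>\<^bsub>?N\<^esub> ?x = \<zero>\<^bsub>?N\<^esub>"
      using ideal_power_annihilates[OF q(1) _ ab x n order_refl]
        nat_pow_in_ideal_power[OF q(1) G.is_ideal, of "a \<oplus> b" "Suc (sum n {a, b})"] by blast
    then have "(a \<oplus> b) [^] Suc (sum n {a, b}) \<in> J"
      using zero[of "(a \<oplus> b) [^] Suc (sum n {a, b})"] ab by (simp del: nat_pow_Suc)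
    then show ?thesis using ab unfolding radical_def by blast
  qed
  have mult: "b \<otimes> a \<in> radical R J" if rad: "a \<in> radical R J" and b: "b \<in> carrier R" for a b
  proof -
    obtain n where n: "a [^] (n::nat) \<in> J" and a: "a \<in> carrier R" using rad by (auto simp: radical_def)
    then have "(b \<otimes> a) [^] n \<in> J" using J.I_l_closed[OF n, of "b [^] n"] b by (simp add: nat_pow_distrib)
    then show ?thesis using b a unfolding radical_def by blast
  qed
  have sub: "radical R J \<subseteq> carrier R" by (auto simp: radical_def)
  have "\<zero> [^] (1::nat) \<in> J" by simp
  then have zr: "\<zero> \<in> radical R J" unfolding radical_def by blast
  show ?thesis
  proof (rule idealI)
    show "subgroup (radical R J) (add_monoid R)"
    proof (rule add.subgroupI)
      fix a assume a: "a \<in> radical R J"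
      then have "\<ominus> a = (\<ominus> \<one>) \<otimes> a" using sub by (auto simp: l_minus)
      then show "\<ominus> a \<in> radical R J" using mult[OF a, of "\<ominus> \<one>"] by simp
    qed (use sub zr add in auto)
    fix a b assume "a \<in> radical R J" "b \<in> carrier R"
    then show "b \<otimes> a \<in> radical R J" "a \<otimes> b \<in> radical R J"
      using mult sub by (auto simp: m_comm subset_iff)
  qed (rule ring_axioms)
qed

text \<open>In a Noetherian ring the union of a nonempty chain of ideals is a member of the chain,
  so it is proper when the members are.\<close>

lemma exists_maximalideal:
  fixes R (structure)
  assumes "noetherian_ring R" "ideal K R" "K \<noteq> carrier R"
  shows "\<exists>m. maximalideal m R \<and> K \<subseteq> m"
proof -
  interpret noetherian_ring R by fact
  let ?A = "{L. ideal L R \<and> K \<subseteq> L \<and> L \<noteq> carrier R}"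
  have "\<exists>M\<in>?A. \<forall>N\<in>?A. M \<subseteq> N \<longrightarrow> N = M"
  proof (rule subset_Zorn_nonempty)
    show "?A \<noteq> {}" using assms by blast
    fix \<Q> assume "\<Q> \<noteq> {}" and chain: "subset.chain ?A \<Q>"
    moreover from chain have "subset.chain {L. ideal L R} \<Q>" unfolding subset.chain_def by blast
    ultimately have "\<Union>\<Q> \<in> \<Q>" using ideal_chain_is_trivial by blast
    then show "\<Union>\<Q> \<in> ?A" using chain unfolding subset.chain_def by blast
  qed
  then obtain M where "M \<in> ?A" and max: "\<forall>N\<in>?A. M \<subseteq> N \<longrightarrow> N = M" by (rule bexE)
  then have M: "ideal M R" "K \<subseteq> M" "M \<noteq> carrier R" by auto
  have "maximalideal M R"
  proof (rule maximalidealI)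
    fix L assume L: "ideal L R" "M \<subseteq> L"
    show "L = M \<or> L = carrier R"
    proof (cases "L = carrier R")
      case False
      then have "L \<in> ?A" using L M(2) by auto
      then show ?thesis using max L(2) by blast
    qed simp
  qed (use M in auto)
  then show ?thesis using M by blast
qed

text \<open>A nonunit \<open>r\<close> and the proper ideal \<open>I\<close> would lie in the same
  maximal ideal, and with them \<open>q + r = 1\<close>. The hypothesis is a sum rather than a
  difference because subtraction in the degree zero subring refers to a smaller carrier.\<close>

lemma local_ring_unit:
  fixes R (structure)
  assumes loc: "noetherian_local_ring R" and I: "ideal I R" "\<one>\<^bsub>R\<^esub> \<notin> I"
    and r: "r \<in> carrier R" and q: "q \<in> I" "q \<oplus>\<^bsub>R\<^esub> r = \<one>\<^bsub>R\<^esub>"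
  shows "\<exists>s\<in>carrier R. s \<otimes>\<^bsub>R\<^esub> r = \<one>\<^bsub>R\<^esub>"
proof (rule ccontr)
  assume no: "\<not> ?thesis"
  have R: "cring R" "noetherian_ring R" and uniq: "\<exists>!m. maximalideal m R"
    using loc by (auto simp: noetherian_local_ring_def)
  interpret cring R by fact
  obtain m where m: "maximalideal m R" "I \<subseteq> m"
    using exists_maximalideal[OF R(2) I(1)] I(2) by auto
  have "ideal (PIdl r) R" by (rule cgenideal_ideal[OF r])
  moreover have "\<one> \<notin> PIdl r" using no by (auto simp: cgenideal_def)
  ultimately obtain m' where m': "maximalideal m' R" "PIdl r \<subseteq> m'"
    using exists_maximalideal[OF R(2)] by (metis one_closed)
  have "m' = m" using uniq m m' by blast
  then have "r \<in> m" using m' cgenideal_self[OF r] by blast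
  interpret M: maximalideal m R by (rule m)
  have "\<one> \<in> m" using q m(2) \<open>r \<in> m\<close> M.a_closed by (metis subsetD)
  then show False using M.one_imp_carrier M.I_notcarr by simp
qed

section \<open>Homogeneous components in a graded ring\<close>

context
  fixes R (structure) and A :: "nat \<Rightarrow> 'a set"
  assumes graded: "graded_ring R A"
begin

interpretation cring R using graded by (simp add: graded_ring_def)

lemma graded_subgroup: "additive_subgroup (A i) R"
  using graded by (simp add: graded_ring_def)

lemma graded_closed: "a \<in> A i \<Longrightarrow> a \<in> carrier R"
  using additive_subgroup.a_subset[OF graded_subgroup] by blast

lemma graded_zero: "\<zero> \<in> A i"
  by (rule additive_subgroup.zero_closed[OF graded_subgroup])

lemma graded_add: "\<lbrakk>a \<in> A i; b \<in> A i\<rbrakk> \<Longrightarrow> a \<oplus> b \<in> A i"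
  by (rule additive_subgroup.a_closed[OF graded_subgroup])

lemma graded_mult: "\<lbrakk>a \<in> A i; b \<in> A j\<rbrakk> \<Longrightarrow> a \<otimes> b \<in> A (i + j)"
  using graded by (simp add: graded_ring_def)

lemma graded_one: "\<one> \<in> A 0"
  using graded by (simp add: graded_ring_def)

lemma graded_pow: "a \<in> A j \<Longrightarrow> a [^] (n::nat) \<in> A (n * j)"
proof (induction n)
  case (Suc n)
  then show ?case using graded_mult[of "a [^] n" "n * j" a j] by (simp add: add.commute)
qed (simp add: graded_one)

definition decomposition :: "'a \<Rightarrow> (nat \<Rightarrow> 'a) \<Rightarrow> bool" where
  "decomposition x c \<longleftrightarrow> (\<forall>i. c i \<in> A i) \<and> finite {i. c i \<noteq> \<zero>} \<and> x = finsum R c {i. c i \<noteq> \<zero>}"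

definition component :: "'a \<Rightarrow> nat \<Rightarrow> 'a" where
  "component x = (THE c. decomposition x c)"

lemma ex1_decomposition: "x \<in> carrier R \<Longrightarrow> \<exists>!c. decomposition x c"
  using graded by (simp add: graded_ring_def decomposition_def)

lemma decomposition_component: "x \<in> carrier R \<Longrightarrow> decomposition x (component x)"
  unfolding component_def by (rule theI'[OF ex1_decomposition])

lemma decomposition_finsum:
  assumes "\<And>i. c i \<in> A i" "finite F" "\<And>i. i \<notin> F \<Longrightarrow> c i = \<zero>"
  shows "decomposition (finsum R c F) c"
proof -
  have sub: "{i. c i \<noteq> \<zero>} \<subseteq> F" using assms(3) by blast
  have "finsum R c F = finsum R c {i. c i \<noteq> \<zero>}"
    by (rule add.finprod_mono_neutral_cong_right[OF assms(2) sub]) (use assms(1) graded_closed in auto)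
  then show ?thesis
    using assms(1) finite_subset[OF sub assms(2)] by (simp add: decomposition_def)
qed

lemma component_finsum:
  assumes "\<And>i. c i \<in> A i" "finite F" "\<And>i. i \<notin> F \<Longrightarrow> c i = \<zero>"
  shows "component (finsum R c F) = c"
proof -
  have "finsum R c F \<in> carrier R" by (rule finsum_closed) (use assms(1) graded_closed in auto)
  moreover have "decomposition (finsum R c F) c"
    by (rule decomposition_finsum) (use assms in auto)
  ultimately show ?thesis
    unfolding component_def using ex1_decomposition the1_equality by metis
qed

lemma component_cases:
  assumes "x \<in> carrier R"
  obtains F where "finite F" "\<And>i. component x i \<in> A i" "\<And>i. i \<notin> F \<Longrightarrow> component x i = \<zero>"
    "x = finsum R (component x) F"
proof
  note dec = decomposition_component[OF assms, unfolded decomposition_def]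
  show "finite {i. component x i \<noteq> \<zero>}" "x = finsum R (component x) {i. component x i \<noteq> \<zero>}"
    "component x i \<in> A i" for i using dec by blast+
qed simp

lemma component_add:
  assumes x: "x \<in> carrier R" and y: "y \<in> carrier R"
  shows "component (x \<oplus> y) i = component x i \<oplus> component y i"
proof -
  obtain F where F: "finite F" "\<And>i. component x i \<in> A i" "\<And>i. i \<notin> F \<Longrightarrow> component x i = \<zero>"
    "x = finsum R (component x) F" using component_cases[OF x] by blast
  obtain G where G: "finite G" "\<And>i. component y i \<in> A i" "\<And>i. i \<notin> G \<Longrightarrow> component y i = \<zero>"
    "y = finsum R (component y) G" using component_cases[OF y] by blast
  have cl: "component x i \<in> carrier R" "component y i \<in> carrier R" for i
    using graded_closed F(2) G(2) by blast+
  have "finsum R (component x) (F \<union> G) = finsum R (component x) F"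
    by (rule add.finprod_mono_neutral_cong_right) (use F(1,3) G(1) cl in auto)
  also have "\<dots> = x" by (rule F(4)[symmetric])
  finally have "finsum R (component x) (F \<union> G) = x" .
  moreover have "finsum R (component y) (F \<union> G) = finsum R (component y) G"
    by (rule add.finprod_mono_neutral_cong_right) (use G(1,3) F(1) cl in auto)
  then have "finsum R (component y) (F \<union> G) = y" using G(4) by metis
  moreover have "finsum R (\<lambda>i. component x i \<oplus> component y i) (F \<union> G) =
      finsum R (component x) (F \<union> G) \<oplus> finsum R (component y) (F \<union> G)"
    by (rule finsum_addf) (use cl in auto)
  moreover have "component (finsum R (\<lambda>i. component x i \<oplus> component y i) (F \<union> G)) = (\<lambda>i. component x i \<oplus> component y i)"
    by (rule component_finsum) (use F(1-3) G(1-3) graded_add in auto)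
  ultimately show ?thesis by metis
qed

lemma component_mult:
  assumes b: "b \<in> A j" and x: "x \<in> carrier R"
  shows "component (b \<otimes> x) k = (if j \<le> k then b \<otimes> component x (k - j) else \<zero>)"
proof -
  obtain F where F: "finite F" "\<And>i. component x i \<in> A i" "\<And>i. i \<notin> F \<Longrightarrow> component x i = \<zero>"
    "x = finsum R (component x) F" using component_cases[OF x] by blast
  define c where "c k = (if j \<le> k then b \<otimes> component x (k - j) else \<zero>)" for k
  have bR: "b \<in> carrier R" by (rule graded_closed[OF b])
  have cA: "c k \<in> A k" for k
    using graded_mult[OF b F(2)[of "k - j"]] graded_zero by (auto simp: c_def)
  \<comment> \<open>Shifted by \<open>j\<close>, a set supporting \<open>x\<close> supports
    \<open>b x\<close>.\<close>
  have "component (finsum R c ((+) j ` F)) = c"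
  proof (rule component_finsum[OF cA])
    fix k assume k: "k \<notin> (+) j ` F"
    show "c k = \<zero>"
    proof (cases "j \<le> k")
      case True
      then have "k - j \<notin> F" using k by (metis image_eqI le_add_diff_inverse)
      then show ?thesis using F(3) bR by (simp add: c_def)
    qed (simp add: c_def)
  qed (use F in simp)
  moreover have "finsum R c ((+) j ` F) = finsum R (\<lambda>i. c (j + i)) F"
    by (rule finsum_reindex) (use cA graded_closed in auto)
  moreover have "finsum R (\<lambda>i. c (j + i)) F = finsum R (\<lambda>i. b \<otimes> component x i) F"
    by (simp add: c_def)
  moreover have "finsum R (\<lambda>i. b \<otimes> component x i) F = b \<otimes> finsum R (component x) F"
    by (rule finsum_rdistr[symmetric]) (use F(1,2) bR graded_closed in auto)
  ultimately have "component (b \<otimes> x) = c" using F(4) by simp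
  then show ?thesis by (simp add: c_def)
qed

lemma component_homogeneous:
  assumes "a \<in> A j"
  shows "component a k = (if k = j then a else \<zero>)"
proof -
  have "component (finsum R (\<lambda>k. if k = j then a else \<zero>) {j}) = (\<lambda>k. if k = j then a else \<zero>)"
    by (rule component_finsum) (use assms graded_zero in auto)
  then show ?thesis using graded_closed[OF assms] by simp
qed

text \<open>The elements all of whose components lie in the ideal form an ideal containing
  \<open>S\<close>. For a homogeneous multiplier this is \<open>component_mult\<close>; a general
  one is decomposed into its components.\<close>

lemma component_in_homogeneous_ideal:
  assumes S: "S \<subseteq> homogeneous_elements A" and x: "x \<in> genideal R S"
  shows "component x i \<in> genideal R S"
proof -
  have SR: "S \<subseteq> carrier R" using S graded_closed by (auto simp: homogeneous_elements_def)
  interpret J: ideal "genideal R S" R by (rule genideal_ideal[OF SR])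
  let ?K = "{x \<in> carrier R. \<forall>i. component x i \<in> genideal R S}"
  have zero: "\<zero> \<in> ?K" using component_homogeneous[OF graded_zero[of 0]] by auto
  have add: "x \<oplus> y \<in> ?K" if "x \<in> ?K" "y \<in> ?K" for x y
    using that by (auto simp: component_add)
  have hom: "b \<otimes> x \<in> ?K" if "x \<in> ?K" "b \<in> A j" for b x j
    using that graded_closed[OF that(2)] J.I_l_closed by (auto simp: component_mult)
  have mult: "b \<otimes> x \<in> ?K" if x: "x \<in> ?K" and b: "b \<in> carrier R" for b x
  proof -
    obtain F where F: "finite F" "\<And>i. component b i \<in> A i" "\<And>i. i \<notin> F \<Longrightarrow> component b i = \<zero>"
      "b = finsum R (component b) F"
      using component_cases[OF b] by blast
    have "finsum R (component b) G \<otimes> x \<in> ?K" if "finite G" for G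
      using that
    proof (induction G rule: finite_induct)
      case empty
      then show ?case using x zero by simp
    next
      case (insert k G)
      have cl: "component b i \<in> carrier R" for i using graded_closed[OF F(2)] .
      have "finsum R (component b) G \<in> carrier R" by (rule finsum_closed) (use cl in auto)
      then have "finsum R (component b) (insert k G) \<otimes> x = component b k \<otimes> x \<oplus> finsum R (component b) G \<otimes> x"
        using insert(1,2) cl x by (simp add: l_distr Pi_def)
      then show ?case using add[OF hom[OF x F(2)] insert(3)] by simp
    qed
    from this[OF F(1)] show ?thesis unfolding F(4)[symmetric] .
  qed
  have "ideal ?K R"
  proof (rule idealI)
    show "subgroup ?K (add_monoid R)"
    proof (rule add.subgroupI)
      fix x assume x: "x \<in> ?K"
      then have "\<ominus> x = (\<ominus> \<one>) \<otimes> x" by (auto simp: l_minus)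
      then show "\<ominus> x \<in> ?K" using mult[OF x, of "\<ominus> \<one>"] by simp
    next
      show "?K \<noteq> {}" using zero by blast
    next
      fix x y assume "x \<in> ?K" "y \<in> ?K"
      then show "x \<oplus> y \<in> ?K" by (rule add)
    qed simp
  next
    fix x b assume x: "x \<in> ?K" and b: "b \<in> carrier R"
    show "b \<otimes> x \<in> ?K" by (rule mult[OF x b])
    then show "x \<otimes> b \<in> ?K" using x b by (simp add: m_comm)
  qed (rule ring_axioms)
  moreover have "S \<subseteq> ?K"
  proof
    fix s assume s: "s \<in> S"
    then obtain j where "s \<in> A j" using S by (auto simp: homogeneous_elements_def)
    then show "s \<in> ?K" using genideal_self[OF SR] s SR by (auto simp: component_homogeneous)
  qed
  ultimately show ?thesis using genideal_minimal[of ?K S] x by blast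
qed

end

text \<open>Since \<open>1 - r\<close> lies in the maximal ideal, \<open>r\<close> is a unit and can
  be cancelled from \<open>a^n r\<close>.\<close>

lemma local_ideal_subset_radical:
  fixes R (structure)
  assumes loc: "noetherian_local_ring R" and I: "ideal I R" "I \<noteq> carrier R" and J: "ideal J R"
    and r: "r \<in> carrier R" "\<one>\<^bsub>R\<^esub> \<ominus>\<^bsub>R\<^esub> r \<in> I"
    and pow: "\<And>a. a \<in> I \<Longrightarrow> \<exists>n::nat. a [^]\<^bsub>R\<^esub> n \<otimes>\<^bsub>R\<^esub> r \<in> J"
  shows "I \<subseteq> radical R J"
proof
  interpret cring R using loc by (simp add: noetherian_local_ring_def)
  interpret I: ideal I R by (rule I)
  interpret J: ideal J R by (rule J)
  have "\<one> \<notin> I" using I.one_imp_carrier I(2) by blast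
  moreover have "(\<one> \<ominus> r) \<oplus> r = \<one>" using r(1) by (simp add: a_minus_def a_assoc l_neg)
  ultimately obtain s where s: "s \<in> carrier R" "s \<otimes> r = \<one>"
    using local_ring_unit[OF loc I(1) _ r] by blast
  fix a assume a: "a \<in> I"
  then have aR: "a \<in> carrier R" by (rule I.Icarr)
  obtain n :: nat where "a [^] n \<otimes> r \<in> J" using pow[OF a] by blast
  then have "s \<otimes> (a [^] n \<otimes> r) \<in> J" using s(1) by (rule J.I_l_closed)
  moreover have "s \<otimes> (a [^] n \<otimes> r) = a [^] n \<otimes> (s \<otimes> r)" using s(1) aR r(1) by (simp add: m_lcomm)
  ultimately show "a \<in> radical R J" using s aR by (auto simp: radical_def)
qed

text \<open>In a graded ring \<open>r\<close> need not be a unit, but its degree zero component is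
  one, because \<open>A 0\<close> is local. For \<open>a\<close> of degree \<open>j\<close>, the
  component of \<open>a^n r\<close> in degree \<open>n j\<close> is \<open>a^n\<close> times that
  unit, and it stays in the ideal because \<open>S\<close> is homogeneous.\<close>

lemma graded_ideal_subset_radical:
  fixes R (structure)
  assumes gr: "standard_graded_ring R A" and hI: "homogeneous_ideal R A I" and I: "I \<noteq> carrier R"
    and S: "S \<subseteq> homogeneous_elements A"
    and r: "r \<in> carrier R" "\<one>\<^bsub>R\<^esub> \<ominus>\<^bsub>R\<^esub> r \<in> I"
    and pow: "\<And>a. a \<in> I \<Longrightarrow> \<exists>n::nat. a [^]\<^bsub>R\<^esub> n \<otimes>\<^bsub>R\<^esub> r \<in> genideal R S"
  shows "I \<subseteq> radical R (genideal R S)"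
proof -
  have g: "graded_ring R A" and loc: "noetherian_local_ring (R\<lparr>carrier := A 0\<rparr>)"
    using gr by (auto simp: standard_graded_ring_def)
  have R: "cring R" using g by (simp add: graded_ring_def)
  interpret cring R by (rule R)
  have iI: "ideal I R" and gen: "I = genideal R (I \<inter> homogeneous_elements A)"
    using hI by (auto simp: homogeneous_ideal_def)
  interpret I: ideal I R by (rule iI)
  have SR: "S \<subseteq> carrier R" using S graded_closed[OF g] by (auto simp: homogeneous_elements_def)
  interpret J: ideal "genideal R S" R by (rule genideal_ideal[OF SR])
  let ?c = "component R A"
  let ?r = "?c r 0" and ?q = "?c (\<one> \<ominus> r) 0"
  have c0: "?c x 0 \<in> A 0" if "x \<in> carrier R" for x
    using component_cases[OF g that] by metis
  have q: "?q \<in> I"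
    using component_in_homogeneous_ideal[OF g, of "I \<inter> homogeneous_elements A" "\<one> \<ominus> r"] r(2) gen by auto
  have "(\<one> \<ominus> r) \<oplus> r = \<one>" using r(1) by (simp add: a_minus_def a_assoc l_neg)
  then have qr: "?q \<oplus> ?r = \<one>"
    using component_add[OF g, of "\<one> \<ominus> r" r 0] r(1) component_homogeneous[OF g graded_one[OF g], of 0] by simp
  interpret R0: cring "R\<lparr>carrier := A 0\<rparr>" using loc by (simp add: noetherian_local_ring_def)
  have "ideal (I \<inter> A 0) (R\<lparr>carrier := A 0\<rparr>)"
  proof (rule idealI)
    show "ring (R\<lparr>carrier := A 0\<rparr>)" by (rule R0.ring_axioms)
    show "subgroup (I \<inter> A 0) (add_monoid (R\<lparr>carrier := A 0\<rparr>))"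
    proof (rule R0.add.subgroupI)
      have "\<zero> \<in> I \<inter> A 0" using graded_zero[OF g] I.zero_closed by blast
      then show "I \<inter> A 0 \<noteq> {}" by blast
    next
      fix x assume x: "x \<in> I \<inter> A 0"
      have "\<ominus> x \<in> A 0" using additive_subgroup.a_inv_closed[OF graded_subgroup[OF g]] x by blast
      moreover from this have "\<ominus>\<^bsub>R\<lparr>carrier := A 0\<rparr>\<^esub> x = \<ominus> x"
        using R0.minus_equality[of "\<ominus> x" x] x graded_closed[OF g] l_neg[of x] by simp
      ultimately show "\<ominus>\<^bsub>R\<lparr>carrier := A 0\<rparr>\<^esub> x \<in> I \<inter> A 0" using x by simp
    qed (use graded_add[OF g] in auto)
    fix a x assume "a \<in> I \<inter> A 0" "x \<in> carrier (R\<lparr>carrier := A 0\<rparr>)"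
    then show "x \<otimes>\<^bsub>R\<lparr>carrier := A 0\<rparr>\<^esub> a \<in> I \<inter> A 0" "a \<otimes>\<^bsub>R\<lparr>carrier := A 0\<rparr>\<^esub> x \<in> I \<inter> A 0"
      using graded_mult[OF g, of _ 0 _ 0] graded_closed[OF g] I.I_l_closed I.I_r_closed by auto
  qed
  moreover have "\<one> \<notin> I" using I.one_imp_carrier I by blast
  ultimately obtain s where s: "s \<in> A 0" "s \<otimes> ?r = \<one>"
    using local_ring_unit[OF loc, of "I \<inter> A 0" ?r ?q] c0[OF r(1)] c0[of "\<one> \<ominus> r"] r(1) q qr by auto
  have sR: "s \<in> carrier R" and rR: "?r \<in> carrier R"
    using graded_closed[OF g s(1)] graded_closed[OF g c0[OF r(1)]] .
  \<comment> \<open>Homogeneous elements suffice, as they generate \<open>I\<close> and the radical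
    is an ideal.\<close>
  have "I \<inter> homogeneous_elements A \<subseteq> radical R (genideal R S)"
  proof
    fix a assume a: "a \<in> I \<inter> homogeneous_elements A"
    then obtain j where j: "a \<in> A j" by (auto simp: homogeneous_elements_def)
    have aR: "a \<in> carrier R" by (rule graded_closed[OF g j])
    obtain n :: nat where n: "a [^] n \<otimes> r \<in> genideal R S" using pow a by blast
    have "?c (a [^] n \<otimes> r) (n * j) = a [^] n \<otimes> ?r"
      using component_mult[OF g graded_pow[OF g j, of n] r(1), of "n * j"] by simp
    then have "a [^] n \<otimes> ?r \<in> genideal R S"
      using component_in_homogeneous_ideal[OF g S n, of "n * j"] by simp
    then have "s \<otimes> (a [^] n \<otimes> ?r) \<in> genideal R S" using sR by (rule J.I_l_closed)
    moreover have "s \<otimes> (a [^] n \<otimes> ?r) = a [^] n \<otimes> (s \<otimes> ?r)" using sR aR rR by (simp add: m_lcomm)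
    ultimately show "a \<in> radical R (genideal R S)" using s aR by (auto simp: radical_def)
  qed
  then show ?thesis
    using genideal_minimal[OF radical_ideal[OF R J.is_ideal]] gen by blast
qed

theorem theorem6p2:
  fixes R :: "('a, 'z) ring_scheme"
    and I :: "'a set"
    and f g h :: 'a
    and E :: "nat \<Rightarrow> ('a, 'e) module"
    and d :: "nat \<Rightarrow> 'e \<Rightarrow> 'e"
    and e :: "'a \<Rightarrow> 'e"
    and M :: "('a, 'e set) module"
  assumes "noetherian_local_ring R \<or>
           (\<exists>A. standard_graded_ring R A \<and> homogeneous_ideal R A I \<and>
                {f, g, h} \<subseteq> homogeneous_elements A)"
    and "ideal I R" and "I \<noteq> carrier R"
    and "f \<in> I" and "g \<in> I" and "h \<in> I"
    and "regular_sequence R [f, h]"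
    and "injective_resolution R (self_module R) E d e"
    and "\<forall>i>2. zero_module (local_cohomology R I E d i)"
    and "M = local_cohomology R I E d 2"
  shows "radical R I = radical R (genideal R {f, g, h}) \<longleftrightarrow>
         (\<forall>i\<ge>2. zero_module (koszul_cohomology R [f, g, h] M i))"
proof -
  have R: "cring R" "noetherian_ring R"
    using assms(1) by (auto simp: noetherian_local_ring_def standard_graded_ring_def graded_ring_def)
  interpret cring R by (rule R)
  interpret I: ideal I R by fact
  note E = assms(8)
  have Ec: "cochain_complex R E d" by (rule injective_resolution_complex[OF E])
  let ?J = "[f, g, h]"
  have fgh: "f \<in> carrier R" "g \<in> carrier R" "h \<in> carrier R" using assms(4-6) I.Icarr by auto
  then have J: "set ?J \<subseteq> carrier R" by simp
  have JI: "{f, g, h} \<subseteq> I" using assms(4-6) by simp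
  interpret J: ideal "genideal R {f, g, h}" R by (rule genideal_ideal) (use fgh in simp)
  have JI': "genideal R {f, g, h} \<subseteq> I" by (rule genideal_minimal[OF assms(2) JI])
  obtain T where T: "T \<subseteq> carrier R" "finite T" "I = genideal R T"
    using noetherian_ring.finetely_gen[OF R(2) assms(2)] by blast
  obtain bs where bs: "set bs = T" using finite_list[OF T(2)] by blast
  \<comment> \<open>The elements \<open>f\<close>, \<open>g\<close>, \<open>h\<close> are put among
    the generators of \<open>I\<close>: regularity of \<open>f, h\<close> then applies to
    \<open>?S\<close>-torsion, and the list splits into \<open>?J\<close> and the elements
    \<open>bs\<close> adjoined to it.\<close>
  let ?S = "set (bs @ ?J)"
  have TI: "T \<subseteq> I" using T genideal_self by blast
  have S: "?S \<subseteq> I" "?S \<subseteq> carrier R" using TI JI bs I.Icarr by auto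
  interpret G: ideal "genideal R ?S" R by (rule genideal_ideal[OF S(2)])
  have "T \<subseteq> genideal R ?S" using genideal_self[OF S(2)] bs by auto
  then have IG: "I = genideal R ?S"
    using genideal_minimal[OF G.is_ideal] genideal_minimal[OF assms(2) S(1)] T(3) by blast
  let ?C = "\<lambda>i. element_torsion R ?S (E i)"
  have tor: "torsion R I (E i) = ?C i" for i
  proof (rule torsion_eq_element_torsion[OF injective_resolutionD(2)[OF E] assms(2) _ S(1) _ R(2)])
    fix a assume "a \<in> I"
    then have "a [^]\<^bsub>R\<^esub> (1::nat) \<in> genideal R ?S" using IG I.Icarr by simp
    then show "\<exists>n::nat. a [^]\<^bsub>R\<^esub> n \<in> genideal R ?S" by blast
  qed simp
  have lc: "local_cohomology R I E d i = cohomology ?C d i" for i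
    by (simp only: local_cohomology_def tor)
  have Cc: "cochain_complex R ?C d" by (rule element_torsion_complex[OF Ec S(2)])
  have high: "x \<in> d i ` carrier (?C i)"
    if i: "2 \<le> i" and x: "x \<in> carrier (?C (Suc i))" "d (Suc i) x = \<zero>\<^bsub>?C (Suc (Suc i))\<^esub>" for i x
  proof -
    have grp: "abelian_group (?C j)" for j
      using cochain_complex.abelian_group_C[OF Cc, of j] .
    have dC: "d i y \<in> carrier (?C (Suc i))" if "y \<in> carrier (?C i)" for y
      using cochain_complex.d_closed[OF Cc that] .
    have dadd: "d i (y \<oplus>\<^bsub>?C i\<^esub> z) = d i y \<oplus>\<^bsub>?C (Suc i)\<^esub> d i z" if "y \<in> carrier (?C i)" "z \<in> carrier (?C i)" for y z
      using cochain_complex.d_add[OF Cc that] .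
    have "zero_module (cohomology ?C d (Suc i))" using assms(9) i unfolding lc by simp
    moreover have "subgroup (coboundaries ?C d (Suc i)) (add_monoid (?C (Suc i)))"
      unfolding coboundaries_def nat.case
      using subgroup_image[OF grp[of i] grp[of "Suc i"], of "d i"] dC dadd by blast
    moreover have xc: "x \<in> cocycles ?C d (Suc i)" using x by (simp only: cocycles_def mem_Collect_eq simp_thms)
    ultimately have "cocycles ?C d (Suc i) \<subseteq> coboundaries ?C d (Suc i)"
      using zero_cohomology_iff[of ?C "Suc i" d, OF grp] by blast
    then show ?thesis using xc unfolding coboundaries_def nat.case by blast
  qed
  note low = torsion_low_cohomology[OF R(1) E assms(7) S(2)]
  have fhS: "f \<in> ?S" "h \<in> ?S" by simp_all
  have M: "M = cohomology ?C d 2" using assms(10) lc by simp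
  have "module R M" unfolding M numeral_2_eq_2 by (rule cohomology_module[OF Cc])
  note three = koszul_cohomology_three_iff[OF this fgh]
  have pd: "pad_diff ?C d = pad_diff E d" by (rule pad_diff_cong) simp
  have "syzygy_conditions f g h M \<longleftrightarrow> exact_from_three (koszul ?J (leaves (pad ?C)))
      (koszul_diff ?J (leaves (pad ?C)) (leaf_diff (pad_diff ?C d)))"
  proof (rule syzygy_conditions_iff_exact[OF Cc _ _ high M fgh])
    show "x = \<zero>\<^bsub>?C 0\<^esub>" if "x \<in> carrier (?C 0)" "d 0 x = \<zero>\<^bsub>?C 1\<^esub>" for x
      using low(1)[OF fhS that(1)] that(2) by simp
    show "x \<in> d 0 ` carrier (?C 0)" if "x \<in> carrier (?C 1)" "d 1 x = \<zero>\<^bsub>?C 2\<^esub>" for x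
      using low(2)[OF fhS that(1)] that(2) by simp
  qed
  then have iff: "(\<forall>i\<ge>2. zero_module (koszul_cohomology R ?J M i)) \<longleftrightarrow>
      exact_from_three (koszul ?J (leaves (pad ?C))) (koszul_diff ?J (leaves (pad ?C)) (leaf_diff (pad_diff E d)))"
    unfolding three pd .
  show ?thesis
    unfolding iff
  proof
    assume rad: "radical R I = radical R (genideal R {f, g, h})"
    have pow: "\<exists>n::nat. a [^]\<^bsub>R\<^esub> n \<in> genideal R (set ?J)" if a: "a \<in> I" for a
    proof -
      have "a [^]\<^bsub>R\<^esub> (1::nat) \<in> I" using a I.Icarr by simp
      then have "a \<in> radical R I" using I.Icarr[OF a] unfolding radical_def by blast
      then have "a \<in> radical R (genideal R {f, g, h})" unfolding rad .
      then show ?thesis unfolding radical_def by simp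
    qed
    \<comment> \<open>Equal radicals give equal torsion submodules, so the same complex can be built
      from \<open>?J\<close> alone, as \<open>koszul_exact_of_torsion\<close> requires.\<close>
    have "torsion R I (E i) = element_torsion R (set ?J) (E i)" for i
      by (rule torsion_eq_element_torsion[OF injective_resolutionD(2)[OF E] assms(2) _ _ pow R(2)])
        (use JI in auto)
    then have "?C = (\<lambda>i. element_torsion R (set ?J) (E i))" using tor by metis
    then show "exact_from_three (koszul ?J (leaves (pad ?C))) (koszul_diff ?J (leaves (pad ?C)) (leaf_diff (pad_diff E d)))"
      using koszul_exact_of_torsion[OF R E J] by (simp only:)
  next
    assume ex: "exact_from_three (koszul ?J (leaves (pad ?C))) (koszul_diff ?J (leaves (pad ?C)) (leaf_diff (pad_diff E d)))"
    have bsR: "set bs \<subseteq> carrier R" using bs T(1) by simp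
    obtain r where r: "r \<in> carrier R" "\<one>\<^bsub>R\<^esub> \<ominus>\<^bsub>R\<^esub> r \<in> I"
      and pow: "\<And>a. a \<in> ?S \<Longrightarrow> \<exists>n::nat. a [^]\<^bsub>R\<^esub> n \<otimes>\<^bsub>R\<^esub> r \<in> genideal R (set ?J)"
      using torsion_lift_of_one[OF R E bsR J ex] unfolding IG[symmetric] by blast
    \<comment> \<open>The torsion of \<open>r\<close> modulo \<open>(f, g, h)\<close> is known for
      the generators in \<open>?S\<close> only. As the radical of this colon ideal is an ideal, it
      contains all of \<open>I\<close> once it contains them.\<close>
    let ?K = "{s \<in> carrier R. s \<otimes>\<^bsub>R\<^esub> r \<in> genideal R {f, g, h}}"
    have K: "ideal ?K R" by (rule colon_ideal[OF R(1) J.is_ideal r(1)])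
    have "?S \<subseteq> radical R ?K"
    proof
      fix a assume a: "a \<in> ?S"
      have aR: "a \<in> carrier R" using a S(2) by blast
      obtain n :: nat where "a [^]\<^bsub>R\<^esub> n \<otimes>\<^bsub>R\<^esub> r \<in> genideal R {f, g, h}" using pow[OF a] by auto
      then have "a [^]\<^bsub>R\<^esub> n \<in> ?K" using aR by simp
      then show "a \<in> radical R ?K" using aR unfolding radical_def by blast
    qed
    then have IK: "I \<subseteq> radical R ?K"
      using genideal_minimal[OF radical_ideal[OF R(1) K]] IG by blast
    have pow': "\<exists>n::nat. a [^]\<^bsub>R\<^esub> n \<otimes>\<^bsub>R\<^esub> r \<in> genideal R {f, g, h}" if "a \<in> I" for a
      using IK that by (auto simp: radical_def)
    have "I \<subseteq> radical R (genideal R {f, g, h})"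
      using assms(1)
    proof
      assume "noetherian_local_ring R"
      then show ?thesis by (rule local_ideal_subset_radical[OF _ assms(2,3) J.is_ideal r pow'])
    next
      assume "\<exists>A. standard_graded_ring R A \<and> homogeneous_ideal R A I \<and> {f, g, h} \<subseteq> homogeneous_elements A"
      then obtain A where A: "standard_graded_ring R A" "homogeneous_ideal R A I"
        "{f, g, h} \<subseteq> homogeneous_elements A" by blast
      show ?thesis by (rule graded_ideal_subset_radical[OF A(1,2) assms(3) A(3) r pow'])
    qed
    note sub = this
    show "radical R I = radical R (genideal R {f, g, h})"
    proof
      show "radical R (genideal R {f, g, h}) \<subseteq> radical R I"
        using JI' by (auto simp: radical_def)
      show "radical R I \<subseteq> radical R (genideal R {f, g, h})"
      proof
        fix a assume "a \<in> radical R I"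
        then obtain n where a: "a \<in> carrier R" "a [^]\<^bsub>R\<^esub> (n::nat) \<in> I" by (auto simp: radical_def)
        then have "a [^]\<^bsub>R\<^esub> n \<in> radical R (genideal R {f, g, h})" using sub by blast
        then obtain k where "(a [^]\<^bsub>R\<^esub> n) [^]\<^bsub>R\<^esub> (k::nat) \<in> genideal R {f, g, h}"
          unfolding radical_def by blast
        then have "a [^]\<^bsub>R\<^esub> (n * k) \<in> genideal R {f, g, h}" using a by (simp add: nat_pow_pow)
        then show "a \<in> radical R (genideal R {f, g, h})" using a unfolding radical_def by blast
      qed
    qed
  qed
qed

end
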